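(* The following hold for all $r>0$, $a>0$ and $T>0$. (i) There are $C=C(n)>0$ and $\theta=\theta(n)\in(0,1)$, depending only on $n$ (in particular not on $r,a,T$), such that for all $u_0\in C_0^\infty(\mathbb R^n;\mathbb C)$, $$\int_{\mathbb R^n}|u_0(x)|^2\,dx\le C\Big(1+\frac{r^n}{(aT)^n}\Big)\Big(\int_{B_r^c(0)}|u(x,T;u_0)|^2\,dx\Big)^{\theta^{1+\frac{r}{aT}}}\Big(\int_{\mathbb R^n}e^{a|x|}|u_0(x)|^2\,dx\Big)^{1-\theta^{1+\frac{r}{aT}}}.$$ (ii) There is $C=C(n)>0$, depending only on $n$, such that for any $\beta>1$ and $\gamma\in(0,1)$, and all $u_0\in C_0^\infty(\mathbb R^n;\mathbb C)$, $$\int_{\mathbb R^n}|u_0(x)|^2\,dx\le C e^{\left(\frac{C^\beta r^\beta}{a(1-\gamma)T^\beta}\right)^{\frac1{\beta-1}}}\Big(\int_{B_r^c(0)}|u(x,T;u_0)|^2\,dx\Big)^{\gamma}\Big(\int_{\mathbb R^n}e^{a|x|^\beta}|u_0(x)|^2\,dx\Big)^{1-\gamma}.$$ (iii) Let $\alpha(s)$, $s\in\mathbb R^+$, be an increasing function with $\lim_{s\to\infty}\frac{\alpha(s)}{s}=0$. Then for each $\gamma\in(0,1)$ there is no positive constant $C$ such that $$\int_{\mathbb R^n}|u_0(x)|^2\,dx\le C\Big(\int_{B_r^c(0)}|u(x,T;u_0)|^2\,dx\Big)^{\gamma}\Big(\int_{\mathbb R^n}e^{a\alpha(|x|)}|u_0(x)|^2\,dx\Big)^{1-\gamma}$$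 for all $u_0\in C_0^\infty(\mathbb R^n;\mathbb C)$.
   Context: Here $n\in\{1,2,\dots\}$ is fixed. For $u_0\in L^2(\mathbb R^n;\mathbb C)$ and $t\ge 0$, $u(x,t;u_0)=(e^{i\Delta t}u_0)(x)$ denotes the solution of the free Schrödinger equation $i\partial_t u+\Delta u=0$ in $\mathbb R^n\times(0,\infty)$ with $u(x,0)=u_0(x)$. $B_r(x)$ is the closed ball in $\mathbb R^n$ centered at $x$ of radius $r$, and $B_r^c(x)$ is its complement in $\mathbb R^n$. $|x|$ is the Euclidean norm. *)

theory Defs
  imports "HOL-Analysis.Analysis"
begin

text \<open>C^k on the whole space, by iterating directional derivatives: taking
  \<open>v\<close> over all directions (not only coordinate ones) keeps the codomain fixed.\<close>

fun Ck :: "nat \<Rightarrow> ('a::euclidean_space \<Rightarrow> 'b::real_normed_vector) \<Rightarrow> bool" where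
  "Ck 0 f \<longleftrightarrow> continuous_on UNIV f"
| "Ck (Suc k) f \<longleftrightarrow>
     (\<forall>x. f differentiable (at x)) \<and> (\<forall>v. Ck k (\<lambda>x. frechet_derivative f (at x) v))"

definition smooth :: "('a::euclidean_space \<Rightarrow> 'b::real_normed_vector) \<Rightarrow> bool" where
  "smooth f \<longleftrightarrow> (\<forall>k. Ck k f)"

definition Cc_infinity :: "('a::euclidean_space \<Rightarrow> 'b::real_normed_vector) set" where
  "Cc_infinity = {f. smooth f \<and> compact (closure {x. f x \<noteq> 0})}"

text \<open>The unitary Fourier transform. It is only meaningful for integrable \<open>f\<close>
  (elsewhere the Bochner integral is 0 by convention), in particular on \<open>Cc_infinity\<close>,
  where its values are Schwartz functions.\<close>

definition fourier :: "(real ^ 'n \<Rightarrow> complex) \<Rightarrow> real ^ 'n \<Rightarrow> complex" where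
  "fourier f \<xi> =
     complex_of_real ((2 * pi) powr (- (real CARD('n) / 2))) *
     (LINT x|lborel. cis (- (x \<bullet> \<xi>)) * f x)"

text \<open>The free Schroedinger group: \<open>schroedinger t u0\<close> is
  $e^{i \Delta t} u_0$, i.e. the Fourier multiplier with symbol $e^{-i t |\xi|^2}$, so that
  \<open>\<lambda>x t. schroedinger t u0 x\<close> is the solution of $i \partial_t u + \Delta u = 0$,
  $u(x,0) = u_0(x)$. For \<open>u0 \<in> Cc_infinity\<close> both integrals involved converge absolutely, so
  no extension by density to $L^2$ is needed there; on other data the formula need not be
  the $L^2$ group.\<close>

definition schroedinger :: "real \<Rightarrow> (real ^ 'n \<Rightarrow> complex) \<Rightarrow> real ^ 'n \<Rightarrow> complex" where
  "schroedinger t u0 x =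
     complex_of_real ((2 * pi) powr (- (real CARD('n) / 2))) *
     (LINT \<xi>|lborel. cis (x \<bullet> \<xi>) * (cis (- (t * (norm \<xi>)\<^sup>2)) * fourier u0 \<xi>))"

end

theory Submission
  imports Defs "HOL-Complex_Analysis.Complex_Analysis" "HOL-Probability.Probability"
begin

text \<open>
  Up to unimodular factors, $e^{iT\Delta}u_0$ is the Fourier transform of \<open>u0\<close> times the chirp
  $e^{i|y|^2/(4T)}$, at frequency $x/(2T)$ (\<open>norm_schroedinger\<close>). The chirp does not change
  $|u_0|$. So the theorem is about a function \<open>g\<close> with a weighted bound and its Fourier transform \<open>F\<close>: how much of
  the energy of \<open>F\<close> can hide in a ball?

  An exponential weight on \<open>g\<close> means that \<open>F\<close> continues analytically to a strip, with bounds for its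
  \<open>L\<^sup>2\<close> norm on every horizontal slice, by Plancherel's identity. Both positive parts follow from a
  two-constants theorem in one complex variable, applied to the scalar function
  $h(z) = \int_{B_r} F(x + z b)\,\overline{F(x)}\,dx$ with a unit vector \<open>b\<close>: at 0 it is the energy in the
  ball, for large real \<open>z\<close> it is controlled by the energy outside, because the translated ball has left the
  ball, and in the strip it is controlled by the weighted norm (\<open>energy_interpolation\<close>).

  For the weight $e^{a|x|}$ the strip has the fixed half-width $aT$ and \<open>h\<close> is small only beyond a
  distance of order \<open>r\<close>; smallness is propagated to the origin in about $r/(aT)$ steps, each of
  which halves the exponent (\<open>two_constants_one_ray\<close>). For the weight $e^{a|x|^\beta}$ with
  $\beta > 1$ the strip may be taken as wide as one likes, and the explicit harmonic majorant
  $\mathrm{Re}\sqrt{\rho^2-z^2}/Y$ gives every exponent below 1 in a single step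
  (\<open>two_constants_two_rays\<close>).

  A sublinear exponent does not suffice: wide Gaussians have a transform concentrated at
  the origin so strongly that the weight cannot compensate (\<open>no_sublinear_weight\<close>). These Gaussians are
  approximated by truncated ones, which are smooth and of compact support.
\<close>

section \<open>Two-constants theorems for a strip\<close>

lemma Re_sin_at_right_angle:
  assumes "\<bar>Re z\<bar> = pi/2"
  shows "Im (sin z) = 0" "\<bar>Re (sin z)\<bar> \<ge> 1" "Re (cos z) = 0"
proof -
  have c: "cos (Re z) = 0" and s: "\<bar>sin (Re z)\<bar> = 1"
  proof -
    have "Re z = pi/2 \<or> Re z = -(pi/2)" using assms by linarith
    then show "cos (Re z) = 0" "\<bar>sin (Re z)\<bar> = 1"
      by (elim disjE; simp only: cos_pi_half cos_minus sin_pi_half sin_minus abs_minus abs_one)+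
  qed
  show "Im (sin z) = 0" "Re (cos z) = 0" using c by (simp_all add: Im_sin Re_cos)
  have "1 \<le> (exp (Im z) + exp (-(Im z))) / 2"
    using cosh_real_ge_1[of "Im z"] by (simp add: cosh_def)
  then show "\<bar>Re (sin z)\<bar> \<ge> 1" using s by (simp add: Re_sin abs_mult)
qed

lemma abs_le_abs_sinh: "\<bar>y\<bar> \<le> \<bar>exp y - exp (-y)\<bar> / 2" for y :: real
proof -
  have *: "t \<le> (exp t - exp (-t)) / 2" if "t \<ge> 0" for t :: real
  proof -
    have "0 \<le> (exp t - exp (-t)) / 2 - t"
      using DERIV_nonneg_imp_nondecreasing[of 0 t "\<lambda>t. (exp t - exp (-t)) / 2 - t"] that
    proof -
      have "\<exists>y. ((\<lambda>t. (exp t - exp (-t)) / 2 - t) has_real_derivative y) (at x) \<and> 0 \<le> y" for x :: real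
        using cosh_real_ge_1[of x]
        by (intro exI[of _ "(exp x + exp (-x)) / 2 - 1"]) (auto simp: cosh_def intro!: derivative_eq_intros)
      then show ?thesis
        using DERIV_nonneg_imp_nondecreasing[of 0 t "\<lambda>t. (exp t - exp (-t)) / 2 - t"] that by auto
    qed
    then show ?thesis by simp
  qed
  show ?thesis using *[of y] *[of "-y"] by (cases "y \<ge> 0") auto
qed

lemma abs_Im_le_cmod_sin: "\<bar>Im z\<bar> \<le> cmod (sin z)"
proof -
  have "(exp (Im z) - exp (-(Im z)))\<^sup>2 / 4 \<le> (cmod (sin z))\<^sup>2"
  proof -
    have "(cmod (sin z))\<^sup>2 = (sin (Re z))\<^sup>2 * ((exp (Im z) + exp (-(Im z)))\<^sup>2 / 4) + (cos (Re z))\<^sup>2 * ((exp (Im z) - exp (-(Im z)))\<^sup>2 / 4)"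
      by (simp add: cmod_power2 Re_sin Im_sin power_mult_distrib power_divide)
    moreover have "(exp (Im z) + exp (-(Im z)))\<^sup>2 / 4 \<ge> (exp (Im z) - exp (-(Im z)))\<^sup>2 / 4"
      by (simp add: power2_eq_square algebra_simps)
    then have "(sin (Re z))\<^sup>2 * ((exp (Im z) + exp (-(Im z)))\<^sup>2 / 4) \<ge> (sin (Re z))\<^sup>2 * ((exp (Im z) - exp (-(Im z)))\<^sup>2 / 4)"
      by (intro mult_left_mono) auto
    moreover have "(sin (Re z))\<^sup>2 * X + (cos (Re z))\<^sup>2 * X = X" for X
      by (metis distrib_right mult_1 sin_cos_squared_add)
    ultimately show ?thesis by (metis add_le_cancel_right)
  qed
  then have "(\<bar>exp (Im z) - exp (-(Im z))\<bar> / 2)\<^sup>2 \<le> (cmod (sin z))\<^sup>2"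
    by (simp add: power_divide)
  then have "\<bar>exp (Im z) - exp (-(Im z))\<bar> / 2 \<le> cmod (sin z)"
    by (rule power2_le_imp_le) auto
  then show ?thesis using abs_le_abs_sinh[of "Im z"] by linarith
qed

lemma abs_Im_sin_le_Re_cos:
  assumes "\<bar>Re z\<bar> \<le> pi/2"
  shows "\<bar>Im (sin z)\<bar> \<le> Re (cos z)"
proof -
  have "cos (Re z) \<ge> 0" using assms by (intro cos_ge_zero) auto
  moreover have "\<bar>exp (Im z) - exp (-(Im z))\<bar> \<le> exp (Im z) + exp (-(Im z))"
    by (smt (verit) exp_gt_zero)
  ultimately show ?thesis
    by (simp add: Im_sin Re_cos abs_mult mult_left_mono)
qed

text \<open>The function
  $\mathrm{Re}\sqrt{\rho^2-z^2}$ is positive and harmonic in the plane slit along the two rays, vanishes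
  on the rays, is at least \<open>Y\<close> on the lines $|\mathrm{Im}\,z| = Y$ and equals \<open>\<rho>\<close> at the
  origin. Divided by \<open>Y\<close> it therefore majorises the harmonic measure of the two lines, and the
  two-constants theorem gives the exponent \<open>\<rho> / Y\<close> for the large bound. This linear dependence on
  \<open>\<rho> / Y\<close> is what makes the estimate sharp enough for weights that grow like a power.

  The substitution $z = \rho\sin\zeta$ opens the slits: it maps the strip $|\mathrm{Re}\,\zeta| < \pi/2$
  onto the slit plane and turns the square root into the entire function $\rho\cos\zeta$, so that no
  branch has to be chosen.\<close>

lemma two_constants_two_rays:
  fixes h :: "complex \<Rightarrow> complex"
  assumes hol: "h holomorphic_on UNIV"
    and \<rho>: "0 < \<rho>" and Y: "0 < Y" and e: "0 < e" "e \<le> M"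
    and strip: "\<And>z. \<bar>Im z\<bar> \<le> Y \<Longrightarrow> cmod (h z) \<le> M"
    and small: "\<And>s::real. \<bar>s\<bar> \<ge> \<rho> \<Longrightarrow> cmod (h (of_real s)) \<le> e"
  shows "cmod (h 0) \<le> e powr (1 - \<rho>/Y) * M powr (\<rho>/Y)"
proof -
  define l where "l = ln (M/e) / Y"
  have M: "M > 0" using e by simp
  have l: "l \<ge> 0" unfolding l_def using e Y by simp
  have bound: "cmod (h 0) * exp (- (l*\<rho>)) \<le> e * exp (d * Y\<^sup>2)" if d: "d > 0" for d
  proof -
    \<comment> \<open>The Gaussian factor of width \<open>1 / sqrt d\<close> is only there to cut the strip at \<open>|Re z| = X\<close>, where it has absorbed the quotient \<open>M / e\<close>; at the end \<open>d\<close> tends to 0.\<close>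
    define X where "X = sqrt (ln (M/e) / d) + 1"
    have X: "X > 0" unfolding X_def using e d by (intro add_nonneg_pos) auto
    have "(sqrt (ln (M/e) / d))\<^sup>2 \<le> X\<^sup>2" unfolding X_def using e d by (intro power_mono) auto
    then have "ln (M/e) / d \<le> X\<^sup>2" using e d by simp
    then have "ln (M/e) \<le> d * X\<^sup>2" using d by (simp add: field_simps)
    then have "exp (ln (M/e)) \<le> exp (d * X\<^sup>2)" by simp
    then have MX: "M * exp (-(d * X\<^sup>2)) \<le> e" using e M by (simp add: exp_minus field_simps)
    define w where "w = (\<lambda>z. of_real \<rho> * sin z :: complex)"
    define k where "k = (\<lambda>z. h (w z) * exp (- (of_real (l*\<rho>) * cos z)) * exp (- (of_real d * (w z)\<^sup>2)))"
    define S where "S = {z. \<bar>Re z\<bar> < pi/2 \<and> \<bar>Im (w z)\<bar> < Y \<and> \<bar>Re (w z)\<bar> < X}"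
    define S' where "S' = {z. \<bar>Re z\<bar> \<le> pi/2 \<and> \<bar>Im (w z)\<bar> \<le> Y \<and> \<bar>Re (w z)\<bar> \<le> X}"
    have cw: "continuous_on A w" for A unfolding w_def by (intro continuous_intros)
    have opS: "open S" unfolding S_def w_def
      by (intro open_Collect_conj open_Collect_less continuous_intros)
    have clS': "closed S'" unfolding S'_def w_def
      by (intro closed_Collect_conj closed_Collect_le continuous_intros)
    have sub: "closure S \<subseteq> S'" by (rule closure_minimal[OF _ clS']) (auto simp: S_def S'_def)
    have hw: "(\<lambda>z. h (w z)) holomorphic_on A" for A
    proof -
      have "w holomorphic_on A" unfolding w_def by (intro holomorphic_intros)
      then have "(h \<circ> w) holomorphic_on A" using hol by (rule holomorphic_on_compose_gen) auto
      then show ?thesis by (simp add: o_def)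
    qed
    have hk: "k holomorphic_on A" for A
      unfolding k_def w_def by (intro holomorphic_intros hw[unfolded w_def])
    have bdd: "bounded S"
    proof -
      have "cmod z \<le> pi/2 + (X+Y)/\<rho>" if "z \<in> S" for z
      proof -
        have "\<rho> * \<bar>Im z\<bar> \<le> \<rho> * cmod (sin z)" using abs_Im_le_cmod_sin[of z] \<rho> by simp
        also have "\<dots> = cmod (w z)" using \<rho> by (simp add: w_def norm_mult)
        also have "\<dots> \<le> X + Y" using cmod_le[of "w z"] that by (auto simp: S_def)
        finally have "\<bar>Im z\<bar> \<le> (X+Y)/\<rho>" using \<rho> by (simp add: field_simps)
        then show ?thesis using cmod_le[of z] that by (auto simp: S_def)
      qed
      then show ?thesis by (auto simp: bounded_iff)
    qed
    have nk: "cmod (k z) = cmod (h (w z)) * exp (- (l*\<rho>*Re (cos z))) * exp (d * (Im (w z))\<^sup>2 - d * (Re (w z))\<^sup>2)" for z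
      unfolding k_def by (simp add: norm_mult power2_eq_square algebra_simps)
    have fr: "cmod (k z) \<le> e * exp (d * Y\<^sup>2)" if "z \<in> frontier S" for z
    proof -
      have zS': "z \<in> S'" using that sub by (auto simp: frontier_def)
      have "z \<notin> S" using that opS by (auto simp: frontier_def interior_open)
      then consider "\<bar>Re z\<bar> = pi/2" | "\<bar>Im (w z)\<bar> = Y" | "\<bar>Re (w z)\<bar> = X"
        using zS' by (auto simp: S_def S'_def not_less)
      moreover have a: "\<bar>Re z\<bar> \<le> pi/2" and b: "\<bar>Im (w z)\<bar> \<le> Y" using zS' by (auto simp: S'_def)
      have hM: "cmod (h (w z)) \<le> M" by (rule strip[OF b])
      have bb: "(Im (w z))\<^sup>2 \<le> Y\<^sup>2" using b by (metis abs_ge_zero power2_abs power_mono)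
      have q1: "exp (d * (Im (w z))\<^sup>2 - d * (Re (w z))\<^sup>2) \<le> exp (d * Y\<^sup>2)"
      proof -
        have "d * (Im (w z))\<^sup>2 \<le> d * Y\<^sup>2" using bb d by (intro mult_left_mono) auto
        moreover have "0 \<le> d * (Re (w z))\<^sup>2" using d by simp
        ultimately have "d * (Im (w z))\<^sup>2 - d * (Re (w z))\<^sup>2 \<le> d * Y\<^sup>2" by linarith
        then show ?thesis by simp
      qed
      have q2: "Re (cos z) \<ge> 0" using abs_Im_sin_le_Re_cos[OF a] by linarith
      have q3: "exp (- (l*\<rho>*Re (cos z))) \<le> 1" using l \<rho> q2 by simp
      ultimately show ?thesis
      proof cases
        \<comment> \<open>On the lines \<open>|Re \<zeta>| = pi/2\<close> the point \<open>z\<close> lies on the two rays and \<open>cos \<zeta>\<close> is imaginary.\<close>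
        case 1
        note r = Re_sin_at_right_angle[OF 1]
        have "w z = of_real (\<rho> * Re (sin z))" using r by (simp add: w_def complex_eq_iff)
        moreover have "\<bar>\<rho> * Re (sin z)\<bar> \<ge> \<rho>" using r \<rho> by (simp add: abs_mult)
        ultimately have "cmod (h (w z)) \<le> e" using small by metis
        then have "cmod (h (w z)) * exp (- (l*\<rho>*Re (cos z))) \<le> e * 1"
          using q3 e by (intro mult_mono) auto
        then show ?thesis unfolding nk using q1 e by (intro mult_mono) auto
      next
        \<comment> \<open>On the sides of the strip the exponential is at most \<open>e / M\<close>.\<close>
        case 2
        have "\<bar>Im (w z)\<bar> = \<rho> * \<bar>Im (sin z)\<bar>" using \<rho> by (simp add: w_def abs_mult)
        also have "\<dots> \<le> \<rho> * Re (cos z)" using abs_Im_sin_le_Re_cos[OF a] \<rho> by simp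
        finally have "l * Y \<le> l * (\<rho> * Re (cos z))" using 2 l by (intro mult_left_mono) auto
        then have "exp (- (l*\<rho>*Re (cos z))) \<le> exp (- (l*Y))" by (simp add: mult_ac)
        then have "cmod (h (w z)) * exp (- (l*\<rho>*Re (cos z))) \<le> M * exp (- (l*Y))"
          using hM M by (intro mult_mono) auto
        also have "\<dots> = e" unfolding l_def using Y e M by (simp add: exp_minus)
        finally show ?thesis unfolding nk using q1 e by (intro mult_mono) auto
      next
        \<comment> \<open>On the artificial ends the Gaussian factor is at most \<open>e / M\<close>.\<close>
        case 3
        then have "(Re (w z))\<^sup>2 = X\<^sup>2" by (metis power2_abs)
        then have "exp (d * (Im (w z))\<^sup>2 - d * (Re (w z))\<^sup>2) \<le> exp (d * Y\<^sup>2 - d * X\<^sup>2)"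
          using mult_left_mono[OF bb, of d] d by simp
        moreover have "cmod (h (w z)) * exp (- (l*\<rho>*Re (cos z))) \<le> M * 1"
          using q3 hM M by (intro mult_mono) auto
        moreover note M
        ultimately have "cmod (k z) \<le> M * 1 * exp (d * Y\<^sup>2 - d * X\<^sup>2)"
          unfolding nk by (intro mult_mono[where a="_ * _" and b="M * 1"]) simp_all
        also have "\<dots> = (M * exp (-(d * X\<^sup>2))) * exp (d * Y\<^sup>2)"
          by (simp add: exp_diff exp_minus field_simps)
        also have "\<dots> \<le> e * exp (d * Y\<^sup>2)" using MX by (intro mult_right_mono) auto
        finally show ?thesis .
      qed
    qed
    have "0 \<in> S" using Y X by (simp add: S_def w_def)
    from maximum_modulus_frontier[OF hk _ bdd fr this]
    have "cmod (k 0) \<le> e * exp (d * Y\<^sup>2)"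
      using hk holomorphic_on_imp_continuous_on by blast
    then show ?thesis by (simp add: k_def w_def norm_mult)
  qed
  have "((\<lambda>d. e * exp (d * Y\<^sup>2)) \<longlongrightarrow> e * exp (0 * Y\<^sup>2)) (at_right 0)"
    by (intro tendsto_intros)
  then have "cmod (h 0) * exp (- (l*\<rho>)) \<le> e * exp (0 * Y\<^sup>2)"
    by (rule tendsto_lowerbound) (auto simp: eventually_at_right_less intro!: eventually_at_rightI[of 0 1] bound)
  then have "cmod (h 0) \<le> e * exp (l*\<rho>)" by (simp add: exp_minus field_simps)
  also have "\<dots> = e powr (1 - \<rho>/Y) * M powr (\<rho>/Y)"
  proof -
    have "exp (l*\<rho>) = (M/e) powr (\<rho>/Y)" using e M by (simp add: powr_def l_def)
    then show ?thesis using e M by (simp add: powr_divide powr_diff)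
  qed
  finally show ?thesis .
qed

text \<open>One step of propagation of smallness along the real axis. The map
  $w \mapsto s_1 + d - 2d\,e^{-w^2}$ folds both rays $|w| \ge \sqrt{\ln 2}$ into the single ray
  $[s_1,\infty)$ and sends 0 to $s_1 - d$, a point beyond the end of that ray; so \<open>two_constants_two_rays\<close>,
  used with \<open>Y = 2 * \<rho>\<close>, applies and yields the exponent 1/2.\<close>

lemma halve_exponent_step:
  fixes h :: "complex \<Rightarrow> complex"
  assumes hol: "h holomorphic_on UNIV"
    and b: "0 < b" and e: "0 < e" "e \<le> M"
    and strip: "\<And>z. \<bar>Im z\<bar> \<le> b \<Longrightarrow> cmod (h z) \<le> M"
    and small: "\<And>s::real. s \<ge> s0 \<Longrightarrow> cmod (h (of_real s)) \<le> e"
    and s: "s \<ge> s0 - b/32"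
  shows "cmod (h (of_real s)) \<le> sqrt (e * M)"
proof -
  define \<rho> where "\<rho> = sqrt (ln (2::real))"
  \<comment> \<open>In the strip \<open>|Im w| \<le> 2 * \<rho>\<close> the exponential is bounded by \<open>exp (4 * ln 2) = 16\<close>, so that with this \<open>d\<close> the map stays within distance \<open>32 * d = b\<close> of the real point \<open>s1 + d\<close>.\<close>
  define d where "d = b/32"
  define s1 where "s1 = s + d"
  have s1: "s1 \<ge> s0" using s by (simp add: s1_def d_def)
  have d: "d > 0" using b by (simp add: d_def)
  have \<rho>: "\<rho> > 0" "\<rho>\<^sup>2 = ln 2" by (auto simp: \<rho>_def)
  define f where "f = (\<lambda>w::complex. h (of_real (s1 + d) - of_real (2*d) * exp (- (w\<^sup>2))))"
  have "(h \<circ> (\<lambda>w::complex. of_real (s1 + d) - of_real (2*d) * exp (- (w\<^sup>2)))) holomorphic_on UNIV"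
    by (rule holomorphic_on_compose_gen[OF _ hol]) (auto intro!: holomorphic_intros)
  then have holf: "f holomorphic_on UNIV" by (simp add: f_def o_def)
  have "cmod (f 0) \<le> e powr (1 - \<rho>/(2*\<rho>)) * M powr (\<rho>/(2*\<rho>))"
  proof (rule two_constants_two_rays[OF holf])
    show "cmod (f z) \<le> M" if "\<bar>Im z\<bar> \<le> 2*\<rho>" for z
      unfolding f_def
    proof (rule strip)
      have "(Im z)\<^sup>2 \<le> (2*\<rho>)\<^sup>2" using that \<rho> by (metis abs_ge_zero power2_abs power_mono)
      then have "(Im z)\<^sup>2 \<le> 4 * ln 2" using \<rho> by (simp add: power_mult_distrib)
      then have "Re (- (z\<^sup>2)) \<le> 4 * ln 2"
        by (smt (verit) Re_power2 uminus_complex.sel(1) zero_le_power2)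
      then have "cmod (exp (- (z\<^sup>2))) \<le> exp (4 * ln 2)" by (simp add: norm_exp_eq_Re)
      also have "exp (4 * ln 2 :: real) = 16"
      proof -
        have "exp (4 * ln 2 :: real) = (2::real) powr 4" by (simp add: powr_def)
        then show ?thesis by simp
      qed
      finally have "2*d * cmod (exp (- (z\<^sup>2))) \<le> 2*d*16" using d by (intro mult_left_mono) auto
      moreover have "\<bar>Im (of_real (s1 + d) - of_real (2*d) * exp (- (z\<^sup>2)))\<bar> \<le> 2*d * cmod (exp (- (z\<^sup>2)))"
        using abs_Im_le_cmod[of "exp (- (z\<^sup>2))"] d by (simp add: abs_mult)
      ultimately show "\<bar>Im (of_real (s1 + d) - of_real (2*d) * exp (- (z\<^sup>2)))\<bar> \<le> b"
        by (simp add: d_def)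
    qed
    show "cmod (f (of_real t)) \<le> e" if "\<bar>t\<bar> \<ge> \<rho>" for t :: real
    proof -
      have "\<rho>\<^sup>2 \<le> t\<^sup>2" using that \<rho> by (metis power2_abs power_mono less_imp_le)
      then have "exp (- (t\<^sup>2)) \<le> exp (- ln 2 :: real)" using \<rho> by simp
      also have "\<dots> = 1/2" by (simp add: exp_minus)
      finally have "2*d*exp (- (t\<^sup>2)) \<le> d" using d by (simp add: field_simps)
      then have "s0 \<le> s1 + d - 2*d*exp (- (t\<^sup>2))" using s1 by linarith
      from small[OF this] show ?thesis
        by (simp add: f_def exp_of_real[symmetric])
    qed
  qed (use \<rho> e in auto)
  then show ?thesis using \<rho> e by (simp add: f_def s1_def powr_half_sqrt real_sqrt_mult)
qed

lemma halve_exponent_iterated: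
  fixes h :: "complex \<Rightarrow> complex"
  assumes hol: "h holomorphic_on UNIV"
    and b: "0 < b" and e: "0 < e" "e \<le> M"
    and strip: "\<And>z. \<bar>Im z\<bar> \<le> b \<Longrightarrow> cmod (h z) \<le> M"
    and small: "\<And>s::real. s \<ge> s0 \<Longrightarrow> cmod (h (of_real s)) \<le> e"
  shows "s \<ge> s0 - real N * (b/32) \<Longrightarrow> cmod (h (of_real s)) \<le> M * (e/M) powr ((1/2)^N)"
proof (induction N arbitrary: s)
  case 0
  then show ?case using small e by simp
next
  case (Suc N)
  define e' where "e' = M * (e/M) powr ((1/2)^N)"
  have e': "0 < e'" "e' \<le> M" unfolding e'_def using e by (auto intro!: powr_le1 mult_left_le)
  have "cmod (h (of_real s)) \<le> sqrt (e' * M)"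
    by (rule halve_exponent_step[OF hol b e' strip, of "s0 - real N * (b/32)"])
      (use Suc in \<open>auto simp: e'_def algebra_simps add_divide_distrib\<close>)
  also have "e' * M = M\<^sup>2 * (e/M) powr ((1/2)^N)" by (simp add: e'_def power2_eq_square)
  also have "sqrt \<dots> = M * (e/M) powr ((1/2)^Suc N)"
    using e by (simp add: real_sqrt_mult powr_half_sqrt[symmetric] powr_powr mult.commute)
  finally show ?case .
qed

text \<open>Steps of length \<open>b/32\<close> lead from the end of
  the ray to the origin, and each of them halves the exponent of the small bound; hence the exponential
  dependence on \<open>\<rho> / b\<close>.\<close>

lemma two_constants_one_ray:
  fixes h :: "complex \<Rightarrow> complex"
  assumes hol: "h holomorphic_on UNIV"
    and b: "0 < b" and \<rho>: "0 < \<rho>" and e: "0 < e" "e \<le> M"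
    and strip: "\<And>z. \<bar>Im z\<bar> \<le> b \<Longrightarrow> cmod (h z) \<le> M"
    and small: "\<And>s::real. s \<ge> \<rho> \<Longrightarrow> cmod (h (of_real s)) \<le> e"
    and \<theta>: "\<theta> \<le> (1/2) powr (32 * (1 + \<rho>/b))"
  shows "cmod (h 0) \<le> e powr \<theta> * M powr (1 - \<theta>)"
proof -
  define N where "N = nat \<lceil>32 * \<rho> / b\<rceil>"
  have N1: "32 * \<rho> / b \<le> real N" unfolding N_def by linarith
  have "0 \<le> 32 * \<rho> / b" using b \<rho> by simp
  then have "real N \<le> 32 * \<rho> / b + 1" unfolding N_def by linarith
  then have N2: "real N \<le> 32 * (1 + \<rho> / b)" by simp
  have "0 \<ge> \<rho> - real N * (b/32)" using N1 b by (simp add: field_simps)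
  from halve_exponent_iterated[OF hol b e strip small this]
  have "cmod (h 0) \<le> M * (e/M) powr ((1/2)^N)" by simp
  also have "\<dots> \<le> M * (e/M) powr \<theta>"
  proof -
    have "(1/2) powr (32 * (1 + \<rho>/b)) \<le> (1/2) powr (real N)" using N2 by (intro powr_mono') auto
    then have "\<theta> \<le> (1/2) powr (real N)" using \<theta> by (rule order_trans[rotated])
    then have "\<theta> \<le> (1/2)^N" by (simp add: powr_realpow)
    then show ?thesis using e by (intro mult_left_mono powr_mono') auto
  qed
  also have "\<dots> = e powr \<theta> * M powr (1 - \<theta>)"
    using e by (simp add: powr_divide powr_diff)
  finally show ?thesis .
qed

section \<open>Gaussian integrals\<close>

lemma borel_measurable_lborel_continuous:
  fixes f :: "'a::euclidean_space \<Rightarrow> 'b::topological_space"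
  shows "continuous_on UNIV f \<Longrightarrow> f \<in> borel_measurable lborel"
  by (simp add: borel_measurable_continuous_onI)

lemma
  fixes f :: "'a::euclidean_space \<Rightarrow> real \<Rightarrow> complex"
  assumes f: "\<And>b. b \<in> Basis \<Longrightarrow> integrable lborel (f b)"
  shows integrable_prod_Basis: "integrable lborel (\<lambda>x. \<Prod>b\<in>Basis. f b (x \<bullet> b))"
    and integral_prod_Basis: "(LINT x|lborel. (\<Prod>b\<in>Basis. f b (x \<bullet> b))) = (\<Prod>b\<in>Basis. LINT x|lborel. f b x)"
proof -
  interpret product_sigma_finite "\<lambda>_::'a. lborel :: real measure" by standard
  have m: "f b \<in> borel_measurable borel" if "b \<in> Basis" for b
    using borel_measurable_integrable[OF f[OF that]] by simp
  have m1: "(\<lambda>x::'a. \<Prod>b\<in>Basis. f b (x \<bullet> b)) \<in> borel_measurable borel"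
    by (intro borel_measurable_prod measurable_compose[OF _ m]) auto
  have m2: "(\<lambda>g. \<Sum>b\<in>Basis. g b *\<^sub>R b) \<in> measurable (\<Pi>\<^sub>M b\<in>Basis. lborel) (borel :: 'a measure)"
    by measurable
  have eq: "(\<Prod>b\<in>Basis. f b ((\<Sum>b\<in>Basis. g b *\<^sub>R b) \<bullet> b)) = (\<Prod>b\<in>Basis. f b (g b))" for g :: "'a \<Rightarrow> real"
    by (intro prod.cong refl arg_cong[of _ _ "f _"]) (simp add: inner_sum_left inner_Basis if_distrib sum.delta cong: if_cong)
  show "integrable lborel (\<lambda>x. \<Prod>b\<in>Basis. f b (x \<bullet> b))"
    by (subst lborel_eq, subst integrable_distr_eq[OF m2 m1])
       (simp only: eq, rule product_integrable_prod[OF finite_Basis f])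
  show "(LINT x|lborel. (\<Prod>b\<in>Basis. f b (x \<bullet> b))) = (\<Prod>b\<in>Basis. LINT x|lborel. f b x)"
    by (subst lborel_eq, subst integral_distr[OF m2 m1])
       (simp only: eq, rule product_integral_prod[OF finite_Basis f])
qed

lemma lborel_integral_scale:
  fixes f :: "'a::euclidean_space \<Rightarrow> complex"
  assumes [measurable]: "f \<in> borel_measurable borel" and c: "c > 0"
  shows "(LINT x|lborel. f x) = of_real (c ^ DIM('a)) * (LINT x|lborel. f (t + c *\<^sub>R x))"
proof -
  have "(LINT x|lborel. f x) = (LINT x|density (distr lborel borel (\<lambda>x. t + c *\<^sub>R x)) (\<lambda>_. ennreal (\<bar>c\<bar>^DIM('a))). f x)"
    using lborel_affine[of c t] c by simp
  also have "\<dots> = of_real (c ^ DIM('a)) * (LINT x|lborel. f (t + c *\<^sub>R x))"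
    using c by (subst integral_density) (auto simp: integral_distr scaleR_conv_of_real)
  finally show ?thesis .
qed

text \<open>The bound \<open>g\<close> on the derivatives dominates the difference quotients, by the mean value
  inequality on the convex set \<open>U\<close>.\<close>

lemma holomorphic_integral:
  fixes f f' :: "complex \<Rightarrow> 'm \<Rightarrow> complex"
  assumes U: "open U" "convex U"
    and int: "\<And>z. z \<in> U \<Longrightarrow> integrable M (f z)"
    and meas: "\<And>z. z \<in> U \<Longrightarrow> f' z \<in> borel_measurable M"
    and der: "\<And>z x. z \<in> U \<Longrightarrow> x \<in> space M \<Longrightarrow> ((\<lambda>z. f z x) has_field_derivative f' z x) (at z)"
    and bnd: "\<And>z x. z \<in> U \<Longrightarrow> x \<in> space M \<Longrightarrow> cmod (f' z x) \<le> g x"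
    and g: "integrable M g"
  shows "(\<lambda>z. LINT x|M. f z x) holomorphic_on U"
  unfolding holomorphic_on_def field_differentiable_def
proof (intro ballI exI)
  fix z assume z: "z \<in> U"
  show "((\<lambda>z. LINT x|M. f z x) has_field_derivative (LINT x|M. f' z x)) (at z within U)"
    unfolding has_field_derivative_iff tendsto_at_iff_sequentially comp_def
  proof (intro allI impI)
    fix X assume X: "\<forall>i. X i \<in> U - {z}" "X \<longlonglongrightarrow> z"
    have "(\<lambda>i. LINT x|M. (f (X i) x - f z x) / (X i - z)) \<longlonglongrightarrow> (LINT x|M. f' z x)"
    proof (rule integral_dominated_convergence[where w=g])
      show "f' z \<in> borel_measurable M" by (rule meas[OF z])
      show "(\<lambda>x. (f (X i) x - f z x) / (X i - z)) \<in> borel_measurable M" for i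
        using int[of "X i"] int[OF z] X(1) by (auto dest!: borel_measurable_integrable)
      show "AE x in M. (\<lambda>i. (f (X i) x - f z x) / (X i - z)) \<longlonglongrightarrow> f' z x"
      proof (rule AE_I2)
        fix x assume x: "x \<in> space M"
        have "((\<lambda>y. (f y x - f z x) / (y - z)) \<longlongrightarrow> f' z x) (at z within U)"
          using has_field_derivative_at_within[OF der[OF z x]] by (simp add: has_field_derivative_iff)
        then show "(\<lambda>i. (f (X i) x - f z x) / (X i - z)) \<longlonglongrightarrow> f' z x"
          using X by (auto simp: tendsto_at_iff_sequentially comp_def)
      qed
      show "AE x in M. norm ((f (X i) x - f z x) / (X i - z)) \<le> g x" for i
      proof (rule AE_I2)
        fix x assume x: "x \<in> space M"
        have "cmod (f (X i) x - f z x) \<le> g x * cmod (X i - z)"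
          by (rule field_differentiable_bound[OF U(2), of _ "\<lambda>z. f' z x"])
             (use X z x der bnd in \<open>auto intro: has_field_derivative_at_within\<close>)
        then show "norm ((f (X i) x - f z x) / (X i - z)) \<le> g x"
          using X(1) by (auto simp: norm_divide field_simps)
      qed
    qed (rule g)
    moreover have eq: "(LINT x|M. (f (X i) x - f z x) / (X i - z)) = ((LINT x|M. f (X i) x) - (LINT x|M. f z x)) / (X i - z)" for i
    proof -
      have "X i \<in> U" using X(1) by auto
      from Bochner_Integration.integral_diff[OF int[OF this] int[OF z]] show ?thesis by simp
    qed
    ultimately show "(\<lambda>i. ((LINT x|M. f (X i) x) - (LINT x|M. f z x)) / (X i - z)) \<longlonglongrightarrow> (LINT x|M. f' z x)"
      by (simp only: eq)
  qed
qed

lemma integrable_gaussian_moment: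
  fixes a :: real
  assumes a: "a > 0"
  shows "integrable lborel (\<lambda>x. exp (- (a * x\<^sup>2)) * \<bar>x\<bar> ^ k)"
proof -
  have "integrable lborel (\<lambda>x. normal_density 0 (sqrt (1/(2*a))) x * \<bar>x - 0\<bar>^k)"
    by (rule integrable_normal_moment_abs) (use a in simp)
  then have "integrable lborel (\<lambda>x. sqrt (pi/a) * (normal_density 0 (sqrt (1/(2*a))) x * \<bar>x\<bar>^k))"
    by simp
  also have "(\<lambda>x. sqrt (pi/a) * (normal_density 0 (sqrt (1/(2*a))) x * \<bar>x\<bar>^k)) = (\<lambda>x. exp (- (a * x\<^sup>2)) * \<bar>x\<bar> ^ k)"
    using a by (auto simp: normal_density_def fun_eq_iff field_simps real_sqrt_divide)
  finally show ?thesis .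
qed

lemma integrable_complex_gaussian_real:
  assumes z: "Re z > 0"
  shows "integrable lborel (\<lambda>x::real. cis (s * x) * exp (- (z * of_real (x\<^sup>2))))"
proof (rule Bochner_Integration.integrable_bound)
  show "integrable lborel (\<lambda>x. exp (- (Re z * x\<^sup>2)) * \<bar>x\<bar> ^ 0)" by (rule integrable_gaussian_moment[OF z])
  show "(\<lambda>x::real. cis (s * x) * exp (- (z * of_real (x\<^sup>2)))) \<in> borel_measurable lborel"
    by (intro borel_measurable_lborel_continuous continuous_intros)
qed (simp add: norm_mult)

lemma fourier_real_gaussian:
  assumes a: "a > 0"
  shows "(LINT x|lborel. cis (s * x) * exp (- (of_real a * of_real (x\<^sup>2)))) = of_real (sqrt (pi/a)) * exp (- (of_real (s\<^sup>2) / (4 * of_real a)))"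
proof -
  define c where "c = 1 / sqrt (2*a)"
  have c: "c > 0" using a by (simp add: c_def)
  have c2: "c\<^sup>2 = 1/(2*a)" using a by (simp add: c_def power_divide)
  have "char std_normal_distribution (s*c) = (LINT x|lborel. std_normal_density x *\<^sub>R cis (s*c*x))"
    unfolding char_def by (subst integral_density) (auto simp: cis_conv_exp)
  then have 1: "(LINT x|lborel. std_normal_density x *\<^sub>R cis (s*c*x)) = of_real (exp (- ((s*c)\<^sup>2) / 2))"
    by (simp add: char_std_normal_distribution)
  have "(LINT x|lborel. cis (s * x) * exp (- (of_real a * of_real (x\<^sup>2)))) = \<bar>c\<bar> *\<^sub>R (LINT x|lborel. cis (s * (0 + c*x)) * exp (- (of_real a * of_real ((0 + c*x)\<^sup>2))))"
    by (rule lborel_integral_real_affine) (use c in simp)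
  also have "(\<lambda>x. cis (s * (0 + c*x)) * exp (- (of_real a * of_real ((0 + c*x)\<^sup>2)))) = (\<lambda>x. of_real (sqrt (2*pi)) * (std_normal_density x *\<^sub>R cis (s*c*x)))"
  proof
    fix x
    have "a * (c*x)\<^sup>2 = x\<^sup>2/2" using a c2 by (simp add: power_mult_distrib)
    then have "exp (- (of_real a * of_real ((c*x)\<^sup>2))) = (of_real (exp (- x\<^sup>2/2)) :: complex)"
      by (metis exp_of_real minus_divide_left of_real_minus of_real_mult)
    then show "cis (s * (0 + c*x)) * exp (- (of_real a * of_real ((0 + c*x)\<^sup>2))) = of_real (sqrt (2*pi)) * (std_normal_density x *\<^sub>R cis (s*c*x))"
      by (simp add: std_normal_density_def scaleR_conv_of_real mult_ac)
  qed
  also have "\<bar>c\<bar> *\<^sub>R (LINT x|lborel. of_real (sqrt (2*pi)) * (std_normal_density x *\<^sub>R cis (s*c*x))) = of_real (c * sqrt (2*pi) * exp (- ((s*c)\<^sup>2) / 2))"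
    using c by (simp only: integral_mult_right_zero 1) (simp add: scaleR_conv_of_real)
  also have "c * sqrt (2*pi) = sqrt (pi/a)"
    using a by (simp add: c_def real_sqrt_divide[symmetric] real_sqrt_mult[symmetric])
  also have "(s*c)\<^sup>2 / 2 = s\<^sup>2 / (4*a)" using c2 by (simp add: power_mult_distrib)
  then have "- ((s*c)\<^sup>2) / 2 = - (s\<^sup>2 / (4*a))" by simp
  finally show ?thesis by (simp add: exp_of_real[symmetric])
qed

text \<open>The principal branch of $\sqrt{\pi/z}$.\<close>

definition gauss_root :: "complex \<Rightarrow> complex" where
  "gauss_root z = of_real (sqrt pi) * z powr (-1/2)"

text \<open>For real \<open>z\<close> this is the characteristic function of the normal distribution; both sides
  are holomorphic in the right half-plane, so that they agree there.\<close>

lemma fourier_complex_gaussian_real: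
  assumes z: "Re z > 0"
  shows "(LINT x|lborel. cis (s * x) * exp (- (z * of_real (x\<^sup>2)))) = gauss_root z * exp (- (of_real (s\<^sup>2) / (4 * z)))"
proof -
  define F where "F = (\<lambda>z. LINT x|lborel. cis (s * x) * exp (- (z * of_real (x\<^sup>2))))"
  define G where "G = (\<lambda>z. gauss_root z * exp (- (of_real (s\<^sup>2) / (4 * z))))"
  have F: "F holomorphic_on {w. Re w > Re z / 2}"
    unfolding F_def
  proof (rule holomorphic_integral[where g="\<lambda>x. exp (- (Re z/2 * x\<^sup>2)) * \<bar>x\<bar>^2"
        and f' = "\<lambda>w x. - (of_real (x\<^sup>2) * (cis (s * x) * exp (- (w * of_real (x\<^sup>2)))))"])
    show "open {w. Re z / 2 < Re w}" by (rule open_halfspace_Re_gt)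
    show "convex {w. Re z / 2 < Re w}" by (rule convex_halfspace_Re_gt)
    show "integrable lborel (\<lambda>x. cis (s * x) * exp (- (w * of_real (x\<^sup>2))))" if "w \<in> {w. Re z / 2 < Re w}" for w
      using that z by (intro integrable_complex_gaussian_real) auto
    show "(\<lambda>x. - (of_real (x\<^sup>2) * (cis (s * x) * exp (- (w * of_real (x\<^sup>2)))))) \<in> borel_measurable lborel" for w
      by (intro borel_measurable_lborel_continuous continuous_intros)
    show "((\<lambda>w. cis (s * x) * exp (- (w * of_real (x\<^sup>2)))) has_field_derivative - (of_real (x\<^sup>2) * (cis (s * x) * exp (- (w * of_real (x\<^sup>2)))))) (at w)" for w x
      by (auto intro!: derivative_eq_intros)
    show "cmod (- (of_real (x\<^sup>2) * (cis (s * x) * exp (- (w * of_real (x\<^sup>2)))))) \<le> exp (- (Re z/2 * x\<^sup>2)) * \<bar>x\<bar>^2" if "w \<in> {w. Re z / 2 < Re w}" for w x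
    proof -
      have "Re z/2 * x\<^sup>2 \<le> Re w * x\<^sup>2" using that by (intro mult_right_mono) auto
      then have "x\<^sup>2 * exp (- (Re w * x\<^sup>2)) \<le> x\<^sup>2 * exp (- (Re z/2 * x\<^sup>2))" by (intro mult_left_mono) auto
      then show ?thesis by (simp add: norm_mult norm_power mult.commute)
    qed
    show "integrable lborel (\<lambda>x. exp (- (Re z/2 * x\<^sup>2)) * \<bar>x\<bar>^2)"
      by (rule integrable_gaussian_moment) (use z in simp)
  qed
  have pos: "w \<notin> \<real>\<^sub>\<le>\<^sub>0 \<and> w \<noteq> 0" if "Re w > Re z/2" for w
    using that z by (auto simp: complex_nonpos_Reals_iff)
  have G: "G holomorphic_on {w. Re w > Re z / 2}"
    unfolding G_def gauss_root_def by (intro holomorphic_intros) (use pos in auto)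
  have lim: "of_real (Re z) islimpt (complex_of_real ` {Re z/2<..})"
    unfolding islimpt_sequential
  proof (intro exI conjI allI)
    show "complex_of_real (Re z + 1 / real (Suc n)) \<in> complex_of_real ` {Re z/2<..} - {of_real (Re z)}" for n
    proof -
      have "1 / real (Suc n) > 0" by simp
      then have "Re z + 1 / real (Suc n) > Re z/2" "Re z + 1 / real (Suc n) \<noteq> Re z"
        using z by linarith+
      then have "Re z + 1 / real (Suc n) \<in> {Re z/2<..}" "Re z + 1 / real (Suc n) \<noteq> Re z"
        by (simp_all only: greaterThan_iff not_False_eq_True)
      then show ?thesis by (simp only: Diff_iff singleton_iff of_real_eq_iff imageI not_False_eq_True simp_thms)
    qed
    have "(\<lambda>n. complex_of_real (Re z + 1 / real (Suc n))) \<longlonglongrightarrow> of_real (Re z + 0)"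
      by (intro tendsto_intros LIMSEQ_Suc[OF lim_1_over_n])
    then show "(\<lambda>n. complex_of_real (Re z + 1 / real (Suc n))) \<longlonglongrightarrow> of_real (Re z)" by simp
  qed
  have "F z - G z = 0"
  proof (rule analytic_continuation[where S="{w. Re w > Re z / 2}" and f="\<lambda>w. F w - G w", OF _ _ _ _ _ lim])
    show "(\<lambda>w. F w - G w) holomorphic_on {w. Re z / 2 < Re w}" using F G by (intro holomorphic_intros)
    show "open {w. Re z / 2 < Re w}" by (rule open_halfspace_Re_gt)
    show "connected {w. Re z / 2 < Re w}" by (rule convex_connected[OF convex_halfspace_Re_gt])
    show "F w - G w = 0" if "w \<in> complex_of_real ` {Re z/2<..}" for w
    proof -
      from that obtain a where a: "w = of_real a" "a > Re z/2" by auto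
      then have a0: "a > 0" using z by simp
      have "sqrt (pi/a) = sqrt pi * a powr (-1/2)"
        using a0 by (simp add: real_sqrt_divide powr_minus powr_half_sqrt[symmetric] field_simps)
      then have "gauss_root w = of_real (sqrt (pi/a))"
        using a0 powr_of_real[of a "-1/2"] by (simp add: gauss_root_def a)
      then show ?thesis
        unfolding F_def G_def a(1) using fourier_real_gaussian[OF a0, of s] by simp
    qed
  qed (use z in auto)
  then show ?thesis by (simp add: F_def G_def)
qed

lemma complex_gaussian_prod:
  fixes x y :: "'a::euclidean_space"
  shows "cis (x \<bullet> y) * exp (- (z * of_real ((norm y)\<^sup>2))) = (\<Prod>b\<in>Basis. cis ((x \<bullet> b) * (y \<bullet> b)) * exp (- (z * of_real ((y \<bullet> b)\<^sup>2))))"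
proof -
  have "(\<Prod>b\<in>Basis. cis ((x \<bullet> b) * (y \<bullet> b))) = cis (\<Sum>b\<in>Basis. (x \<bullet> b) * (y \<bullet> b))"
    by (simp add: cis_conv_exp exp_sum[symmetric] sum_distrib_left)
  then have 1: "(\<Prod>b\<in>Basis. cis ((x \<bullet> b) * (y \<bullet> b))) = cis (x \<bullet> y)"
    by (simp add: euclidean_inner[of x y])
  have "(\<Prod>b\<in>Basis. exp (- (z * of_real ((y \<bullet> b)\<^sup>2)))) = exp (\<Sum>b\<in>Basis. - (z * of_real ((y \<bullet> b)\<^sup>2)))"
    by (rule exp_sum[symmetric]) simp
  also have "(\<Sum>b\<in>Basis. - (z * of_real ((y \<bullet> b)\<^sup>2))) = - (z * of_real (\<Sum>b\<in>Basis. (y \<bullet> b)\<^sup>2))"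
    by (simp add: sum_negf sum_distrib_left)
  also have "(\<Sum>b\<in>Basis. (y \<bullet> b)\<^sup>2) = (norm y)\<^sup>2"
    unfolding power2_norm_eq_inner using euclidean_inner[of y y] by (simp only: power2_eq_square)
  finally show ?thesis by (simp only: prod.distrib 1)
qed

lemma
  fixes x :: "'a::euclidean_space"
  assumes z: "Re z > 0"
  shows integrable_complex_gaussian: "integrable lborel (\<lambda>y. cis (x \<bullet> y) * exp (- (z * of_real ((norm y)\<^sup>2))))"
    and fourier_complex_gaussian: "(LINT y|lborel. cis (x \<bullet> y) * exp (- (z * of_real ((norm y)\<^sup>2)))) = gauss_root z ^ DIM('a) * exp (- (of_real ((norm x)\<^sup>2) / (4 * z)))"
proof -
  note i = integrable_complex_gaussian_real[OF z]
  show "integrable lborel (\<lambda>y. cis (x \<bullet> y) * exp (- (z * of_real ((norm y)\<^sup>2))))"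
    unfolding complex_gaussian_prod by (rule integrable_prod_Basis[OF i])
  have "(LINT y|lborel. cis (x \<bullet> y) * exp (- (z * of_real ((norm y)\<^sup>2)))) = (\<Prod>b\<in>Basis. gauss_root z * exp (- (of_real ((x \<bullet> b)\<^sup>2) / (4 * z))))"
    unfolding complex_gaussian_prod
    by (subst integral_prod_Basis[OF i]) (simp only: fourier_complex_gaussian_real[OF z])
  also have "\<dots> = gauss_root z ^ DIM('a) * (\<Prod>b\<in>Basis. cis (0 * (x \<bullet> b)) * exp (- ((1/(4*z)) * of_real ((x \<bullet> b)\<^sup>2))))"
    by (simp add: prod.distrib)
  also have "(\<Prod>b\<in>Basis. cis (0 * (x \<bullet> b)) * exp (- ((1/(4*z)) * of_real ((x \<bullet> b)\<^sup>2)))) = exp (- ((1/(4*z)) * of_real ((norm x)\<^sup>2)))"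
    using complex_gaussian_prod[of 0 x "1/(4*z)"] by simp
  finally show "(LINT y|lborel. cis (x \<bullet> y) * exp (- (z * of_real ((norm y)\<^sup>2)))) = gauss_root z ^ DIM('a) * exp (- (of_real ((norm x)\<^sup>2) / (4 * z)))"
    by simp
qed

section \<open>Plancherel's identity\<close>

text \<open>The parameter \<open>l\<close> rescales the frequency. The solution at time \<open>T\<close> is, up to unimodular
  factors, such a transform with \<open>l = 1 / (2 * T)\<close>; carrying \<open>l\<close> along saves a change of variables in
  the sets over which the solution is integrated.\<close>

definition FT :: "real \<Rightarrow> ('a::euclidean_space \<Rightarrow> complex) \<Rightarrow> 'a \<Rightarrow> complex" where
  "FT l f x = (LINT y|lborel. cis (- (l * (x \<bullet> y))) * f y)"

lemma borel_measurable_cis [measurable]: "cis \<in> borel_measurable borel"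
  by (intro borel_measurable_continuous_onI continuous_intros)

lemma borel_measurable_cnj [measurable]: "cnj \<in> borel_measurable borel"
  by (intro borel_measurable_continuous_onI continuous_intros)

lemma borel_measurable_FT [measurable]:
  assumes [measurable]: "f \<in> borel_measurable borel"
  shows "FT l f \<in> borel_measurable borel"
  unfolding FT_def[abs_def] by measurable

lemma integrable_cis_mult:
  fixes f :: "'a::euclidean_space \<Rightarrow> complex"
  assumes f: "integrable lborel f" and [measurable]: "p \<in> borel_measurable borel"
  shows "integrable lborel (\<lambda>y. cis (p y) * f y)"
proof (rule Bochner_Integration.integrable_bound[OF f])
  show "(\<lambda>y. cis (p y) * f y) \<in> borel_measurable lborel"
    using borel_measurable_integrable[OF f] by measurable
qed (simp add: norm_mult)

lemma norm_FT_le: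
  assumes f: "integrable lborel f"
  shows "cmod (FT l f x) \<le> (LINT y|lborel. cmod (f y))"
proof -
  have "cmod (FT l f x) \<le> (LINT y|lborel. cmod (cis (- (l * (x \<bullet> y))) * f y))"
    unfolding FT_def by (rule integral_norm_bound)
  then show ?thesis by (simp add: norm_mult)
qed

text \<open>The multiplication formula, which is Fubini's theorem for the symmetric kernel
  $e^{-i l\,x\cdot y}$. Every interchange of integrals below goes through it.\<close>

lemma integral_mult_FT:
  fixes f g :: "'a::euclidean_space \<Rightarrow> complex"
  assumes f: "integrable lborel f" and g: "integrable lborel g"
  shows "(LINT x|lborel. f x * FT l g x) = (LINT y|lborel. FT l f y * g y)"
proof -
  have [measurable]: "f \<in> borel_measurable borel" "g \<in> borel_measurable borel"
    using f g by auto
  let ?F = "\<lambda>x y. f x * (cis (- (l * (x \<bullet> y))) * g y)"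
  have int: "integrable (lborel \<Otimes>\<^sub>M lborel) (case_prod ?F)"
  proof (rule lborel_pair.Fubini_integrable)
    show "case_prod ?F \<in> borel_measurable (lborel \<Otimes>\<^sub>M lborel)" by measurable
    have "integrable lborel (\<lambda>x. cmod (f x) * (LINT y|lborel. cmod (g y)))"
      using f by auto
    then show "integrable lborel (\<lambda>x. LINT y|lborel. norm (case (x, y) of (x, y) \<Rightarrow> ?F x y))"
      by (simp add: norm_mult)
    show "AE x in lborel. integrable lborel (\<lambda>y. case (x, y) of (x, y) \<Rightarrow> ?F x y)"
      using integrable_cis_mult[OF g] by (auto intro!: integrable_mult_right)
  qed
  have "(LINT x|lborel. f x * FT l g x) = (LINT x|lborel. LINT y|lborel. ?F x y)"
    unfolding FT_def using integrable_cis_mult[OF g] by simp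
  also have "\<dots> = (LINT y|lborel. LINT x|lborel. ?F x y)"
    using lborel_pair.Fubini_integral[OF int] by simp
  also have "\<dots> = (LINT y|lborel. FT l f y * g y)"
    unfolding FT_def integral_mult_left_zero[symmetric] by (simp add: mult_ac inner_commute)
  finally show ?thesis .
qed

lemma cnj_FT: "cnj (FT l f x) = FT (-l) (\<lambda>y. cnj (f y)) x"
proof -
  have "cnj (FT l f x) = (LINT y|lborel. cnj (cis (- (l * (x \<bullet> y))) * f y))"
    unfolding FT_def by (rule Bochner_Integration.integral_cnj[symmetric])
  then show ?thesis by (simp add: FT_def cis_cnj)
qed

lemma integrable_real_gaussian:
  assumes "d > 0"
  shows "integrable lborel (\<lambda>x::'a::euclidean_space. exp (- (d * (norm x)\<^sup>2)))"
proof -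
  have "integrable lborel (\<lambda>x::'a. cmod (cis (0 \<bullet> x) * exp (- (of_real d * of_real ((norm x)\<^sup>2)))))"
    by (intro integrable_norm integrable_complex_gaussian) (use assms in simp)
  then show ?thesis by (simp flip: of_real_mult)
qed

lemma FT_gaussian:
  fixes y w :: "'a::euclidean_space"
  assumes d: "Re z > 0"
  shows "(LINT x|lborel. cis (- (l * (w \<bullet> x))) * (cis (l' * (y \<bullet> x)) * exp (- (z * of_real ((norm x)\<^sup>2)))))
     = gauss_root z ^ DIM('a) * exp (- (of_real ((norm (l' *\<^sub>R y - l *\<^sub>R w))\<^sup>2) / (4 * z)))"
proof -
  have "(LINT x|lborel. cis (- (l * (w \<bullet> x))) * (cis (l' * (y \<bullet> x)) * exp (- (z * of_real ((norm x)\<^sup>2)))))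
     = (LINT x|lborel. cis ((l' *\<^sub>R y - l *\<^sub>R w) \<bullet> x) * exp (- (z * of_real ((norm x)\<^sup>2))))"
    by (intro Bochner_Integration.integral_cong refl)
       (simp add: inner_diff_left cis_mult mult.assoc[symmetric])
  then show ?thesis by (simp only: fourier_complex_gaussian[OF d])
qed

lemma gauss_root_of_real: "d > 0 \<Longrightarrow> gauss_root (of_real d) = of_real (sqrt (pi / d))"
  using powr_of_real[of d "-1/2"]
  by (simp add: gauss_root_def real_sqrt_divide powr_minus powr_half_sqrt[symmetric] field_simps)

lemma integral_real_gaussian:
  assumes "d > 0"
  shows "(LINT x::'a::euclidean_space|lborel. exp (- (d * (norm x)\<^sup>2))) = sqrt (pi / d) ^ DIM('a)"
proof -
  have "complex_of_real (LINT x::'a|lborel. exp (- (d * (norm x)\<^sup>2))) = (LINT x::'a|lborel. of_real (exp (- (d * (norm x)\<^sup>2))))"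
    by (rule integral_complex_of_real[symmetric])
  also have "\<dots> = (LINT x::'a|lborel. cis (0 \<bullet> x) * exp (- (of_real d * of_real ((norm x)\<^sup>2))))"
    by (simp add: exp_of_real[symmetric])
  also have "\<dots> = of_real (sqrt (pi / d) ^ DIM('a))"
    using assms by (subst fourier_complex_gaussian) (auto simp: gauss_root_of_real)
  finally show ?thesis by (simp only: of_real_eq_iff)
qed

text \<open>The Gaussian damping makes all integrals converge absolutely. Two applications of the
  multiplication formula turn the damped energy into a pairing of \<open>f\<close> with its own average over a
  Gaussian of width \<open>c\<close>, which concentrates as \<open>d\<close> tends to 0.\<close>

lemma regularised_energy:
  fixes f :: "'a::euclidean_space \<Rightarrow> complex"
  assumes f: "integrable lborel f" and l: "l > 0" and d: "d > 0"
  defines "c \<equiv> 2 * sqrt d / l"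
  shows "integrable lborel (\<lambda>x. exp (- (d * (norm x)\<^sup>2)) * (cmod (FT l f x))\<^sup>2)"
    and "of_real (LINT x|lborel. exp (- (d * (norm x)\<^sup>2)) * (cmod (FT l f x))\<^sup>2) =
      of_real ((2 * sqrt pi / l) ^ DIM('a)) *
      (LINT y|lborel. (LINT v|lborel. of_real (exp (- ((norm v)\<^sup>2))) * cnj (f (y + c *\<^sub>R v))) * f y)"
proof -
  have [measurable]: "f \<in> borel_measurable borel" using f by auto
  have cf: "integrable lborel (\<lambda>x. cnj (f x))" using f by simp
  define B where "B = (LINT y|lborel. cmod (f y))"
  have B: "cmod (FT l f x) \<le> B" for x unfolding B_def by (rule norm_FT_le[OF f])
  define G where "G = (\<lambda>x::'a. complex_of_real (exp (- (d * (norm x)\<^sup>2))))"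
  have G: "integrable lborel G" unfolding G_def by (rule integrable_of_real[OF integrable_real_gaussian[OF d]])
  have Gm[measurable]: "G \<in> borel_measurable borel" using G by auto
  have gm: "(\<lambda>x::'a. exp (- (d * (norm x)\<^sup>2)) * (cmod (FT l f x))\<^sup>2) \<in> borel_measurable lborel" by measurable
  show "integrable lborel (\<lambda>x. exp (- (d * (norm x)\<^sup>2)) * (cmod (FT l f x))\<^sup>2)"
  proof (rule Bochner_Integration.integrable_bound[OF _ gm])
    show "integrable lborel (\<lambda>x::'a. exp (- (d * (norm x)\<^sup>2)) * B\<^sup>2)"
      by (intro integrable_mult_left integrable_real_gaussian d)
    show "AE x in lborel. norm (exp (- (d * (norm x)\<^sup>2)) * (cmod (FT l f x))\<^sup>2) \<le> norm (exp (- (d * (norm x)\<^sup>2)) * B\<^sup>2)"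
      using B by (auto intro!: power_mono)
  qed
  have Gc: "integrable lborel (\<lambda>x. G x * cnj (FT l f x))"
  proof (rule Bochner_Integration.integrable_bound)
    show "integrable lborel (\<lambda>x. G x * of_real B)" using G by simp
    show "(\<lambda>x. G x * cnj (FT l f x)) \<in> borel_measurable lborel" by measurable
    show "AE x in lborel. norm (G x * cnj (FT l f x)) \<le> norm (G x * of_real B)"
      using order_trans[OF B abs_ge_self] by (auto simp: norm_mult intro!: mult_left_mono)
  qed
  have inner_eq: "FT l (\<lambda>x. G x * cnj (FT l f x)) y = of_real ((2 * sqrt pi / l) ^ DIM('a)) * (LINT v|lborel. of_real (exp (- ((norm v)\<^sup>2))) * cnj (f (y + c *\<^sub>R v)))" for y
  proof -
    have K: "FT (-l) (\<lambda>x. cis (- (l * (y \<bullet> x))) * G x) w = of_real (sqrt (pi/d) ^ DIM('a) * exp (- (l\<^sup>2 * (norm (w - y))\<^sup>2 / (4 * d))))" for w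
    proof -
      have "FT (-l) (\<lambda>x. cis (- (l * (y \<bullet> x))) * G x) w = gauss_root (of_real d) ^ DIM('a) * exp (- (of_real ((norm ((-l) *\<^sub>R y - (-l) *\<^sub>R w))\<^sup>2) / (4 * of_real d)))"
        using FT_gaussian[of "of_real d" "-l" w "-l" y] d
        by (simp add: FT_def G_def exp_of_real[symmetric])
      also have "(-l) *\<^sub>R y - (-l) *\<^sub>R w = l *\<^sub>R (w - y)" by (simp add: scaleR_diff_right)
      also have "(norm (l *\<^sub>R (w - y)))\<^sup>2 = l\<^sup>2 * (norm (w - y))\<^sup>2" by (simp add: power_mult_distrib)
      finally show ?thesis using d by (simp add: gauss_root_of_real exp_of_real[symmetric])
    qed
    have "FT l (\<lambda>x. G x * cnj (FT l f x)) y = (LINT x|lborel. (cis (- (l * (y \<bullet> x))) * G x) * FT (-l) (\<lambda>y. cnj (f y)) x)"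
      by (subst FT_def) (simp add: cnj_FT mult.assoc)
    also have "\<dots> = (LINT w|lborel. FT (-l) (\<lambda>x. cis (- (l * (y \<bullet> x))) * G x) w * cnj (f w))"
      by (intro integral_mult_FT integrable_cis_mult G cf) measurable
    also have "\<dots> = (LINT w|lborel. of_real (sqrt (pi/d) ^ DIM('a) * exp (- (l\<^sup>2 * (norm (w - y))\<^sup>2 / (4 * d)))) * cnj (f w))"
      by (simp only: K)
    also have "\<dots> =
       of_real (c ^ DIM('a)) * (LINT v|lborel. of_real (sqrt (pi/d) ^ DIM('a) * exp (- (l\<^sup>2 * (norm (y + c *\<^sub>R v - y))\<^sup>2 / (4 * d)))) * cnj (f (y + c *\<^sub>R v)))"
      by (rule lborel_integral_scale) (use l d in \<open>auto simp: c_def\<close>)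
    also have "(\<lambda>v. of_real (sqrt (pi/d) ^ DIM('a) * exp (- (l\<^sup>2 * (norm (y + c *\<^sub>R v - y))\<^sup>2 / (4 * d)))) * cnj (f (y + c *\<^sub>R v)))
      = (\<lambda>v. of_real (sqrt (pi/d) ^ DIM('a)) * (of_real (exp (- ((norm v)\<^sup>2))) * cnj (f (y + c *\<^sub>R v))))"
    proof
      fix v
      have "l\<^sup>2 * (norm (y + c *\<^sub>R v - y))\<^sup>2 / (4 * d) = (norm v)\<^sup>2"
        using l d by (simp add: c_def power_mult_distrib power_divide)
      then show "of_real (sqrt (pi/d) ^ DIM('a) * exp (- (l\<^sup>2 * (norm (y + c *\<^sub>R v - y))\<^sup>2 / (4 * d)))) * cnj (f (y + c *\<^sub>R v))
        = of_real (sqrt (pi/d) ^ DIM('a)) * (of_real (exp (- ((norm v)\<^sup>2))) * cnj (f (y + c *\<^sub>R v)))"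
        by (simp only: of_real_mult mult.assoc)
    qed
    also have "of_real (c ^ DIM('a)) * (LINT v|lborel. of_real (sqrt (pi/d) ^ DIM('a)) * (of_real (exp (- ((norm v)\<^sup>2))) * cnj (f (y + c *\<^sub>R v))))
      = of_real ((c * sqrt (pi/d)) ^ DIM('a)) * (LINT v|lborel. of_real (exp (- ((norm v)\<^sup>2))) * cnj (f (y + c *\<^sub>R v)))"
      by (simp only: integral_mult_right_zero power_mult_distrib of_real_mult mult.assoc)
    also have "c * sqrt (pi/d) = 2 * sqrt pi / l" using l d by (simp add: c_def real_sqrt_divide)
    finally show ?thesis .
  qed
  have "of_real (LINT x|lborel. exp (- (d * (norm x)\<^sup>2)) * (cmod (FT l f x))\<^sup>2) =
      (LINT x|lborel. complex_of_real (exp (- (d * (norm x)\<^sup>2)) * (cmod (FT l f x))\<^sup>2))"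
    by (rule integral_complex_of_real[symmetric])
  also have "\<dots> = (LINT x|lborel. (G x * cnj (FT l f x)) * FT l f x)"
    by (intro Bochner_Integration.integral_cong refl)
       (simp add: G_def complex_norm_square mult_ac del: of_real_power)
  also have "\<dots> = (LINT y|lborel. FT l (\<lambda>x. G x * cnj (FT l f x)) y * f y)"
    by (rule integral_mult_FT[OF Gc f])
  also have "\<dots> = (LINT y|lborel. of_real ((2 * sqrt pi / l) ^ DIM('a)) * (LINT v|lborel. of_real (exp (- ((norm v)\<^sup>2))) * cnj (f (y + c *\<^sub>R v))) * f y)"
    by (simp only: inner_eq)
  finally show "of_real (LINT x|lborel. exp (- (d * (norm x)\<^sup>2)) * (cmod (FT l f x))\<^sup>2) =
      of_real ((2 * sqrt pi / l) ^ DIM('a)) *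
      (LINT y|lborel. (LINT v|lborel. of_real (exp (- ((norm v)\<^sup>2))) * cnj (f (y + c *\<^sub>R v))) * f y)"
    by (simp only: mult.assoc integral_mult_right_zero)
qed

text \<open>For continuous, bounded, integrable functions the Gaussian averages of
  \<open>regularised_energy\<close> converge pointwise with an integrable majorant, and monotone
  convergence removes the damping on the Fourier side.\<close>

lemma
  fixes f :: "'a::euclidean_space \<Rightarrow> complex"
  assumes f: "integrable lborel f" and cont: "continuous_on UNIV f" and bdd: "\<And>x. cmod (f x) \<le> B" and l: "l > 0"
  shows integrable_FT_square: "integrable lborel (\<lambda>x. (cmod (FT l f x))\<^sup>2)"
    and plancherel: "(LINT x|lborel. (cmod (FT l f x))\<^sup>2) = (2 * pi / l) ^ DIM('a) * (LINT x|lborel. (cmod (f x))\<^sup>2)"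
proof -
  have [measurable]: "f \<in> borel_measurable borel" using f by auto
  define d where "d = (\<lambda>k::nat. 1 / real (Suc k))"
  have d: "d k > 0" for k by (simp add: d_def)
  have d0: "d \<longlonglongrightarrow> 0" unfolding d_def by (rule LIMSEQ_Suc[OF lim_1_over_n])
  define c where "c = (\<lambda>k. 2 * sqrt (d k) / l)"
  have c0: "c \<longlonglongrightarrow> 0"
  proof -
    have "c \<longlonglongrightarrow> 2 * sqrt 0 / l" unfolding c_def by (intro tendsto_intros d0) (use l in auto)
    then show ?thesis by simp
  qed
  define H where "H = (\<lambda>k y. (LINT v|lborel. of_real (exp (- ((norm v)\<^sup>2))) * cnj (f (y + c k *\<^sub>R v))))"
  have gi: "integrable lborel (\<lambda>v::'a. exp (- ((norm v)\<^sup>2)))"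
    using integrable_real_gaussian[of 1, where 'a='a] by simp
  have gI: "(LINT v::'a|lborel. exp (- ((norm v)\<^sup>2))) = sqrt pi ^ DIM('a)"
    using integral_real_gaussian[of 1, where 'a='a] by simp
  have B0: "B \<ge> 0" using order_trans[OF norm_ge_zero bdd] .
  have Hlim: "(\<lambda>k. H k y) \<longlonglongrightarrow> of_real (sqrt pi ^ DIM('a)) * cnj (f y)" for y
  proof -
    have "(\<lambda>k. H k y) \<longlonglongrightarrow> (LINT v::'a|lborel. of_real (exp (- ((norm v)\<^sup>2))) * cnj (f y))"
      unfolding H_def
    proof (rule integral_dominated_convergence[where w="\<lambda>v. exp (- ((norm v)\<^sup>2)) * B"])
      show "AE v in lborel. (\<lambda>k. of_real (exp (- ((norm v)\<^sup>2))) * cnj (f (y + c k *\<^sub>R v))) \<longlonglongrightarrow> of_real (exp (- ((norm v)\<^sup>2))) * cnj (f y)"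
      proof (rule AE_I2)
        fix v :: 'a
        have "(\<lambda>k. y + c k *\<^sub>R v) \<longlonglongrightarrow> y + 0 *\<^sub>R v" by (intro tendsto_intros c0)
        then have "(\<lambda>k. f (y + c k *\<^sub>R v)) \<longlonglongrightarrow> f y"
          using continuous_on_tendsto_compose[OF cont] by auto
        then show "(\<lambda>k. of_real (exp (- ((norm v)\<^sup>2))) * cnj (f (y + c k *\<^sub>R v))) \<longlonglongrightarrow> of_real (exp (- ((norm v)\<^sup>2))) * cnj (f y)"
          by (intro tendsto_intros)
      qed
      show "integrable lborel (\<lambda>v::'a. exp (- ((norm v)\<^sup>2)) * B)" using gi by simp
      show "(\<lambda>v. of_real (exp (- ((norm v)\<^sup>2))) * cnj (f (y + c k *\<^sub>R v))) \<in> borel_measurable lborel" for k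
        by measurable
    qed (auto simp: norm_mult bdd intro!: mult_left_mono)
    also have "(LINT v::'a|lborel. of_real (exp (- ((norm v)\<^sup>2))) * cnj (f y)) = of_real (sqrt pi ^ DIM('a)) * cnj (f y)"
      by (simp only: integral_mult_left_zero integral_complex_of_real gI)
    finally show ?thesis .
  qed
  have Hb: "cmod (H k y) \<le> sqrt pi ^ DIM('a) * B" for k y
  proof -
    have "cmod (H k y) \<le> (LINT v::'a|lborel. exp (- ((norm v)\<^sup>2)) * B)"
      unfolding H_def
    proof (rule Bochner_Integration.integral_norm_bound_integral)
      show "integrable lborel (\<lambda>v::'a. exp (- ((norm v)\<^sup>2)) * B)" using gi by simp
      then show "integrable lborel (\<lambda>v::'a. of_real (exp (- ((norm v)\<^sup>2))) * cnj (f (y + c k *\<^sub>R v)))"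
        by (rule Bochner_Integration.integrable_bound) (auto simp: norm_mult B0 bdd)
    qed (simp add: norm_mult bdd)
    then show ?thesis by (simp add: gI)
  qed
  have Hm[measurable]: "H k \<in> borel_measurable borel" for k unfolding H_def by measurable
  define A where "A = (\<lambda>k. LINT x|lborel. exp (- (d k * (norm x)\<^sup>2)) * (cmod (FT l f x))\<^sup>2)"
  have A: "of_real (A k) = of_real ((2 * sqrt pi / l) ^ DIM('a)) * (LINT y|lborel. H k y * f y)" for k
    unfolding A_def H_def c_def by (rule regularised_energy(2)[OF f l d])
  have "(\<lambda>k. LINT y|lborel. H k y * f y) \<longlonglongrightarrow> (LINT y|lborel. (of_real (sqrt pi ^ DIM('a)) * cnj (f y)) * f y)"
  proof (rule integral_dominated_convergence[where w="\<lambda>y. sqrt pi ^ DIM('a) * B * cmod (f y)"])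
    show "integrable lborel (\<lambda>y. sqrt pi ^ DIM('a) * B * cmod (f y))" using f by auto
    show "AE y in lborel. (\<lambda>k. H k y * f y) \<longlonglongrightarrow> of_real (sqrt pi ^ DIM('a)) * cnj (f y) * f y"
      by (intro AE_I2 tendsto_mult_right Hlim)
  qed (auto simp: norm_mult intro!: mult_right_mono Hb simp del: of_real_power)
  then have "(\<lambda>k. complex_of_real (A k)) \<longlonglongrightarrow> of_real ((2 * sqrt pi / l) ^ DIM('a)) * (LINT y|lborel. (of_real (sqrt pi ^ DIM('a)) * cnj (f y)) * f y)"
    unfolding A by (intro tendsto_intros)
  also have "(LINT y|lborel. (of_real (sqrt pi ^ DIM('a)) * cnj (f y)) * f y) = (LINT y|lborel. complex_of_real (sqrt pi ^ DIM('a) * (cmod (f y))\<^sup>2))"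
    by (intro Bochner_Integration.integral_cong refl) (simp add: complex_norm_square mult_ac del: of_real_power)
  also have "\<dots> = of_real (sqrt pi ^ DIM('a) * (LINT y|lborel. (cmod (f y))\<^sup>2))"
    by (simp only: integral_complex_of_real integral_mult_right_zero)
  also have "of_real ((2 * sqrt pi / l) ^ DIM('a)) * of_real (sqrt pi ^ DIM('a) * (LINT y|lborel. (cmod (f y))\<^sup>2))
    = complex_of_real ((2 * pi / l) ^ DIM('a) * (LINT y|lborel. (cmod (f y))\<^sup>2))"
  proof -
    have "(2 * sqrt pi / l) ^ DIM('a) * sqrt pi ^ DIM('a) = (2 * pi / l) ^ DIM('a)"
      unfolding power_mult_distrib[symmetric] by (simp add: mult.assoc)
    then show ?thesis by (metis mult.assoc of_real_mult)
  qed
  finally have Alim: "A \<longlonglongrightarrow> (2 * pi / l) ^ DIM('a) * (LINT y|lborel. (cmod (f y))\<^sup>2)"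
    by (simp only: tendsto_of_real_iff)
  have mono: "AE x in lborel. mono (\<lambda>k. exp (- (d k * (norm (x::'a))\<^sup>2)) * (cmod (FT l f x))\<^sup>2)"
  proof (intro AE_I2 monoI mult_right_mono)
    fix x :: 'a and m n :: nat assume "m \<le> n"
    then have "d n \<le> d m" by (simp add: d_def field_simps)
    then show "exp (- (d m * (norm x)\<^sup>2)) \<le> exp (- (d n * (norm x)\<^sup>2))"
      by (simp add: mult_right_mono)
  qed auto
  have lim: "AE x in lborel. (\<lambda>k. exp (- (d k * (norm (x::'a))\<^sup>2)) * (cmod (FT l f x))\<^sup>2) \<longlonglongrightarrow> (cmod (FT l f x))\<^sup>2"
  proof (rule AE_I2)
    fix x :: 'a
    have "(\<lambda>k. exp (- (d k * (norm x)\<^sup>2)) * (cmod (FT l f x))\<^sup>2) \<longlonglongrightarrow> exp (- (0 * (norm x)\<^sup>2)) * (cmod (FT l f x))\<^sup>2"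
      by (intro tendsto_intros d0)
    then show "(\<lambda>k. exp (- (d k * (norm x)\<^sup>2)) * (cmod (FT l f x))\<^sup>2) \<longlonglongrightarrow> (cmod (FT l f x))\<^sup>2" by simp
  qed
  have m: "(\<lambda>x. (cmod (FT l f x))\<^sup>2) \<in> borel_measurable lborel" by measurable
  note mc = regularised_energy(1)[OF f l d] mono lim Alim[unfolded A_def] m
  show "integrable lborel (\<lambda>x. (cmod (FT l f x))\<^sup>2)"
    by (rule integrable_monotone_convergence[OF mc])
  show "(LINT x|lborel. (cmod (FT l f x))\<^sup>2) = (2 * pi / l) ^ DIM('a) * (LINT x|lborel. (cmod (f x))\<^sup>2)"
    by (rule integral_monotone_convergence[OF mc])
qed

section \<open>Decay of the Fourier transform\<close>

definition diff_op :: "'a::real_normed_vector \<Rightarrow> ('a \<Rightarrow> 'b) \<Rightarrow> 'a \<Rightarrow> 'b::real_normed_vector" where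
  "diff_op h f x = f (x + h) - f x"

lemma bounded_continuous_vanishing:
  fixes f :: "'a::euclidean_space \<Rightarrow> 'b::real_normed_vector"
  assumes "continuous_on UNIV f" and "\<And>x. norm x > R \<Longrightarrow> f x = 0"
  obtains B where "B \<ge> 0" "\<And>x. norm (f x) \<le> B"
proof -
  have "compact (f ` cball 0 R)"
    by (intro compact_continuous_image continuous_on_subset[OF assms(1)]) auto
  then obtain B where B: "\<And>x. x \<in> cball 0 R \<Longrightarrow> norm (f x) \<le> B"
    by (meson bounded_iff compact_imp_bounded imageI)
  have "norm (f x) \<le> max B 0" for x
    using B[of x] assms(2)[of x] by (cases "norm x \<le> R") (auto simp: le_max_iff_disj)
  then show thesis using that[of "max B 0"] by auto
qed

lemma has_vector_derivative_diff_op: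
  assumes "\<And>x t. ((\<lambda>t. g (x + t *\<^sub>R v)) has_vector_derivative g' (x + t *\<^sub>R v)) (at t)"
  shows "((\<lambda>t. (diff_op h ^^ k) g (x + t *\<^sub>R v)) has_vector_derivative (diff_op h ^^ k) g' (x + t *\<^sub>R v)) (at t)"
proof (induction k arbitrary: x t)
  case 0
  then show ?case using assms by simp
next
  case (Suc k)
  have "((\<lambda>t. (diff_op h ^^ k) g (x + h + t *\<^sub>R v) - (diff_op h ^^ k) g (x + t *\<^sub>R v)) has_vector_derivative
     (diff_op h ^^ k) g' (x + h + t *\<^sub>R v) - (diff_op h ^^ k) g' (x + t *\<^sub>R v)) (at t)"
    by (intro has_vector_derivative_diff Suc)
  then show ?case by (simp add: diff_op_def[of h "(diff_op h ^^ k) _"] add_ac)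
qed

text \<open>An iterated difference of order \<open>k\<close> costs \<open>k\<close> derivatives. Differences replace
  integration by parts in the decay estimate for the Fourier transform.\<close>

lemma diff_op_power_bound:
  fixes f :: "'a::euclidean_space \<Rightarrow> 'b::real_normed_vector" and v :: 'a
  assumes "Ck k f" and "\<And>x. norm x > R \<Longrightarrow> f x = 0"
  shows "\<exists>C\<ge>0. \<forall>s x. norm ((diff_op (s *\<^sub>R v) ^^ k) f x) \<le> C * \<bar>s\<bar> ^ k"
  using assms
proof (induction k arbitrary: f)
  case 0
  then obtain B where "B \<ge> 0" "\<And>x. norm (f x) \<le> B"
    using bounded_continuous_vanishing[of f R] by auto
  then show ?case by auto
next
  case (Suc k)
  define f' where "f' = (\<lambda>x. frechet_derivative f (at x) v)"
  have der: "(f has_derivative frechet_derivative f (at x)) (at x)" for x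
    using Suc.prems(1) by (auto simp: frechet_derivative_works)
  have z: "f' x = 0" if "norm x > R" for x
  proof -
    have "eventually (\<lambda>y. y \<in> {y. norm y > R}) (at x)"
      using that by (intro eventually_at_in_open' open_Collect_less continuous_intros) auto
    then have "eventually (\<lambda>y. f y = 0) (at x)"
      by (rule eventually_mono) (use Suc.prems(2) in auto)
    then have "(f has_derivative (\<lambda>_. 0)) (at x)"
      using Suc.prems(2)[OF that] has_derivative_transform_eventually[of "\<lambda>_. 0" "\<lambda>_. 0" x UNIV f]
      by (auto elim!: eventually_mono)
    then have "frechet_derivative f (at x) = (\<lambda>_. 0)" by (metis frechet_derivative_at)
    then show ?thesis by (simp add: f'_def)
  qed
  have "Ck k f'" using Suc.prems(1) by (simp add: f'_def)
  from Suc.IH[OF this z] obtain C where C: "C \<ge> 0" "\<And>s x. norm ((diff_op (s *\<^sub>R v) ^^ k) f' x) \<le> C * \<bar>s\<bar> ^ k"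
    by auto
  have dv: "((\<lambda>t. f (x + t *\<^sub>R v)) has_vector_derivative f' (x + t *\<^sub>R v)) (at t)" for x t
  proof -
    have "((\<lambda>t. x + t *\<^sub>R v) has_vector_derivative v) (at t)"
      by (auto intro!: derivative_eq_intros)
    from vector_derivative_diff_chain_within[OF this, of f "frechet_derivative f (at (x + t *\<^sub>R v))"] der
    show ?thesis by (auto simp: f'_def o_def intro: has_derivative_at_withinI)
  qed
  have "norm ((diff_op (s *\<^sub>R v) ^^ Suc k) f x) \<le> C * \<bar>s\<bar> ^ Suc k" for s x
  proof -
    let ?g = "\<lambda>t. (diff_op (s *\<^sub>R v) ^^ k) f (x + t *\<^sub>R v)"
    have d: "(?g has_derivative (\<lambda>u. u *\<^sub>R (diff_op (s *\<^sub>R v) ^^ k) f' (x + t *\<^sub>R v))) (at t within UNIV)" for t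
      using has_vector_derivative_diff_op[where g=f and g'=f', OF dv, where h="s *\<^sub>R v" and k=k and x=x and t=t] by (simp add: has_vector_derivative_def)
    have o: "onorm (\<lambda>u. u *\<^sub>R (diff_op (s *\<^sub>R v) ^^ k) f' (x + t *\<^sub>R v)) \<le> C * \<bar>s\<bar> ^ k" for t
    proof (rule onorm_le)
      fix u :: real
      show "norm (u *\<^sub>R (diff_op (s *\<^sub>R v) ^^ k) f' (x + t *\<^sub>R v)) \<le> C * \<bar>s\<bar> ^ k * norm u"
        using mult_left_mono[OF C(2)[of s "x + t *\<^sub>R v"], of "\<bar>u\<bar>"] by (simp add: mult_ac)
    qed
    have "norm (?g s - ?g 0) \<le> C * \<bar>s\<bar> ^ k * norm (s - 0)"
      by (rule differentiable_bound[of UNIV]) (use d o in auto)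
    then show ?thesis by (simp add: diff_op_def mult_ac)
  qed
  then show ?case using C(1) by blast
qed

lemma integrable_translate:
  fixes f :: "'a::euclidean_space \<Rightarrow> complex"
  assumes f: "integrable lborel f"
  shows "integrable lborel (\<lambda>x. f (x + h))"
proof -
  have "integrable (distr lborel borel ((+) h)) f" using f by (simp add: lborel_distr_plus)
  then have "integrable lborel (\<lambda>x. f (h + x))"
    by (subst (asm) integrable_distr_eq) (use f in auto)
  then show ?thesis by (simp add: add.commute)
qed

lemma FT_diff_op:
  fixes f :: "'a::euclidean_space \<Rightarrow> complex"
  assumes f: "integrable lborel f"
  shows integrable_diff_op: "integrable lborel (diff_op h f)"
    and "FT l (diff_op h f) \<xi> = (cis (l * (\<xi> \<bullet> h)) - 1) * FT l f \<xi>"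
proof -
  have [measurable]: "f \<in> borel_measurable borel" using f by auto
  note fh = integrable_translate[OF f, of h]
  show "integrable lborel (diff_op h f)" unfolding diff_op_def[abs_def] using fh f by (rule Bochner_Integration.integrable_diff)
  have "FT l (diff_op h f) \<xi> = (LINT y|lborel. cis (- (l * (\<xi> \<bullet> y))) * f (y + h)) - FT l f \<xi>"
  proof -
    have "(LINT y|lborel. cis (- (l * (\<xi> \<bullet> y))) * f (y + h) - cis (- (l * (\<xi> \<bullet> y))) * f y) = (LINT y|lborel. cis (- (l * (\<xi> \<bullet> y))) * f (y + h)) - FT l f \<xi>"
      unfolding FT_def by (intro Bochner_Integration.integral_diff integrable_cis_mult f fh) measurable
    then show ?thesis by (simp add: FT_def[of l "diff_op h f"] diff_op_def right_diff_distrib)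
  qed
  also have "(LINT y|lborel. cis (- (l * (\<xi> \<bullet> y))) * f (y + h)) = cis (l * (\<xi> \<bullet> h)) * (LINT y|lborel. cis (- (l * (\<xi> \<bullet> (h + 1 *\<^sub>R y)))) * f (h + 1 *\<^sub>R y))"
    by (simp add: inner_add_right distrib_left cis_mult[symmetric] mult.assoc[symmetric] add.commute
        flip: integral_mult_right_zero)
       (simp add: cis_mult)
  also have "(LINT y|lborel. cis (- (l * (\<xi> \<bullet> (h + 1 *\<^sub>R y)))) * f (h + 1 *\<^sub>R y)) = FT l f \<xi>"
    unfolding FT_def using lborel_integral_scale[of "\<lambda>y. cis (- (l * (\<xi> \<bullet> y))) * f y" 1 h] by simp
  finally show "FT l (diff_op h f) \<xi> = (cis (l * (\<xi> \<bullet> h)) - 1) * FT l f \<xi>" by (simp add: algebra_simps)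
qed

lemma FT_diff_op_power:
  fixes f :: "'a::euclidean_space \<Rightarrow> complex"
  assumes f: "integrable lborel f"
  shows "integrable lborel ((diff_op h ^^ k) f) \<and> FT l ((diff_op h ^^ k) f) \<xi> = (cis (l * (\<xi> \<bullet> h)) - 1) ^ k * FT l f \<xi>"
  using f by (induction k) (auto simp: integrable_diff_op FT_diff_op(2))

lemma diff_op_power_vanishes:
  fixes f :: "'a::real_normed_vector \<Rightarrow> 'b::real_normed_vector"
  assumes "\<And>x. norm x > R \<Longrightarrow> f x = 0"
  shows "norm x > R + real k * norm h \<Longrightarrow> (diff_op h ^^ k) f x = 0"
proof (induction k arbitrary: x)
  case 0
  then show ?case using assms by simp
next
  case (Suc k)
  have "norm (x + h) \<ge> norm x - norm h" by (metis norm_diff_ineq)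
  then have 1: "norm (x + h) > R + real k * norm h" "norm x > R + real k * norm h"
    using Suc.prems by (auto simp: algebra_simps) (smt (verit) norm_ge_zero)
  show ?case using Suc.IH[OF 1(1)] Suc.IH[OF 1(2)] by (simp add: diff_op_def)
qed

lemma integrable_continuous_vanishing:
  fixes f :: "'a::euclidean_space \<Rightarrow> 'b::{banach, second_countable_topology}"
  assumes c: "continuous_on UNIV f" and z: "\<And>x. norm x > R \<Longrightarrow> f x = 0"
  shows "integrable lborel f"
proof -
  have "integrable lborel (\<lambda>x. indicator (cball 0 R) x *\<^sub>R f x)"
    by (rule borel_integrable_compact) (auto intro: continuous_on_subset[OF c])
  also have "(\<lambda>x. indicator (cball 0 R) x *\<^sub>R f x) = f"
    using z by (auto simp: indicator_def fun_eq_iff not_le)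
  finally show ?thesis .
qed

text \<open>A difference with step \<open>h\<close> multiplies the transform by $e^{i\xi\cdot h}-1$. The step is
  chosen such that this factor has its largest modulus 2.\<close>

lemma FT_decay_direction:
  fixes f :: "'a::euclidean_space \<Rightarrow> complex" and v :: 'a
  assumes f: "Ck (2 * m) f" "integrable lborel f" and z: "\<And>x. norm x > R \<Longrightarrow> f x = 0" and v: "norm v = 1"
  shows "\<exists>C\<ge>0. \<forall>\<xi>. cmod (FT 1 f \<xi>) * (1 + (\<xi> \<bullet> v)\<^sup>2) ^ m \<le> C"
proof -
  let ?k = "2 * m"
  obtain C where C: "C \<ge> 0" "\<And>s x. cmod ((diff_op (s *\<^sub>R v) ^^ ?k) f x) \<le> C * \<bar>s\<bar> ^ ?k"
    using diff_op_power_bound[OF f(1) z] by blast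
  define R' where "R' = R + real ?k * pi"
  define V where "V = measure lborel (cball (0::'a) R')"
  have V: "V \<ge> 0" by (simp add: V_def)
  define C0 where "C0 = (LINT y|lborel. cmod (f y))"
  have C0: "cmod (FT 1 f \<xi>) \<le> C0" for \<xi> unfolding C0_def by (rule norm_FT_le[OF f(2)])
  have big: "cmod (FT 1 f \<xi>) * \<bar>\<xi> \<bullet> v\<bar> ^ ?k \<le> C * pi ^ ?k * V" if xi: "\<bar>\<xi> \<bullet> v\<bar> \<ge> 1" for \<xi>
  proof -
    \<comment> \<open>Then \<open>\<xi> \<bullet> (s *\<^sub>R v) = pi\<close>, so that the multiplier is \<open>cis pi - 1 = - 2\<close>.\<close>
    define s where "s = pi / (\<xi> \<bullet> v)"
    have nz: "\<xi> \<bullet> v \<noteq> 0" using xi by auto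
    have s: "\<bar>s\<bar> \<le> pi" using xi nz by (simp add: s_def field_simps abs_divide)
    have iD: "integrable lborel ((diff_op (s *\<^sub>R v) ^^ ?k) f)"
      and FD: "FT 1 ((diff_op (s *\<^sub>R v) ^^ ?k) f) \<xi> = (cis (1 * (\<xi> \<bullet> (s *\<^sub>R v))) - 1) ^ ?k * FT 1 f \<xi>"
      using FT_diff_op_power[OF f(2)] by blast+
    have "1 * (\<xi> \<bullet> (s *\<^sub>R v)) = pi" using nz by (simp add: s_def)
    then have "cmod (FT 1 ((diff_op (s *\<^sub>R v) ^^ ?k) f) \<xi>) = 2 ^ ?k * cmod (FT 1 f \<xi>)"
      unfolding FD by (simp add: norm_mult norm_power)
    moreover have "1 * cmod (FT 1 f \<xi>) \<le> 2 ^ ?k * cmod (FT 1 f \<xi>)"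
      by (intro mult_right_mono one_le_power) auto
    ultimately have "cmod (FT 1 f \<xi>) \<le> cmod (FT 1 ((diff_op (s *\<^sub>R v) ^^ ?k) f) \<xi>)" by simp
    also have "\<dots> \<le> (LINT y|lborel. cmod ((diff_op (s *\<^sub>R v) ^^ ?k) f y))" by (rule norm_FT_le[OF iD])
    also have "\<dots> \<le> (LINT y|lborel. C * \<bar>s\<bar> ^ ?k * indicat_real (cball (0::'a) R') y)"
    proof (rule Bochner_Integration.integral_mono)
      show "integrable lborel (\<lambda>y. cmod ((diff_op (s *\<^sub>R v) ^^ ?k) f y))" using iD by (rule integrable_norm)
      show "integrable lborel (\<lambda>y. C * \<bar>s\<bar> ^ ?k * indicat_real (cball (0::'a) R') y)"
        by (intro integrable_mult_right integrable_real_indicator emeasure_bounded_finite) auto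
      show "cmod ((diff_op (s *\<^sub>R v) ^^ ?k) f y) \<le> C * \<bar>s\<bar> ^ ?k * indicat_real (cball 0 R') y" for y
      proof (cases "norm y \<le> R'")
        case True then show ?thesis using C(2)[of s y] by simp
      next
        case False
        have "real ?k * norm (s *\<^sub>R v) \<le> real ?k * pi" using s v by (intro mult_left_mono) auto
        then have "norm y > R + real ?k * norm (s *\<^sub>R v)" using False by (simp add: R'_def)
        then show ?thesis using diff_op_power_vanishes[where R=R and f=f and h="s *\<^sub>R v" and k="?k" and x=y] z False by simp
      qed
    qed
    also have "\<dots> = C * \<bar>s\<bar> ^ ?k * V" by (simp add: V_def)
    finally have "cmod (FT 1 f \<xi>) * \<bar>\<xi> \<bullet> v\<bar> ^ ?k \<le> C * \<bar>s\<bar> ^ ?k * V * \<bar>\<xi> \<bullet> v\<bar> ^ ?k"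
      by (intro mult_right_mono) auto
    also have "\<dots> = C * (\<bar>s\<bar> * \<bar>\<xi> \<bullet> v\<bar>) ^ ?k * V" by (simp only: power_mult_distrib mult_ac)
    also have "\<bar>s\<bar> * \<bar>\<xi> \<bullet> v\<bar> = pi" using nz by (simp add: s_def abs_divide)
    finally show ?thesis .
  qed
  have C0': "C0 \<ge> 0" by (simp add: C0_def)
  have "cmod (FT 1 f \<xi>) * (1 + (\<xi> \<bullet> v)\<^sup>2) ^ m \<le> 2 ^ m * (C0 + C * pi ^ ?k * V)" for \<xi>
  proof (cases "\<bar>\<xi> \<bullet> v\<bar> \<ge> 1")
    case True
    have "1 \<le> (\<xi> \<bullet> v)\<^sup>2" using one_le_power[OF True, of 2] by simp
    then have "(1 + (\<xi> \<bullet> v)\<^sup>2) ^ m \<le> (2 * (\<xi> \<bullet> v)\<^sup>2) ^ m" by (intro power_mono) auto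
    also have "\<dots> = 2 ^ m * \<bar>\<xi> \<bullet> v\<bar> ^ ?k" by (simp add: power_mult_distrib power_mult)
    finally have "cmod (FT 1 f \<xi>) * (1 + (\<xi> \<bullet> v)\<^sup>2) ^ m \<le> cmod (FT 1 f \<xi>) * (2 ^ m * \<bar>\<xi> \<bullet> v\<bar> ^ ?k)"
      by (intro mult_left_mono) auto
    also have "\<dots> \<le> 2 ^ m * (C * pi ^ ?k * V)" using big[OF True] by (simp add: mult.left_commute)
    also have "\<dots> \<le> 2 ^ m * (C0 + C * pi ^ ?k * V)" using C0' by simp
    finally show ?thesis .
  next
    case False
    then have "(\<xi> \<bullet> v)\<^sup>2 \<le> 1" by (simp add: abs_square_le_1)
    then have "(1 + (\<xi> \<bullet> v)\<^sup>2) ^ m \<le> 2 ^ m" by (intro power_mono) auto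
    then have "cmod (FT 1 f \<xi>) * (1 + (\<xi> \<bullet> v)\<^sup>2) ^ m \<le> C0 * 2 ^ m"
      using C0 C0' by (intro mult_mono) auto
    also have "\<dots> \<le> 2 ^ m * (C0 + C * pi ^ ?k * V)" using C V by (simp add: mult.commute)
    finally show ?thesis .
  qed
  moreover have "2 ^ m * (C0 + C * pi ^ ?k * V) \<ge> 0" using C V C0' by simp
  ultimately show ?thesis by blast
qed

lemma integrable_inverse_one_plus_square: "integrable lborel (\<lambda>x::real. inverse (1 + x\<^sup>2))"
  using integrable_inverse_1_plus_square by (simp add: set_integrable_def einterval_eq)

text \<open>Decay of order
  \<open>2 * DIM('a)\<close> in each coordinate separately suffices: multiplied over the \<open>DIM('a)\<close> coordinates,
  the bounds control the power of order \<open>DIM('a)\<close> of the transform, hence the transform itself, by a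
  constant times $\prod_b (1+\xi_b^2)^{-1}$.\<close>

lemma integrable_FT:
  fixes f :: "'a::euclidean_space \<Rightarrow> complex"
  assumes f: "smooth f" and z: "\<And>x. norm x > R \<Longrightarrow> f x = 0"
  shows "integrable lborel (FT 1 f)"
proof -
  let ?n = "DIM('a)"
  have Ck: "Ck k f" for k using f by (simp add: smooth_def)
  have cont: "continuous_on UNIV f" using Ck[of 0] by simp
  have fi: "integrable lborel f" by (rule integrable_continuous_vanishing[OF cont z])
  have [measurable]: "f \<in> borel_measurable borel" using fi by auto
  have "\<forall>b\<in>Basis. \<exists>C\<ge>0. \<forall>\<xi>. cmod (FT 1 f \<xi>) * (1 + (\<xi> \<bullet> b)\<^sup>2) ^ ?n \<le> C"
    using FT_decay_direction[OF Ck fi z] by simp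
  then obtain C where C: "\<And>b. b \<in> Basis \<Longrightarrow> C b \<ge> 0"
    "\<And>b \<xi>. b \<in> Basis \<Longrightarrow> cmod (FT 1 f \<xi>) * (1 + (\<xi> \<bullet> b)\<^sup>2) ^ ?n \<le> C b"
    by metis
  define P where "P = max 1 (\<Prod>b\<in>(Basis::'a set). C b)"
  have bound: "cmod (FT 1 f \<xi>) \<le> P * (\<Prod>b\<in>Basis. inverse (1 + (\<xi> \<bullet> b)\<^sup>2))" for \<xi>
  proof -
    let ?Q = "\<Prod>b\<in>Basis. (1 + (\<xi> \<bullet> b)\<^sup>2)"
    have pos: "?Q > 0" by (intro prod_pos) (auto simp: add_pos_nonneg)
    have "(cmod (FT 1 f \<xi>) * ?Q) ^ ?n = (\<Prod>b\<in>Basis. cmod (FT 1 f \<xi>) * (1 + (\<xi> \<bullet> b)\<^sup>2) ^ ?n)"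
      by (simp add: prod.distrib power_mult_distrib prod_power_distrib)
    also have "\<dots> \<le> (\<Prod>b\<in>Basis. C b)" by (intro prod_mono) (auto intro: C)
    also have "\<dots> \<le> P" by (simp add: P_def)
    also have "P \<le> P ^ ?n" by (rule self_le_power) (auto simp: P_def)
    finally have "cmod (FT 1 f \<xi>) * ?Q \<le> P"
      by (rule power_le_imp_le_base[where n="?n-1", simplified]) (auto simp: P_def)
    moreover have "(\<Prod>b\<in>Basis. inverse (1 + (\<xi> \<bullet> b)\<^sup>2)) = inverse ?Q"
      using prod_inversef[of "\<lambda>b. 1 + (\<xi> \<bullet> b)\<^sup>2" Basis] by (simp only: o_def)
    ultimately show ?thesis using pos by (simp only: divide_inverse[symmetric] pos_le_divide_eq)
  qed
  have i1: "integrable lborel (\<lambda>x::real. complex_of_real (inverse (1 + x\<^sup>2)))"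
    by (rule integrable_of_real[OF integrable_inverse_one_plus_square])
  have "integrable lborel (\<lambda>\<xi>::'a. cmod (\<Prod>b\<in>Basis. complex_of_real (inverse (1 + (\<xi> \<bullet> b)\<^sup>2))))"
    by (intro integrable_norm integrable_prod_Basis i1)
  then have "integrable lborel (\<lambda>\<xi>::'a. \<bar>\<Prod>b\<in>Basis. inverse (1 + (\<xi> \<bullet> b)\<^sup>2)\<bar>)"
    by (simp only: of_real_prod[symmetric] norm_of_real)
  then have "integrable lborel (\<lambda>\<xi>::'a. P * \<bar>\<Prod>b\<in>Basis. inverse (1 + (\<xi> \<bullet> b)\<^sup>2)\<bar>)"
    by (rule integrable_mult_right)
  then show ?thesis
  proof (rule Bochner_Integration.integrable_bound)
    show "FT 1 f \<in> borel_measurable lborel" by measurable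
    have "cmod (FT 1 f \<xi>) \<le> norm (P * \<bar>\<Prod>b\<in>Basis. inverse (1 + (\<xi> \<bullet> b)\<^sup>2)\<bar>)" for \<xi>
    proof -
      have "P * (\<Prod>b\<in>Basis. inverse (1 + (\<xi> \<bullet> b)\<^sup>2)) \<le> norm (P * \<bar>\<Prod>b\<in>Basis. inverse (1 + (\<xi> \<bullet> b)\<^sup>2)\<bar>)"
        by (simp add: abs_mult) (metis abs_ge_self abs_mult)
      then show ?thesis using bound[of \<xi>] by linarith
    qed
    then show "AE \<xi> in lborel. norm (FT 1 f \<xi>) \<le> norm (P * \<bar>\<Prod>b\<in>Basis. inverse (1 + (\<xi> \<bullet> b)\<^sup>2)\<bar>)" by simp
  qed
qed

section \<open>The Schroedinger group as a Fourier transform\<close>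

lemma norm_gauss_root:
  assumes "z \<noteq> 0"
  shows "(cmod (gauss_root z))\<^sup>2 = pi / cmod z"
proof -
  have "cmod (z powr (-1/2)) = exp (- ln (cmod z) / 2)"
    using assms by (simp add: powr_def)
  then have "(cmod (z powr (-1/2)))\<^sup>2 = exp (- ln (cmod z))"
    by (simp add: power2_eq_square exp_add[symmetric])
  also have "\<dots> = 1 / cmod z" using assms by (simp add: exp_minus divide_inverse)
  finally show ?thesis by (simp add: gauss_root_def norm_mult power_mult_distrib)
qed

text \<open>The explicit kernel of the free Schroedinger group: up to unimodular factors, the solution
  at time \<open>T\<close> is the transform of the initial datum multiplied by the chirp $e^{i|y|^2/(4T)}$, taken at
  frequency \<open>x / (2 * T)\<close>. Time is moved slightly into the complex plane, where the propagator is an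
  absolutely convergent Gaussian integral, and then back.\<close>

lemma norm_schroedinger:
  fixes u0 :: "real ^ 'n \<Rightarrow> complex"
  assumes u0: "integrable lborel u0" and Fu0: "integrable lborel (FT 1 u0)" and T: "T > 0"
  shows "(cmod (schroedinger T u0 x))\<^sup>2 =
    (1 / (4 * pi * T)) ^ CARD('n) * (cmod (FT (1 / (2 * T)) (\<lambda>y. cis ((norm y)\<^sup>2 / (4 * T)) * u0 y) x))\<^sup>2"
proof -
  define K where "K = (2 * pi) powr (- (real CARD('n) / 2))"
  have K4: "(K * K)\<^sup>2 = (1 / (4 * pi\<^sup>2)) ^ CARD('n)"
  proof -
    have "K * K = (2 * pi) powr (- real CARD('n))" unfolding K_def powr_add[symmetric] by simp
    also have "\<dots> = (1 / (2 * pi)) ^ CARD('n)" by (simp add: powr_minus powr_realpow power_one_over inverse_eq_divide)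
    finally show ?thesis by (simp add: power_mult[symmetric] mult.commute[of _ 2]) (simp add: power_mult power_divide power_mult_distrib)
  qed
  have four: "fourier u0 \<xi> = of_real K * FT 1 u0 \<xi>" for \<xi>
    by (simp add: fourier_def FT_def K_def inner_commute)
  define J where "J = (LINT \<xi>|lborel. cis (x \<bullet> \<xi>) * (cis (- (T * (norm \<xi>)\<^sup>2)) * FT 1 u0 \<xi>))"
  have S: "schroedinger T u0 x = of_real (K * K) * J"
  proof -
    have "schroedinger T u0 x = of_real K * (LINT \<xi>|lborel. of_real K * (cis (x \<bullet> \<xi>) * (cis (- (T * (norm \<xi>)\<^sup>2)) * FT 1 u0 \<xi>)))"
      unfolding schroedinger_def four K_def[symmetric] by (simp add: mult_ac)
    then show ?thesis unfolding J_def integral_mult_right_zero by simp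
  qed
  define z where "z = (\<lambda>k. complex_of_real (1 / real (Suc k)) + \<i> * of_real T)"
  have Rez: "Re (z k) > 0" for k by (simp add: z_def)
  have zlim: "z \<longlonglongrightarrow> \<i> * of_real T"
  proof -
    have "z \<longlonglongrightarrow> of_real 0 + \<i> * of_real T" unfolding z_def
      by (intro tendsto_intros LIMSEQ_Suc[OF lim_1_over_n])
    then show ?thesis by simp
  qed
  have lim1: "(\<lambda>k. LINT \<xi>|lborel. (cis (x \<bullet> \<xi>) * exp (- (z k * of_real ((norm \<xi>)\<^sup>2)))) * FT 1 u0 \<xi>) \<longlonglongrightarrow> J"
    unfolding J_def mult.assoc[symmetric]
  proof (rule integral_dominated_convergence[where w="\<lambda>\<xi>. cmod (FT 1 u0 \<xi>)"])
    have [measurable]: "FT 1 u0 \<in> borel_measurable borel" using Fu0 by auto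
    show "(\<lambda>\<xi>. cis (x \<bullet> \<xi>) * cis (- (T * (norm \<xi>)\<^sup>2)) * FT 1 u0 \<xi>) \<in> borel_measurable lborel" by measurable
    show "(\<lambda>\<xi>. cis (x \<bullet> \<xi>) * exp (- (z k * of_real ((norm \<xi>)\<^sup>2))) * FT 1 u0 \<xi>) \<in> borel_measurable lborel" for k by measurable
    show "integrable lborel (\<lambda>\<xi>. cmod (FT 1 u0 \<xi>))" using Fu0 by simp
    show "AE \<xi> in lborel. (\<lambda>k. cis (x \<bullet> \<xi>) * exp (- (z k * of_real ((norm \<xi>)\<^sup>2))) * FT 1 u0 \<xi>) \<longlonglongrightarrow> cis (x \<bullet> \<xi>) * cis (- (T * (norm \<xi>)\<^sup>2)) * FT 1 u0 \<xi>"
    proof (rule AE_I2)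
      fix \<xi> :: "real ^ 'n"
      have "(\<lambda>k. cis (x \<bullet> \<xi>) * exp (- (z k * of_real ((norm \<xi>)\<^sup>2))) * FT 1 u0 \<xi>) \<longlonglongrightarrow> cis (x \<bullet> \<xi>) * exp (- (\<i> * of_real T * of_real ((norm \<xi>)\<^sup>2))) * FT 1 u0 \<xi>"
        by (intro tendsto_intros zlim)
      also have "exp (- (\<i> * of_real T * of_real ((norm \<xi>)\<^sup>2))) = cis (- (T * (norm \<xi>)\<^sup>2))"
        by (simp add: cis_conv_exp mult_ac)
      finally show "(\<lambda>k. cis (x \<bullet> \<xi>) * exp (- (z k * of_real ((norm \<xi>)\<^sup>2))) * FT 1 u0 \<xi>) \<longlonglongrightarrow> cis (x \<bullet> \<xi>) * cis (- (T * (norm \<xi>)\<^sup>2)) * FT 1 u0 \<xi>" .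
    qed
    show "AE \<xi> in lborel. norm (cis (x \<bullet> \<xi>) * exp (- (z k * of_real ((norm \<xi>)\<^sup>2))) * FT 1 u0 \<xi>) \<le> cmod (FT 1 u0 \<xi>)" for k
    proof (rule AE_I2)
      fix \<xi> :: "real ^ 'n"
      have "exp (- (Re (z k) * (norm \<xi>)\<^sup>2)) \<le> 1" using Rez[of k] by simp
      then show "norm (cis (x \<bullet> \<xi>) * exp (- (z k * of_real ((norm \<xi>)\<^sup>2))) * FT 1 u0 \<xi>) \<le> cmod (FT 1 u0 \<xi>)"
        by (simp add: norm_mult mult_left_le_one_le)
    qed
  qed
  have eq: "(LINT \<xi>|lborel. (cis (x \<bullet> \<xi>) * exp (- (z k * of_real ((norm \<xi>)\<^sup>2)))) * FT 1 u0 \<xi>)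
      = gauss_root (z k) ^ CARD('n) * (LINT y|lborel. exp (- (of_real ((norm (x - y))\<^sup>2) / (4 * z k))) * u0 y)" for k
  proof -
    have "(LINT \<xi>|lborel. (cis (x \<bullet> \<xi>) * exp (- (z k * of_real ((norm \<xi>)\<^sup>2)))) * FT 1 u0 \<xi>)
      = (LINT y|lborel. FT 1 (\<lambda>\<xi>. cis (x \<bullet> \<xi>) * exp (- (z k * of_real ((norm \<xi>)\<^sup>2)))) y * u0 y)"
      by (rule integral_mult_FT[OF integrable_complex_gaussian[OF Rez] u0])
    also have "\<dots> = (LINT y|lborel. gauss_root (z k) ^ CARD('n) * (exp (- (of_real ((norm (x - y))\<^sup>2) / (4 * z k))) * u0 y))"
      using FT_gaussian[OF Rez[of k], of 1 _ 1 x] by (simp add: FT_def mult.assoc)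
    finally show ?thesis by simp
  qed
  have lim2: "(\<lambda>k. LINT y|lborel. exp (- (of_real ((norm (x - y))\<^sup>2) / (4 * z k))) * u0 y) \<longlonglongrightarrow>
     (LINT y|lborel. cis ((norm (x - y))\<^sup>2 / (4 * T)) * u0 y)"
  proof (rule integral_dominated_convergence[where w="\<lambda>y. cmod (u0 y)"])
    have [measurable]: "u0 \<in> borel_measurable borel" using u0 by auto
    show "(\<lambda>y. cis ((norm (x - y))\<^sup>2 / (4 * T)) * u0 y) \<in> borel_measurable lborel" by measurable
    show "(\<lambda>y. exp (- (of_real ((norm (x - y))\<^sup>2) / (4 * z k))) * u0 y) \<in> borel_measurable lborel" for k by measurable
    show "integrable lborel (\<lambda>\<xi>. cmod (u0 \<xi>))" using u0 by simp
    show "AE y in lborel. (\<lambda>k. exp (- (of_real ((norm (x - y))\<^sup>2) / (4 * z k))) * u0 y) \<longlonglongrightarrow> cis ((norm (x - y))\<^sup>2 / (4 * T)) * u0 y"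
    proof (rule AE_I2)
      fix y :: "real ^ 'n"
      have "(\<lambda>k. exp (- (of_real ((norm (x - y))\<^sup>2) / (4 * z k))) * u0 y) \<longlonglongrightarrow> exp (- (of_real ((norm (x - y))\<^sup>2) / (4 * (\<i> * of_real T)))) * u0 y"
        by (intro tendsto_intros zlim) (use T in auto)
      also have "exp (- (of_real ((norm (x - y))\<^sup>2) / (4 * (\<i> * of_real T)))) = cis ((norm (x - y))\<^sup>2 / (4 * T))"
      proof -
        have "of_real ((norm (x - y))\<^sup>2) / (4 * (\<i> * of_real T)) = complex_of_real ((norm (x - y))\<^sup>2 / (4 * T)) / \<i>"
        proof -
          have "4 * (\<i> * of_real T) = complex_of_real (4 * T) * \<i>" by simp
          then show ?thesis by (metis divide_divide_eq_left of_real_divide)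
        qed
        also have "\<dots> = - (\<i> * complex_of_real ((norm (x - y))\<^sup>2 / (4 * T)))" by simp
        finally show ?thesis by (simp only: cis_conv_exp minus_minus)
      qed
      finally show "(\<lambda>k. exp (- (of_real ((norm (x - y))\<^sup>2) / (4 * z k))) * u0 y) \<longlonglongrightarrow> cis ((norm (x - y))\<^sup>2 / (4 * T)) * u0 y" .
    qed
    show "AE y in lborel. norm (exp (- (of_real ((norm (x - y))\<^sup>2) / (4 * z k))) * u0 y) \<le> cmod (u0 y)" for k
    proof (rule AE_I2)
      fix y :: "real ^ 'n"
      have "0 \<le> Re (of_real ((norm (x - y))\<^sup>2) / (4 * z k))"
        using Rez[of k] by (simp add: Re_divide)
      then show "norm (exp (- (of_real ((norm (x - y))\<^sup>2) / (4 * z k))) * u0 y) \<le> cmod (u0 y)"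
        by (simp add: norm_mult mult_left_le_one_le del: of_real_power)
    qed
  qed
  have lim3: "(\<lambda>k. gauss_root (z k)) \<longlonglongrightarrow> gauss_root (\<i> * of_real T)"
    unfolding gauss_root_def using T
    by (intro tendsto_intros zlim) (auto simp: complex_nonpos_Reals_iff)
  have J: "J = gauss_root (\<i> * of_real T) ^ CARD('n) * (LINT y|lborel. cis ((norm (x - y))\<^sup>2 / (4 * T)) * u0 y)"
    by (rule LIMSEQ_unique[OF lim1]) (unfold eq, intro tendsto_intros lim2 lim3)
  have "(LINT y|lborel. cis ((norm (x - y))\<^sup>2 / (4 * T)) * u0 y) =
     (LINT y|lborel. cis ((norm x)\<^sup>2 / (4 * T)) * (cis (- (1 / (2 * T) * (x \<bullet> y))) * (cis ((norm y)\<^sup>2 / (4 * T)) * u0 y)))"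
  proof (intro Bochner_Integration.integral_cong refl)
    fix y :: "real ^ 'n"
    have "(norm (x - y))\<^sup>2 / (4 * T) = (norm x)\<^sup>2 / (4 * T) + (- (1 / (2 * T) * (x \<bullet> y)) + (norm y)\<^sup>2 / (4 * T))"
      using T by (simp add: power2_norm_eq_inner inner_diff inner_commute field_simps)
    then show "cis ((norm (x - y))\<^sup>2 / (4 * T)) * u0 y = cis ((norm x)\<^sup>2 / (4 * T)) * (cis (- (1 / (2 * T) * (x \<bullet> y))) * (cis ((norm y)\<^sup>2 / (4 * T)) * u0 y))"
      by (simp only: cis_mult[symmetric] mult.assoc)
  qed
  also have "\<dots> = cis ((norm x)\<^sup>2 / (4 * T)) * FT (1 / (2 * T)) (\<lambda>y. cis ((norm y)\<^sup>2 / (4 * T)) * u0 y) x"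
    by (simp only: FT_def integral_mult_right_zero)
  finally have "(cmod J)\<^sup>2 = ((cmod (gauss_root (\<i> * of_real T)))\<^sup>2) ^ CARD('n) * (cmod (FT (1 / (2 * T)) (\<lambda>y. cis ((norm y)\<^sup>2 / (4 * T)) * u0 y) x))\<^sup>2"
    unfolding J by (simp add: norm_mult norm_power power_mult_distrib flip: power_mult) (simp add: mult.commute)
  also have "(cmod (gauss_root (\<i> * of_real T)))\<^sup>2 = pi / T"
    using norm_gauss_root[of "\<i> * of_real T"] T by (simp add: norm_mult)
  finally have "(cmod (schroedinger T u0 x))\<^sup>2 = (K * K)\<^sup>2 * ((pi / T) ^ CARD('n) * (cmod (FT (1 / (2 * T)) (\<lambda>y. cis ((norm y)\<^sup>2 / (4 * T)) * u0 y) x))\<^sup>2)"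
    unfolding S by (simp add: norm_mult power_mult_distrib)
  also have "(K * K)\<^sup>2 * ((pi / T) ^ CARD('n) * X) = (1 / (4 * pi * T)) ^ CARD('n) * X" for X
    unfolding K4 mult.assoc[symmetric] power_mult_distrib[symmetric]
    by (simp add: power2_eq_square)
  finally show ?thesis .
qed

section \<open>The spectral inequality\<close>

text \<open>The exponent that a two-constants theorem provides at the origin for entire functions that
  are small on both real rays beyond \<open>\<rho>\<close> and bounded in the strip of half-width \<open>Y\<close>. The argument
  that follows is the same for both theorems above; they enter only through the exponent.\<close>

definition interpolation_exponent :: "real \<Rightarrow> real \<Rightarrow> real \<Rightarrow> bool" where
  "interpolation_exponent \<rho> Y \<theta> \<longleftrightarrow>
     (\<forall>h e M. h holomorphic_on UNIV \<longrightarrow> 0 < e \<longrightarrow> e \<le> M \<longrightarrow>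
        (\<forall>z. \<bar>Im z\<bar> \<le> Y \<longrightarrow> cmod (h z) \<le> M) \<longrightarrow>
        (\<forall>s::real. \<bar>s\<bar> \<ge> \<rho> \<longrightarrow> cmod (h (of_real s)) \<le> e) \<longrightarrow>
        cmod (h 0) \<le> e powr \<theta> * M powr (1 - \<theta>))"

lemma interpolation_exponent_two_rays:
  assumes "0 < \<rho>" "0 < Y"
  shows "interpolation_exponent \<rho> Y (1 - \<rho> / Y)"
  unfolding interpolation_exponent_def
proof (intro allI impI)
  fix h e M
  assume "h holomorphic_on UNIV" "0 < e" "e \<le> M" "\<forall>z. \<bar>Im z\<bar> \<le> Y \<longrightarrow> cmod (h z) \<le> M"
    "\<forall>s::real. \<bar>s\<bar> \<ge> \<rho> \<longrightarrow> cmod (h (of_real s)) \<le> e"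
  then show "cmod (h 0) \<le> e powr (1 - \<rho>/Y) * M powr (1 - (1 - \<rho>/Y))"
    using two_constants_two_rays[of h \<rho> Y e M] assms by simp
qed

lemma interpolation_exponent_one_ray:
  assumes "0 < \<rho>" "0 < Y" "\<theta> \<le> (1/2) powr (32 * (1 + \<rho>/Y))"
  shows "interpolation_exponent \<rho> Y \<theta>"
  unfolding interpolation_exponent_def
proof (intro allI impI)
  fix h e M
  assume "h holomorphic_on UNIV" "0 < e" "e \<le> M" "\<forall>z. \<bar>Im z\<bar> \<le> Y \<longrightarrow> cmod (h z) \<le> M"
    "\<forall>s::real. \<bar>s\<bar> \<ge> \<rho> \<longrightarrow> cmod (h (of_real s)) \<le> e"
  then show "cmod (h 0) \<le> e powr \<theta> * M powr (1 - \<theta>)"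
    using two_constants_one_ray[of h Y \<rho> e M \<theta>] assms by simp
qed

lemma Cauchy_Schwarz_integral:
  fixes u v :: "'m \<Rightarrow> complex"
  assumes [measurable]: "u \<in> borel_measurable M" "v \<in> borel_measurable M"
    and u: "integrable M (\<lambda>x. (cmod (u x))\<^sup>2)" and v: "integrable M (\<lambda>x. (cmod (v x))\<^sup>2)"
  shows "cmod (LINT x|M. u x * v x) \<le> sqrt (LINT x|M. (cmod (u x))\<^sup>2) * sqrt (LINT x|M. (cmod (v x))\<^sup>2)"
proof (cases "integrable M (\<lambda>x. u x * v x)")
  case False
  then show ?thesis by (simp add: not_integrable_integral_eq)
next
  case True
  let ?U = "LINT x|M. (cmod (u x))\<^sup>2" and ?V = "LINT x|M. (cmod (v x))\<^sup>2"
  let ?I = "LINT x|M. u x * v x"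
  have "ennreal (cmod ?I) \<le> (\<integral>\<^sup>+x. ennreal (cmod (u x * v x)) \<partial>M)"
    by (rule integral_norm_bound_ennreal[OF True])
  also have "\<dots> = (\<integral>\<^sup>+x. ennreal (cmod (u x)) * ennreal (cmod (v x)) \<partial>M)"
    by (simp add: norm_mult ennreal_mult)
  finally have "(ennreal (cmod ?I))\<^sup>2 \<le> (\<integral>\<^sup>+x. ennreal (cmod (u x)) * ennreal (cmod (v x)) \<partial>M)\<^sup>2"
    by (intro power_mono) auto
  also have "\<dots> \<le> (\<integral>\<^sup>+x. (ennreal (cmod (u x)))\<^sup>2 \<partial>M) * (\<integral>\<^sup>+x. (ennreal (cmod (v x)))\<^sup>2 \<partial>M)"
    by (rule Cauchy_Schwarz_nn_integral) measurable
  also have "\<dots> = ennreal ?U * ennreal ?V"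
    using u v by (simp add: ennreal_power nn_integral_eq_integral)
  finally have "ennreal ((cmod ?I)\<^sup>2) \<le> ennreal (?U * ?V)"
    by (simp add: ennreal_power ennreal_mult)
  then have "(cmod ?I)\<^sup>2 \<le> ?U * ?V" by (subst (asm) ennreal_le_iff) auto
  then have "cmod ?I \<le> sqrt (?U * ?V)" by (rule real_le_rsqrt)
  then show ?thesis by (simp add: real_sqrt_mult)
qed

lemma lborel_integral_translate:
  fixes f :: "'a::euclidean_space \<Rightarrow> real"
  assumes [measurable]: "f \<in> borel_measurable borel"
  shows "(LINT x|lborel. f (x + h)) = (LINT x|lborel. f x)"
proof -
  have "(LINT x|lborel. f x) = (LINT x|distr lborel borel ((+) h). f x)" by (simp add: lborel_distr_plus)
  also have "\<dots> = (LINT x|lborel. f (h + x))" by (rule integral_distr) measurable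
  finally show ?thesis by (simp add: add.commute)
qed

text \<open>The transform of the tilted function is the analytic continuation of the transform of \<open>g\<close>
  in the direction \<open>b\<close>: at real \<open>z\<close> it is the translate by \<open>z *\<^sub>R b\<close>.\<close>

definition tilt :: "real \<Rightarrow> 'a::euclidean_space \<Rightarrow> ('a \<Rightarrow> complex) \<Rightarrow> complex \<Rightarrow> 'a \<Rightarrow> complex" where
  "tilt l b g z y = exp (- (\<i> * of_real (l * (y \<bullet> b)) * z)) * g y"

lemma norm_tilt: "cmod (tilt l b g z y) = exp (l * Im z * (y \<bullet> b)) * cmod (g y)"
  by (simp add: tilt_def norm_mult mult_ac)

lemma FT_tilt_of_real: "FT l (tilt l b g (of_real s)) x = FT l g (x + s *\<^sub>R b)"
proof -
  have "cis (- (l * (x \<bullet> y))) * exp (- (\<i> * of_real (l * (y \<bullet> b)) * of_real s)) = cis (- (l * ((x + s *\<^sub>R b) \<bullet> y)))" for y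
    by (simp add: cis_conv_exp exp_add[symmetric] inner_add_left inner_commute algebra_simps)
  then show ?thesis by (simp add: FT_def tilt_def mult.assoc[symmetric])
qed

locale vanishing_far =
  fixes g :: "'a::euclidean_space \<Rightarrow> complex" and R :: real
  assumes cont: "continuous_on UNIV g" and van: "\<And>x. norm x > R \<Longrightarrow> g x = 0"
begin

lemma measurable_g [measurable]: "g \<in> borel_measurable borel"
  using cont by (rule borel_measurable_continuous_onI)

lemma tilt_props:
  shows cont_tilt: "continuous_on UNIV (tilt l b g z)"
    and integrable_tilt: "integrable lborel (tilt l b g z)"
    and bounded_tilt: "\<exists>B. \<forall>x. cmod (tilt l b g z x) \<le> B"
proof -
  show c: "continuous_on UNIV (tilt l b g z)"
    unfolding tilt_def[abs_def] by (intro continuous_intros cont)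
  have v: "tilt l b g z x = 0" if "norm x > R" for x using van[OF that] by (simp add: tilt_def)
  show "integrable lborel (tilt l b g z)" by (rule integrable_continuous_vanishing[OF c v])
  show "\<exists>B. \<forall>x. cmod (tilt l b g z x) \<le> B"
    using bounded_continuous_vanishing[OF c v] by metis
qed

lemma measurable_tilt [measurable]: "tilt l b g z \<in> borel_measurable borel"
  using cont_tilt by (rule borel_measurable_continuous_onI)

lemma plancherel_tilt:
  assumes l: "l > 0"
  shows "integrable lborel (\<lambda>x. (cmod (FT l (tilt l b g z) x))\<^sup>2)"
    and "(LINT x|lborel. (cmod (FT l (tilt l b g z) x))\<^sup>2) =
       (2 * pi / l) ^ DIM('a) * (LINT y|lborel. exp (2 * l * Im z * (y \<bullet> b)) * (cmod (g y))\<^sup>2)"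
proof -
  obtain B where B: "\<And>x. cmod (tilt l b g z x) \<le> B" using bounded_tilt by metis
  note p = integrable_tilt cont_tilt B l
  show "integrable lborel (\<lambda>x. (cmod (FT l (tilt l b g z) x))\<^sup>2)" by (rule integrable_FT_square[OF p])
  have "(cmod (tilt l b g z y))\<^sup>2 = exp (2 * l * Im z * (y \<bullet> b)) * (cmod (g y))\<^sup>2" for y
    by (simp add: norm_tilt power_mult_distrib exp_double[symmetric] mult_ac)
  then show "(LINT x|lborel. (cmod (FT l (tilt l b g z) x))\<^sup>2) =
       (2 * pi / l) ^ DIM('a) * (LINT y|lborel. exp (2 * l * Im z * (y \<bullet> b)) * (cmod (g y))\<^sup>2)"
    using plancherel[OF p] by simp
qed

lemma tilt_0 [simp]: "tilt l b g 0 = g" by (simp add: tilt_def fun_eq_iff)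

lemma holomorphic_tilted_integral:
  assumes k[measurable]: "k \<in> borel_measurable borel" and K: "\<And>y. cmod (k y) \<le> K" and b: "norm b \<le> 1" and l: "l > 0"
  shows "(\<lambda>z. LINT y|lborel. k y * tilt l b g z y) holomorphic_on UNIV"
proof -
  let ?h = "\<lambda>z. LINT y|lborel. k y * tilt l b g z y"
  have K0: "K \<ge> 0" using order_trans[OF norm_ge_zero K] .
  have gi: "integrable lborel g" using integrable_tilt[of l b 0] by simp
  have "?h holomorphic_on ball 0 n" for n :: real
  proof (rule holomorphic_integral[where f'="\<lambda>z y. - (\<i> * of_real (l * (y \<bullet> b))) * (k y * tilt l b g z y)"
      and g="\<lambda>y. l * \<bar>R\<bar> * (K * (exp (l * n * \<bar>R\<bar>) * cmod (g y)))"])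
    show "integrable lborel (\<lambda>y. l * \<bar>R\<bar> * (K * (exp (l * n * \<bar>R\<bar>) * cmod (g y))))"
      using gi by (intro integrable_mult_right integrable_norm)
    fix z assume "z \<in> ball (0::complex) n"
    then have z: "cmod z \<le> n" by simp
    show "integrable lborel (\<lambda>y. k y * tilt l b g z y)"
    proof (rule Bochner_Integration.integrable_bound)
      show "integrable lborel (\<lambda>y. K * cmod (tilt l b g z y))" using integrable_tilt by (intro integrable_mult_right integrable_norm)
      show "AE y in lborel. norm (k y * tilt l b g z y) \<le> norm (K * cmod (tilt l b g z y))"
        using K K0 by (auto simp: norm_mult intro!: mult_right_mono)
    qed measurable
    show "(\<lambda>y. - (\<i> * of_real (l * (y \<bullet> b))) * (k y * tilt l b g z y)) \<in> borel_measurable lborel" by measurable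
    show "((\<lambda>z. k y * tilt l b g z y) has_field_derivative - (\<i> * of_real (l * (y \<bullet> b))) * (k y * tilt l b g z y)) (at z)" for y
      unfolding tilt_def by (auto intro!: derivative_eq_intros)
    show "cmod (- (\<i> * of_real (l * (y \<bullet> b))) * (k y * tilt l b g z y)) \<le> l * \<bar>R\<bar> * (K * (exp (l * n * \<bar>R\<bar>) * cmod (g y)))" for y
    proof (cases "norm y > R")
      case True
      then show ?thesis using van by (simp add: tilt_def)
    next
      case False
      have yb: "\<bar>y \<bullet> b\<bar> \<le> \<bar>R\<bar>"
      proof -
        have "\<bar>y \<bullet> b\<bar> \<le> norm y * norm b" by (rule Cauchy_Schwarz_ineq2)
        also have "\<dots> \<le> norm y * 1" using b by (intro mult_left_mono) auto
        finally show ?thesis using False by linarith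
      qed
      have "Im z * (y \<bullet> b) \<le> \<bar>Im z\<bar> * \<bar>y \<bullet> b\<bar>" by (metis abs_ge_self abs_mult)
      also have "\<dots> \<le> n * \<bar>R\<bar>" using yb z abs_Im_le_cmod[of z] by (intro mult_mono) auto
      finally have "l * (Im z * (y \<bullet> b)) \<le> l * (n * \<bar>R\<bar>)" using l by (intro mult_left_mono) auto
      then have "exp (l * Im z * (y \<bullet> b)) \<le> exp (l * n * \<bar>R\<bar>)" by (simp add: mult_ac)
      then have 1: "cmod (tilt l b g z y) \<le> exp (l * n * \<bar>R\<bar>) * cmod (g y)"
        unfolding norm_tilt by (intro mult_right_mono) auto
      have "cmod (- (\<i> * of_real (l * (y \<bullet> b))) * (k y * tilt l b g z y)) = (l * \<bar>y \<bullet> b\<bar>) * (cmod (k y) * cmod (tilt l b g z y))"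
        using l by (simp add: norm_mult abs_mult)
      also have "\<dots> \<le> l * \<bar>R\<bar> * (K * (exp (l * n * \<bar>R\<bar>) * cmod (g y)))"
        using yb l K0 K 1 by (intro mult_mono) auto
      finally show ?thesis .
    qed
  qed auto
  then have "?h field_differentiable at z" for z
    by (rule holomorphic_on_imp_differentiable_at[of _ "ball 0 (cmod z + 1)"]) auto
  then show ?thesis by (simp add: holomorphic_on_def field_differentiable_at_within)
qed

text \<open>Spectral inequality. Let \<open>F\<close> be the transform of \<open>g\<close>, and let \<open>h z\<close> be the inner product,
  over the ball of radius \<open>r\<close>, of the continued translate \<open>F (x + z b)\<close> with \<open>F\<close>. Then \<open>h 0\<close> is the energy
  in the ball. For real \<open>z\<close> beyond \<open>2 * r\<close> the translated ball lies outside the ball, so \<open>h\<close> is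
  controlled by the energy \<open>E\<close> outside; in the strip it is controlled by \<open>M\<close>, by Plancherel's identity.
  The two-constants theorem compares the three.\<close>

lemma energy_interpolation:
  assumes l: "l > 0" and r: "r > 0" and b: "norm b = 1" and Y: "Y > 0" and \<theta>: "0 < \<theta>" "\<theta> < 1"
    and ex: "interpolation_exponent (3 * r) Y \<theta>"
    and M: "\<And>t. \<bar>t\<bar> \<le> Y \<Longrightarrow> (2 * pi / l) ^ DIM('a) * (LINT y|lborel. exp (2 * l * t * (y \<bullet> b)) * (cmod (g y))\<^sup>2) \<le> M"
  defines "E \<equiv> (LINT x:(- cball 0 r)|lborel. (cmod (FT l g x))\<^sup>2)"
  shows "(LINT x|lborel. (cmod (FT l g x))\<^sup>2) \<le> 2 * E powr \<theta> * M powr (1 - \<theta>)"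
proof -
  define F where "F = FT l g"
  have gi: "integrable lborel g" using integrable_tilt[of l b 0] by simp
  have [measurable]: "cball (0::'a) r \<in> sets borel" "- cball (0::'a) r \<in> sets borel" by auto
  have [measurable]: "F \<in> borel_measurable borel" unfolding F_def by measurable
  have F2: "integrable lborel (\<lambda>x. (cmod (F x))\<^sup>2)" unfolding F_def using plancherel_tilt(1)[OF l, of b 0] by simp
  define A where "A = (LINT x|lborel. indicat_real (cball 0 r) x * (cmod (F x))\<^sup>2)"
  define m where "m = sqrt A"
  have A0: "A \<ge> 0" unfolding A_def by (intro Bochner_Integration.integral_nonneg) auto
  have m2: "m\<^sup>2 = A" "m \<ge> 0" using A0 by (auto simp: m_def)
  have E: "E = (LINT x|lborel. indicat_real (- cball 0 r) x * (cmod (F x))\<^sup>2)"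
    by (simp add: E_def set_lebesgue_integral_def F_def)
  have E0: "E \<ge> 0" unfolding E by (intro Bochner_Integration.integral_nonneg) auto
  have intI: "integrable lborel (\<lambda>x. indicat_real S x * (cmod (G x))\<^sup>2)" if "S \<in> sets borel" "integrable lborel (\<lambda>x. (cmod (G x))\<^sup>2)" for S G
    using integrable_real_mult_indicator[OF _ that(2), of S] that(1) by (simp add: mult.commute)
  have tot: "(LINT x|lborel. (cmod (F x))\<^sup>2) = A + E"
  proof -
    have "(LINT x|lborel. (cmod (F x))\<^sup>2) = (LINT x|lborel. indicat_real (cball 0 r) x * (cmod (F x))\<^sup>2 + indicat_real (- cball 0 r) x * (cmod (F x))\<^sup>2)"
      by (intro Bochner_Integration.integral_cong refl) (auto simp: indicator_def)
    then show ?thesis unfolding A_def E by (subst (asm) Bochner_Integration.integral_add) (auto intro!: intI F2)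
  qed
  have totM: "A + E \<le> M"
    using M[of 0] Y plancherel_tilt(2)[OF l, of b 0] unfolding tot[symmetric] F_def by simp
  \<comment> \<open>The multiplication formula moves the ball and the conjugate onto the side of \<open>g\<close>, where the dependence on \<open>z\<close> is an explicit exponential.\<close>
  define \<phi> where "\<phi> = (\<lambda>x. indicator (cball 0 r) x * cnj (F x))"
  have \<phi>m [measurable]: "\<phi> \<in> borel_measurable borel" unfolding \<phi>_def by measurable
  have \<phi>2: "(cmod (\<phi> x))\<^sup>2 = indicat_real (cball 0 r) x * (cmod (F x))\<^sup>2" for x
    by (auto simp: \<phi>_def norm_mult indicator_def)
  have \<phi>i: "integrable lborel \<phi>"
  proof (rule Bochner_Integration.integrable_bound)
    show "integrable lborel (\<lambda>x. (LINT y|lborel. cmod (g y)) * indicat_real (cball (0::'a) r) x)"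
      by (intro integrable_mult_right integrable_real_indicator emeasure_bounded_finite) auto
    show "AE x in lborel. norm (\<phi> x) \<le> norm ((LINT y|lborel. cmod (g y)) * indicat_real (cball (0::'a) r) x)"
      using order_trans[OF norm_FT_le[OF gi, of l] abs_ge_self] by (auto simp: \<phi>_def F_def norm_mult indicator_def)
  qed measurable
  define k where "k = FT l \<phi>"
  define h where "h = (\<lambda>z. LINT y|lborel. k y * tilt l b g z y)"
  have [measurable]: "k \<in> borel_measurable borel" unfolding k_def by measurable
  have hol: "h holomorphic_on UNIV" unfolding h_def
    by (rule holomorphic_tilted_integral[OF _ norm_FT_le[OF \<phi>i, of l, folded k_def]]) (use b l in auto)
  have h2: "h z = (LINT x|lborel. \<phi> x * FT l (tilt l b g z) x)" for z
    unfolding h_def k_def by (rule integral_mult_FT[OF \<phi>i integrable_tilt, symmetric])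
  have hb: "cmod (h z) \<le> m * sqrt (LINT x|lborel. indicat_real (cball 0 r) x * (cmod (FT l (tilt l b g z) x))\<^sup>2)" for z
  proof -
    let ?v = "\<lambda>x. indicator (cball 0 r) x * FT l (tilt l b g z) x"
    have v2: "(cmod (?v x))\<^sup>2 = indicat_real (cball 0 r) x * (cmod (FT l (tilt l b g z) x))\<^sup>2" for x
      by (auto simp: norm_mult indicator_def)
    have "h z = (LINT x|lborel. \<phi> x * ?v x)" unfolding h2
      by (intro Bochner_Integration.integral_cong refl) (auto simp: \<phi>_def indicator_def)
    also have "cmod \<dots> \<le> sqrt (LINT x|lborel. (cmod (\<phi> x))\<^sup>2) * sqrt (LINT x|lborel. (cmod (?v x))\<^sup>2)"
    proof (rule Cauchy_Schwarz_integral)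
      show "\<phi> \<in> borel_measurable lborel" "?v \<in> borel_measurable lborel" by measurable
      show "integrable lborel (\<lambda>x. (cmod (\<phi> x))\<^sup>2)" unfolding \<phi>2 by (intro intI F2) auto
      show "integrable lborel (\<lambda>x. (cmod (?v x))\<^sup>2)" unfolding v2 by (intro intI plancherel_tilt(1) l) auto
    qed
    finally show ?thesis unfolding \<phi>2 v2 m_def A_def .
  qed
  have h0: "h 0 = of_real A"
  proof -
    have "h 0 = (LINT x|lborel. complex_of_real (indicat_real (cball 0 r) x * (cmod (F x))\<^sup>2))"
      unfolding h2 by (intro Bochner_Integration.integral_cong refl)
       (auto simp: \<phi>_def F_def indicator_def complex_norm_square mult.commute simp del: of_real_power)
    then show ?thesis unfolding A_def by (simp only: integral_complex_of_real)
  qed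
  have strip: "cmod (h z) \<le> m * sqrt M" if "\<bar>Im z\<bar> \<le> Y" for z
  proof -
    have "(LINT x|lborel. indicat_real (cball 0 r) x * (cmod (FT l (tilt l b g z) x))\<^sup>2) \<le> (LINT x|lborel. (cmod (FT l (tilt l b g z) x))\<^sup>2)"
      by (intro Bochner_Integration.integral_mono intI plancherel_tilt(1) l) (auto simp: indicator_def)
    also have "\<dots> \<le> M" unfolding plancherel_tilt(2)[OF l] by (rule M[OF that])
    finally show ?thesis using hb[of z] m2(2) by (meson mult_left_mono order_trans real_sqrt_le_mono)
  qed
  have small: "cmod (h (of_real s)) \<le> m * sqrt E" if s: "\<bar>s\<bar> \<ge> 3 * r" for s :: real
  proof -
    have "(LINT x|lborel. indicat_real (cball 0 r) x * (cmod (FT l (tilt l b g (of_real s)) x))\<^sup>2)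
       = (LINT x|lborel. indicat_real (cball 0 r) x * (cmod (F (x + s *\<^sub>R b)))\<^sup>2)"
      by (simp add: FT_tilt_of_real F_def)
    also have "\<dots> \<le> (LINT x|lborel. indicat_real (- cball 0 r) (x + s *\<^sub>R b) * (cmod (F (x + s *\<^sub>R b)))\<^sup>2)"
    proof (rule Bochner_Integration.integral_mono)
      have i1: "integrable lborel (\<lambda>x. (cmod (F (x + s *\<^sub>R b)))\<^sup>2)"
        using plancherel_tilt(1)[OF l, of b "of_real s"] by (simp add: FT_tilt_of_real F_def)
      show "integrable lborel (\<lambda>x. indicat_real (cball 0 r) x * (cmod (F (x + s *\<^sub>R b)))\<^sup>2)"
        by (intro intI i1) auto
      have "integrable lborel (\<lambda>x. indicat_real ((\<lambda>x. x + s *\<^sub>R b) -` (- cball 0 r)) x * (cmod (F (x + s *\<^sub>R b)))\<^sup>2)"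
        by (intro intI i1) (simp add: borel_open open_vimage continuous_intros)
      then show "integrable lborel (\<lambda>x. indicat_real (- cball 0 r) (x + s *\<^sub>R b) * (cmod (F (x + s *\<^sub>R b)))\<^sup>2)"
        by (simp add: indicator_def)
      show "indicat_real (cball 0 r) x * (cmod (F (x + s *\<^sub>R b)))\<^sup>2 \<le> indicat_real (- cball 0 r) (x + s *\<^sub>R b) * (cmod (F (x + s *\<^sub>R b)))\<^sup>2" for x
      proof (cases "norm x \<le> r")
        case True
        have "norm (s *\<^sub>R b) \<le> norm (x + s *\<^sub>R b) + norm x"
          by (metis add_diff_cancel_left' norm_triangle_ineq4)
        then have "norm (x + s *\<^sub>R b) > r" using True s b r by simp
        then show ?thesis using True by (simp add: indicator_def)
      qed simp
    qed
    also have "\<dots> = E" unfolding E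
      by (rule lborel_integral_translate[of "\<lambda>x. indicat_real (- cball 0 r) x * (cmod (F x))\<^sup>2"]) measurable
    finally show ?thesis using hb[of "of_real s"] m2(2) by (meson mult_left_mono order_trans real_sqrt_le_mono)
  qed
  \<comment> \<open>The two-constants theorem needs a positive small bound; \<open>E'\<close> stands for \<open>E\<close> or, if \<open>E = 0\<close>, for a number that tends to 0.\<close>
  have main: "A \<le> E' powr \<theta> * M powr (1 - \<theta>)" if E': "E' > 0" "E \<le> E'" "E' \<le> M" for E'
  proof (cases "m = 0")
    case True
    then show ?thesis using m2 by simp
  next
    case False
    then have m: "m > 0" using m2 by simp
    have M0: "M > 0" using E' by simp
    have "cmod (h 0) \<le> (m * sqrt E') powr \<theta> * (m * sqrt M) powr (1 - \<theta>)"
    proof (rule ex[unfolded interpolation_exponent_def, rule_format, OF hol])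
      show "0 < m * sqrt E'" "m * sqrt E' \<le> m * sqrt M" using m E' by auto
      show "cmod (h z) \<le> m * sqrt M" if "\<bar>Im z\<bar> \<le> Y" for z by (rule strip[OF that])
      show "cmod (h (of_real s)) \<le> m * sqrt E'" if "\<bar>s\<bar> \<ge> 3 * r" for s :: real
        by (rule order_trans[OF small[OF that] mult_left_mono]) (use E' m in auto)
    qed
    also have "\<dots> = m * (E' powr (\<theta>/2) * M powr ((1 - \<theta>)/2))"
    proof -
      have "m powr \<theta> * m powr (1 - \<theta>) = m" using m by (simp flip: powr_add)
      moreover have "sqrt E' powr \<theta> = E' powr (\<theta>/2)" "sqrt M powr (1 - \<theta>) = M powr ((1 - \<theta>)/2)"
        using E' M0 by (simp_all add: powr_half_sqrt[symmetric] powr_powr)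
      ultimately show ?thesis using m E' M0 by (simp add: powr_mult)
    qed
    finally have "m * m \<le> m * (E' powr (\<theta>/2) * M powr ((1 - \<theta>)/2))"
      using A0 m2 by (simp add: h0 power2_eq_square)
    then have "m \<le> E' powr (\<theta>/2) * M powr ((1 - \<theta>)/2)" using m by simp
    then have "m\<^sup>2 \<le> (E' powr (\<theta>/2) * M powr ((1 - \<theta>)/2))\<^sup>2" using m by (intro power_mono) auto
    also have "\<dots> = E' powr \<theta> * M powr (1 - \<theta>)"
      by (simp add: power2_eq_square powr_add[symmetric] mult_ac)
    finally show ?thesis using m2 by simp
  qed
  have "A \<le> E powr \<theta> * M powr (1 - \<theta>)"
  proof (cases "E > 0")
    case True
    then show ?thesis using main[of E] totM A0 by simp
  next
    case False
    then have Ez: "E = 0" using E0 by simp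
    show ?thesis
    proof (cases "M > 0")
      case False
      then show ?thesis using totM A0 Ez by simp
    next
      case True
      have "((\<lambda>x. x powr \<theta> * M powr (1 - \<theta>)) \<longlongrightarrow> 0 * M powr (1 - \<theta>)) (at_right 0)"
      proof (intro tendsto_intros)
        show "((\<lambda>x::real. x powr \<theta>) \<longlongrightarrow> 0) (at_right 0)"
          using \<theta> by (intro tendsto_zero_powrI[of _ _ "\<lambda>_. \<theta>" \<theta>] tendsto_intros) (auto simp: eventually_at_right_less intro!: eventually_at_rightI[of 0 1])
      qed
      then have "A \<le> 0 * M powr (1 - \<theta>)"
      proof (rule tendsto_lowerbound)
        show "\<forall>\<^sub>F x in at_right 0. A \<le> x powr \<theta> * M powr (1 - \<theta>)"
          using True by (intro eventually_at_rightI[of 0 M]) (auto intro!: main simp: Ez)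
      qed auto
      then show ?thesis using Ez by simp
    qed
  qed
  moreover have "E \<le> E powr \<theta> * M powr (1 - \<theta>)"
  proof -
    have "E = E powr \<theta> * E powr (1 - \<theta>)" using E0 by (simp flip: powr_add)
    also have "\<dots> \<le> E powr \<theta> * M powr (1 - \<theta>)"
      using totM A0 E0 \<theta> by (intro mult_left_mono powr_mono2) auto
    finally show ?thesis .
  qed
  ultimately show ?thesis using tot unfolding F_def by simp
qed

end

section \<open>Observability with exponential and power weights\<close>

lemma Cc_infinity_vanishes:
  assumes "f \<in> Cc_infinity"
  obtains R where "\<And>x. norm x > R \<Longrightarrow> f x = 0"
proof -
  have "bounded (closure {x. f x \<noteq> 0})" using assms by (auto simp: Cc_infinity_def intro: compact_imp_bounded)
  then obtain R where "\<And>x. x \<in> closure {x. f x \<noteq> 0} \<Longrightarrow> norm x \<le> R" by (auto simp: bounded_iff)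
  then have "f x = 0" if "norm x > R" for x
    using that closure_subset[of "{x. f x \<noteq> 0}"] by (metis (mono_tags) mem_Collect_eq not_le subsetD)
  then show thesis by (rule that)
qed

lemma Cc_infinity_imp_continuous: "f \<in> Cc_infinity \<Longrightarrow> continuous_on UNIV f"
  by (auto simp: Cc_infinity_def smooth_def dest: spec[of _ 0])

text \<open>Multiplication by the chirp turns the Schroedinger evolution into a Fourier transform and
  leaves the modulus unchanged.\<close>

definition chirp :: "real \<Rightarrow> (real ^ 'n \<Rightarrow> complex) \<Rightarrow> real ^ 'n \<Rightarrow> complex" where
  "chirp T u0 y = cis ((norm y)\<^sup>2 / (4 * T)) * u0 y"

lemma norm_chirp [simp]: "cmod (chirp T u0 y) = cmod (u0 y)"
  by (simp add: chirp_def norm_mult)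

lemma vanishing_far_chirp:
  assumes "u0 \<in> Cc_infinity" "T > 0"
  obtains R where "vanishing_far (chirp T u0) R"
proof -
  obtain R where R: "\<And>x. norm x > R \<Longrightarrow> u0 x = 0" using Cc_infinity_vanishes[OF assms(1)] by blast
  have "continuous_on UNIV (chirp T u0)" unfolding chirp_def[abs_def]
    by (intro continuous_intros Cc_infinity_imp_continuous[OF assms(1)]) (use assms in auto)
  with R show thesis by (intro that[of R]) (auto simp: vanishing_far_def chirp_def)
qed

lemma schroedinger_energy_outside:
  fixes u0 :: "real ^ 'n \<Rightarrow> complex"
  assumes u0: "u0 \<in> Cc_infinity" and T: "T > 0"
  shows "(4 * pi * T) ^ CARD('n) * (LINT x:(- cball 0 r)|lborel. (cmod (schroedinger T u0 x))\<^sup>2) =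
     (LINT x:(- cball 0 r)|lborel. (cmod (FT (1 / (2 * T)) (chirp T u0) x))\<^sup>2)"
proof -
  obtain R where R: "\<And>x. norm x > R \<Longrightarrow> u0 x = 0" using Cc_infinity_vanishes[OF u0] by blast
  have i1: "integrable lborel u0" by (rule integrable_continuous_vanishing[OF Cc_infinity_imp_continuous[OF u0] R])
  have i2: "integrable lborel (FT 1 u0)" by (rule integrable_FT[OF _ R]) (use u0 in \<open>simp add: Cc_infinity_def\<close>)
  have "(4 * pi * T) ^ CARD('n) * (cmod (schroedinger T u0 x))\<^sup>2 = (cmod (FT (1 / (2 * T)) (chirp T u0) x))\<^sup>2" for x
    unfolding norm_schroedinger[OF i1 i2 T] chirp_def[abs_def] mult.assoc[symmetric] power_mult_distrib[symmetric]
    using T by simp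
  note * = this[symmetric]
  show ?thesis unfolding set_lebesgue_integral_def * by (simp add: mult.left_commute flip: integral_mult_right_zero)
qed

text \<open>The spectral inequality, read for the solution. By Plancherel's identity, the continuation
  of the transform by \<open>t\<close> in an imaginary direction costs the weight $e^{t\,(y\cdot b)/T}$ on the initial
  datum, so that a weight \<open>w\<close> is admissible as soon as it dominates $e^{Y|y|/T}$ up to a constant.\<close>

lemma observability_interpolation:
  fixes u0 :: "real ^ 'n \<Rightarrow> complex"
  assumes u0: "u0 \<in> Cc_infinity" and T: "T > 0" and r: "r > 0" and Y: "Y > 0" and \<theta>: "0 < \<theta>" "\<theta> < 1"
    and ex: "interpolation_exponent (3 * r) Y \<theta>"
    and w: "continuous_on UNIV w" and k: "k \<ge> 0"
    and tilt: "\<And>y. exp (Y / T * norm y) \<le> k * w y"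
  shows "(LINT x|lborel. (cmod (u0 x))\<^sup>2) \<le> 2 * (LINT x:(- cball 0 r)|lborel. (cmod (schroedinger T u0 x))\<^sup>2) powr \<theta> *
     (k * (LINT x|lborel. w x * (cmod (u0 x))\<^sup>2)) powr (1 - \<theta>)"
proof -
  let ?U = "LINT x:(- cball 0 r)|lborel. (cmod (schroedinger T u0 x))\<^sup>2"
  let ?W = "LINT x|lborel. w x * (cmod (u0 x))\<^sup>2"
  define g where "g = chirp T u0"
  define l where "l = 1 / (2 * T)"
  define N where "N = (2 * pi / l) ^ CARD('n)"
  have l: "l > 0" using T by (simp add: l_def)
  have N: "N > 0" using l by (simp add: N_def)
  have "2 * pi / l = 4 * pi * T" by (simp add: l_def)
  then have N': "N = (4 * pi * T) ^ CARD('n)" by (simp only: N_def)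
  obtain R where "vanishing_far g R" unfolding g_def using u0 T by (rule vanishing_far_chirp)
  then interpret vanishing_far g R .
  obtain R0 where R0: "\<And>x. norm x > R0 \<Longrightarrow> u0 x = 0" using Cc_infinity_vanishes[OF u0] by blast
  have wint: "integrable lborel (\<lambda>x. f x * (cmod (u0 x))\<^sup>2)" if "continuous_on UNIV f" for f :: "real ^ 'n \<Rightarrow> real"
    by (rule integrable_continuous_vanishing[where R=R0])
       (auto simp: R0 intro!: continuous_intros that Cc_infinity_imp_continuous[OF u0])
  have gu: "cmod (g x) = cmod (u0 x)" for x by (simp add: g_def)
  obtain b :: "real ^ 'n" where b: "b \<in> Basis" using nonempty_Basis by blast
  have w0: "k * w y \<ge> 0" for y using tilt[of y] by (meson exp_ge_zero order_trans)
  have W0: "k * ?W \<ge> 0"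
  proof -
    have "0 \<le> (LINT x|lborel. k * w x * (cmod (u0 x))\<^sup>2)"
      by (intro Bochner_Integration.integral_nonneg mult_nonneg_nonneg w0) auto
    then show ?thesis by (simp add: mult.assoc)
  qed
  have U0: "?U \<ge> 0" unfolding set_lebesgue_integral_def by (intro Bochner_Integration.integral_nonneg) auto
  have M: "(2 * pi / l) ^ DIM(real ^ 'n) * (LINT y|lborel. exp (2 * l * t * (y \<bullet> b)) * (cmod (g y))\<^sup>2) \<le> N * (k * ?W)" if t: "\<bar>t\<bar> \<le> Y" for t
  proof -
    have "(LINT y|lborel. exp (2 * l * t * (y \<bullet> b)) * (cmod (u0 y))\<^sup>2) \<le> (LINT y|lborel. k * (w y * (cmod (u0 y))\<^sup>2))"
    proof (rule Bochner_Integration.integral_mono)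
      show "integrable lborel (\<lambda>y. exp (2 * l * t * (y \<bullet> b)) * (cmod (u0 y))\<^sup>2)"
        by (intro wint continuous_intros)
      show "integrable lborel (\<lambda>y. k * (w y * (cmod (u0 y))\<^sup>2))" by (intro integrable_mult_right wint w)
      show "exp (2 * l * t * (y \<bullet> b)) * (cmod (u0 y))\<^sup>2 \<le> k * (w y * (cmod (u0 y))\<^sup>2)" for y
      proof -
        have "t * (y \<bullet> b) \<le> \<bar>t\<bar> * \<bar>y \<bullet> b\<bar>" by (metis abs_ge_self abs_mult)
        also have "\<dots> \<le> Y * norm y" using t Y Basis_le_norm[OF b, of y] by (intro mult_mono) auto
        finally have "exp (2 * l * t * (y \<bullet> b)) \<le> exp (Y / T * norm y)"
          using T by (simp add: l_def divide_right_mono)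
        also have "\<dots> \<le> k * w y" by (rule tilt)
        finally have "exp (2 * l * t * (y \<bullet> b)) \<le> k * w y" .
        then show ?thesis unfolding mult.assoc[symmetric] by (intro mult_right_mono) (auto simp: mult.assoc)
      qed
    qed
    then show ?thesis using N by (simp add: gu N_def)
  qed
  have FN: "(LINT x|lborel. (cmod (FT l g x))\<^sup>2) = N * (LINT x|lborel. (cmod (u0 x))\<^sup>2)"
    using plancherel_tilt(2)[OF l, of b 0] by (simp add: N_def gu)
  have EN: "(LINT x:(- cball 0 r)|lborel. (cmod (FT l g x))\<^sup>2) = N * ?U"
    unfolding N' g_def l_def by (rule schroedinger_energy_outside[OF u0 T, symmetric])
  have "N * (LINT x|lborel. (cmod (u0 x))\<^sup>2) \<le> 2 * (N * ?U) powr \<theta> * (N * (k * ?W)) powr (1 - \<theta>)"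
    using energy_interpolation[OF l r _ Y \<theta> ex M] b unfolding FN EN by simp
  also have "\<dots> = (N powr \<theta> * N powr (1 - \<theta>)) * (2 * ?U powr \<theta> * (k * ?W) powr (1 - \<theta>))"
    using N U0 W0 by (simp only: powr_mult less_imp_le mult_ac)
  also have "N powr \<theta> * N powr (1 - \<theta>) = N" using N by (simp flip: powr_add)
  finally show ?thesis using N by simp
qed

text \<open>A form of Young's inequality: where the power does not dominate the linear term, \<open>s\<close> is at
  most $(q/a)^{1/(\beta-1)}$.\<close>

lemma linear_le_power_weight:
  fixes q s a \<beta> :: real
  assumes "q \<ge> 0" "s \<ge> 0" "a > 0" "\<beta> > 1"
  shows "q * s \<le> a * s powr \<beta> + (q powr \<beta> / a) powr (1 / (\<beta> - 1))"
proof (cases "q = 0 \<or> s = 0")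
  case True
  then show ?thesis using assms by (auto intro!: add_nonneg_nonneg)
next
  case False
  then have q: "q > 0" and s: "s > 0" using assms by auto
  show ?thesis
  proof (cases "q \<le> a * s powr (\<beta> - 1)")
    case True
    have "q * s \<le> a * s powr (\<beta> - 1) * s" using True s by (intro mult_right_mono) auto
    also have "\<dots> = a * s powr \<beta>" using s by (simp add: powr_diff)
    finally show ?thesis by (smt (verit) powr_ge_zero)
  next
    case False
    then have "s powr (\<beta> - 1) \<le> q / a" using assms by (simp add: field_simps)
    then have "(s powr (\<beta> - 1)) powr (1 / (\<beta> - 1)) \<le> (q / a) powr (1 / (\<beta> - 1))"
      using assms by (intro powr_mono2) auto
    then have "s \<le> (q / a) powr (1 / (\<beta> - 1))" using s assms by (simp add: powr_powr)
    then have "q * s \<le> q * (q / a) powr (1 / (\<beta> - 1))" using q by (intro mult_left_mono) auto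
    also have "q = (q powr (\<beta> - 1)) powr (1 / (\<beta> - 1))" using q assms by (simp add: powr_powr)
    then have "q * (q / a) powr (1 / (\<beta> - 1)) = (q powr (\<beta> - 1) * (q / a)) powr (1 / (\<beta> - 1))"
      using q assms by (subst powr_mult) auto
    also have "q powr (\<beta> - 1) * (q / a) = q powr \<beta> / a" using q by (simp add: powr_diff)
    finally show ?thesis using assms by (smt (verit) mult_nonneg_nonneg powr_ge_zero)
  qed
qed

text \<open>The weight $e^{a|x|}$ allows a continuation to the strip of half-width \<open>a * T\<close> only, however
  large \<open>r\<close> is; so the theorem with one ray is used, and the constant 96 is three times the 32 from
  there, because the smallness begins at \<open>3 * r\<close>.\<close>

lemma observability_exponential_weight:
  "\<exists>C>0. \<exists>\<theta>\<in>{0<..<1::real}. \<forall>r>0. \<forall>a>0. \<forall>T>0.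
        \<forall>u0 \<in> (Cc_infinity :: (real ^ 'n \<Rightarrow> complex) set).
          (LINT x|lborel. (cmod (u0 x))\<^sup>2)
            \<le> C * (1 + r ^ CARD('n) / (a * T) ^ CARD('n))
              * (LINT x:(- cball 0 r)|lborel. (cmod (schroedinger T u0 x))\<^sup>2)
                  powr (\<theta> powr (1 + r / (a * T)))
              * (LINT x|lborel. exp (a * norm x) * (cmod (u0 x))\<^sup>2)
                  powr (1 - \<theta> powr (1 + r / (a * T)))"
proof (intro exI[of _ 2] bexI[of _ "(1/2) powr 96"] conjI allI impI ballI)
  show "(1/2::real) powr 96 \<in> {0<..<1}" by (simp add: power_divide)
  fix r a T :: real and u0 :: "real ^ 'n \<Rightarrow> complex"
  assume r: "r > 0" and a: "a > 0" and T: "T > 0" and u0: "u0 \<in> Cc_infinity"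
  let ?\<theta> = "((1/2::real) powr 96) powr (1 + r / (a * T))"
  have q: "1 + r / (a * T) > 0" using r a T by (simp add: add_pos_pos)
  have \<theta>: "?\<theta> = (1/2) powr (96 * (1 + r / (a * T)))" by (simp only: powr_powr)
  have "0 < ?\<theta>" by simp
  moreover have "?\<theta> < 1" unfolding \<theta>
    using powr_less_mono'[of "1/2" 0 "96 * (1 + r / (a * T))"] q by simp
  moreover have "interpolation_exponent (3 * r) (a * T) ?\<theta>"
  proof (rule interpolation_exponent_one_ray)
    have "32 * (1 + 3 * r / (a * T)) \<le> 96 * (1 + r / (a * T))" by simp
    then show "?\<theta> \<le> (1/2) powr (32 * (1 + 3 * r / (a * T)))" unfolding \<theta> by (intro powr_mono') auto
  qed (use r a T in auto)
  moreover have "continuous_on UNIV (\<lambda>x::real ^ 'n. exp (a * norm x))" by (intro continuous_intros)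
  ultimately have "(LINT x|lborel. (cmod (u0 x))\<^sup>2) \<le> 2 * (LINT x:(- cball 0 r)|lborel. (cmod (schroedinger T u0 x))\<^sup>2) powr ?\<theta> *
     (1 * (LINT x|lborel. exp (a * norm x) * (cmod (u0 x))\<^sup>2)) powr (1 - ?\<theta>)"
    using r a T by (intro observability_interpolation[OF u0 T r, of "a * T"]) auto
  also have "\<dots> = 1 * \<dots>" by simp
  also have "\<dots> \<le> (1 + r ^ CARD('n) / (a * T) ^ CARD('n)) * (2 * (LINT x:(- cball 0 r)|lborel. (cmod (schroedinger T u0 x))\<^sup>2) powr ?\<theta> *
     (1 * (LINT x|lborel. exp (a * norm x) * (cmod (u0 x))\<^sup>2)) powr (1 - ?\<theta>))"
    using r a T by (intro mult_right_mono) auto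
  finally show "(LINT x|lborel. (cmod (u0 x))\<^sup>2) \<le> 2 * (1 + r ^ CARD('n) / (a * T) ^ CARD('n))
              * (LINT x:(- cball 0 r)|lborel. (cmod (schroedinger T u0 x))\<^sup>2) powr ?\<theta>
              * (LINT x|lborel. exp (a * norm x) * (cmod (u0 x))\<^sup>2) powr (1 - ?\<theta>)"
    by (simp only: mult_ac mult_1_left)
qed simp

text \<open>A weight that grows faster than every exponential allows a continuation to arbitrarily wide
  strips. The half-width \<open>Y = 3 * r / (1 - \<gamma>)\<close> makes the exponent from the two rays equal to \<open>\<gamma>\<close>, and
  Young's inequality gives the price of this continuation.\<close>

lemma observability_power_weight:
  "\<exists>C>0. \<forall>r>0. \<forall>a>0. \<forall>T>0. \<forall>\<beta>>1. \<forall>\<gamma>\<in>{0<..<1::real}.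
        \<forall>u0 \<in> (Cc_infinity :: (real ^ 'n \<Rightarrow> complex) set).
          (LINT x|lborel. (cmod (u0 x))\<^sup>2)
            \<le> C * exp ((C powr \<beta> * r powr \<beta> / (a * (1 - \<gamma>) * T powr \<beta>))
                        powr (1 / (\<beta> - 1)))
              * (LINT x:(- cball 0 r)|lborel. (cmod (schroedinger T u0 x))\<^sup>2) powr \<gamma>
              * (LINT x|lborel. exp (a * norm x powr \<beta>) * (cmod (u0 x))\<^sup>2)
                  powr (1 - \<gamma>)"
proof (intro exI[of _ 3] conjI allI impI ballI)
  fix r a T \<beta> \<gamma> :: real and u0 :: "real ^ 'n \<Rightarrow> complex"
  assume r: "r > 0" and a: "a > 0" and T: "T > 0" and \<beta>: "\<beta> > 1" and \<gamma>: "\<gamma> \<in> {0<..<1}" and u0: "u0 \<in> Cc_infinity"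
  define p where "p = 1 / (\<beta> - 1)"
  define Y where "Y = 3 * r / (1 - \<gamma>)"
  define Q where "Q = ((Y / T) powr \<beta> / a) powr p"
  let ?U = "LINT x:(- cball 0 r)|lborel. (cmod (schroedinger T u0 x))\<^sup>2"
  let ?W = "LINT x|lborel. exp (a * norm x powr \<beta>) * (cmod (u0 x))\<^sup>2"
  have Y: "Y > 0" using r \<gamma> by (simp add: Y_def)
  have "interpolation_exponent (3 * r) Y (1 - 3 * r / Y)"
    by (rule interpolation_exponent_two_rays) (use r Y in auto)
  also have "1 - 3 * r / Y = \<gamma>" using r \<gamma> by (simp add: Y_def)
  finally have ex: "interpolation_exponent (3 * r) Y \<gamma>" .
  have cont: "continuous_on UNIV (\<lambda>x::real ^ 'n. exp (a * norm x powr \<beta>))"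
    by (intro continuous_intros continuous_on_powr') (use \<beta> in auto)
  have tilt: "exp (Y / T * norm y) \<le> exp Q * exp (a * norm y powr \<beta>)" for y :: "real ^ 'n"
  proof -
    have "Y / T * norm y \<le> a * norm y powr \<beta> + Q"
      unfolding Q_def p_def using Y T a \<beta> by (intro linear_le_power_weight) auto
    then show ?thesis by (simp add: exp_add[symmetric] add.commute)
  qed
  have W0: "?W \<ge> 0" by (intro Bochner_Integration.integral_nonneg) auto
  have "(LINT x|lborel. (cmod (u0 x))\<^sup>2) \<le> 2 * ?U powr \<gamma> * (exp Q * ?W) powr (1 - \<gamma>)"
    using \<gamma> by (intro observability_interpolation[OF u0 T r Y _ _ ex cont _ tilt]) auto
  also have "(exp Q * ?W) powr (1 - \<gamma>) = exp ((1 - \<gamma>) * Q) * ?W powr (1 - \<gamma>)"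
    using W0 by (simp add: powr_mult exp_powr_real mult.commute)
  also have "(1 - \<gamma>) * Q = (3 powr \<beta> * r powr \<beta> / (a * (1 - \<gamma>) * T powr \<beta>)) powr p"
  proof -
    have g: "1 - \<gamma> > 0" using \<gamma> by simp
    have "1 - \<gamma> = ((1 - \<gamma>) powr (\<beta> - 1)) powr p" using g \<beta> by (simp add: powr_powr p_def)
    then have "(1 - \<gamma>) * Q = ((1 - \<gamma>) powr (\<beta> - 1) * ((Y / T) powr \<beta> / a)) powr p"
      unfolding Q_def using g a by (subst powr_mult) auto
    also have "(Y / T) powr \<beta> = 3 powr \<beta> * r powr \<beta> / ((1 - \<gamma>) powr \<beta> * T powr \<beta>)"
      unfolding Y_def using g r T by (simp add: powr_divide powr_mult)
    also have "(1 - \<gamma>) powr (\<beta> - 1) * (3 powr \<beta> * r powr \<beta> / ((1 - \<gamma>) powr \<beta> * T powr \<beta>) / a) = 3 powr \<beta> * r powr \<beta> / (a * (1 - \<gamma>) * T powr \<beta>)"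
      using g a T by (simp add: powr_diff field_simps)
    finally show ?thesis .
  qed
  finally have "(LINT x|lborel. (cmod (u0 x))\<^sup>2) \<le> 2 * (exp ((3 powr \<beta> * r powr \<beta> / (a * (1 - \<gamma>) * T powr \<beta>)) powr p) * ?U powr \<gamma> * ?W powr (1 - \<gamma>))"
    by (simp only: mult_ac)
  also have "\<dots> \<le> 3 * (exp ((3 powr \<beta> * r powr \<beta> / (a * (1 - \<gamma>) * T powr \<beta>)) powr p) * ?U powr \<gamma> * ?W powr (1 - \<gamma>))"
    by (intro mult_right_mono) auto
  finally show "(LINT x|lborel. (cmod (u0 x))\<^sup>2) \<le> 3 * exp ((3 powr \<beta> * r powr \<beta> / (a * (1 - \<gamma>) * T powr \<beta>)) powr (1 / (\<beta> - 1))) * ?U powr \<gamma> * ?W powr (1 - \<gamma>)"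
    by (simp only: p_def mult.assoc)
qed simp

section \<open>Truncated Gaussians\<close>

lemma Ck_SucD: "Ck (Suc k) f \<Longrightarrow> Ck k f"
proof (induction k arbitrary: f)
  case 0
  then show ?case by (auto simp: continuous_on_eq_continuous_at intro: differentiable_imp_continuous_within)
next
  case (Suc k)
  then show ?case by (metis Ck.simps(2))
qed

lemma Ck_SucI:
  assumes "\<And>x. (f has_derivative D x) (at x)" and "\<And>v. Ck k (\<lambda>x. D x v)"
  shows "Ck (Suc k) f"
proof -
  have "frechet_derivative f (at x) = D x" for x using frechet_derivative_at[OF assms(1)] by simp
  then show ?thesis using assms by (auto simp: differentiable_def)
qed

lemma Ck_frechet:
  assumes "Ck (Suc k) f"
  shows "(f has_derivative frechet_derivative f (at x)) (at x)" "Ck k (\<lambda>x. frechet_derivative f (at x) v)"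
  using assms by (auto simp: frechet_derivative_works)

lemma Ck_add:
  assumes "Ck k f" "Ck k g"
  shows "Ck k (\<lambda>x. f x + g x)"
  using assms
proof (induction k arbitrary: f g)
  case 0
  then show ?case by (auto intro: continuous_intros)
next
  case (Suc k)
  show ?case
    by (rule Ck_SucI[OF has_derivative_add[OF Ck_frechet(1)[OF Suc.prems(1)] Ck_frechet(1)[OF Suc.prems(2)]]])
       (intro Suc.IH Ck_frechet(2) Suc.prems)
qed

lemma Ck_mult:
  fixes f g :: "'a::euclidean_space \<Rightarrow> 'b::real_normed_algebra"
  assumes "Ck k f" "Ck k g"
  shows "Ck k (\<lambda>x. f x * g x)"
  using assms
proof (induction k arbitrary: f g)
  case 0
  then show ?case by (auto intro: continuous_intros)
next
  case (Suc k)
  show ?case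
    by (rule Ck_SucI[OF has_derivative_mult[OF Ck_frechet(1)[OF Suc.prems(1)] Ck_frechet(1)[OF Suc.prems(2)]]])
       (intro Ck_add Suc.IH Ck_frechet(2) Ck_SucD[of k f] Ck_SucD[of k g] Suc.prems)
qed

lemma Ck_const: "Ck k (\<lambda>x. c)"
proof (induction k arbitrary: c)
  case (Suc k)
  show ?case by (rule Ck_SucI[OF has_derivative_const]) (rule Suc)
qed auto

lemma Ck_inner: "Ck k (\<lambda>x. complex_of_real (2 * (v \<bullet> x)))"
proof (cases k)
  case 0
  then show ?thesis by (auto intro!: continuous_intros)
next
  case (Suc j)
  have "((\<lambda>x. complex_of_real (2 * (v \<bullet> x))) has_derivative (\<lambda>w. complex_of_real (2 * (v \<bullet> w)))) (at x)" for x
    by (auto intro!: derivative_eq_intros)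
  from Ck_SucI[OF this Ck_const] show ?thesis using Suc by simp
qed

text \<open>The sequence \<open>\<Psi>\<close> lists the successive derivatives of the profile.\<close>

lemma Ck_radial:
  fixes \<Psi> :: "nat \<Rightarrow> real \<Rightarrow> complex"
  assumes "\<And>j s. (\<Psi> j has_vector_derivative \<Psi> (Suc j) s) (at s)"
  shows "Ck k (\<lambda>x::'a::euclidean_space. \<Psi> j (x \<bullet> x))"
proof (induction k arbitrary: j)
  case 0
  have "continuous_on UNIV (\<Psi> j)"
    using assms by (auto simp: continuous_on_eq_continuous_at intro: has_vector_derivative_continuous)
  then have "continuous_on UNIV (\<Psi> j \<circ> (\<lambda>x::'a. x \<bullet> x))"
    by (intro continuous_on_compose continuous_intros) (auto intro: continuous_on_subset)
  then show ?case by (simp add: o_def)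
next
  case (Suc k)
  have "((\<lambda>x. \<Psi> j (x \<bullet> x)) has_derivative (\<lambda>v. complex_of_real (2 * (v \<bullet> x)) * \<Psi> (Suc j) (x \<bullet> x))) (at x)" for x :: 'a
  proof -
    have "((\<lambda>x. x \<bullet> x) has_derivative (\<lambda>v. 2 * (v \<bullet> x))) (at x)"
      by (auto intro!: derivative_eq_intros simp: inner_commute)
    from has_derivative_compose[OF this assms[unfolded has_vector_derivative_def]]
    show ?thesis by (simp add: scaleR_conv_of_real)
  qed
  then show ?case by (rule Ck_SucI) (intro Ck_mult Ck_inner Suc)
qed

text \<open>The functions $p(1/t)\,e^{-1/t}$, extended by 0; they form a class that is closed under
  differentiation.\<close>

definition flat :: "real poly \<Rightarrow> real \<Rightarrow> real" where
  "flat p t = (if t > 0 then poly p (1 / t) * exp (- (1 / t)) else 0)"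

definition flat_deriv :: "real poly \<Rightarrow> real poly" where
  "flat_deriv p = [:0, 0, 1:] * (p - pderiv p)"

lemma poly_times_exp_minus_tendsto_0: "((\<lambda>y::real. poly p y * exp (- y)) \<longlongrightarrow> 0) at_top"
proof -
  have "((\<lambda>y::real. \<Sum>i\<le>degree p. coeff p i * (y ^ i / exp y)) \<longlongrightarrow> (\<Sum>i\<le>degree p. coeff p i * 0)) at_top"
    by (intro tendsto_intros tendsto_power_div_exp_0)
  then show ?thesis by (simp add: poly_altdef sum_distrib_left exp_minus divide_inverse mult_ac)
qed

lemma has_field_derivative_flat: "(flat p has_real_derivative flat (flat_deriv p) t) (at t)"
proof -
  consider "t > 0" | "t < 0" | "t = 0" by linarith
  then show ?thesis
  proof cases
    case 1
    have "((\<lambda>t. poly p (1 / t) * exp (- (1 / t))) has_real_derivative flat (flat_deriv p) t) (at t)"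
      using 1 by (auto intro!: derivative_eq_intros poly_DERIV[THEN DERIV_chain2] simp: flat_def flat_deriv_def field_simps power2_eq_square)
    moreover have "eventually (\<lambda>s. s > 0) (nhds t)" using 1 by (intro eventually_nhds_in_open[of "{0<..}", simplified]) auto
    then have "eventually (\<lambda>s. poly p (1 / s) * exp (- (1 / s)) = flat p s) (nhds t)"
      by (rule eventually_mono) (simp add: flat_def)
    ultimately show ?thesis by (subst (asm) DERIV_cong_ev[OF refl _ refl])
  next
    case 2
    have "((\<lambda>t. 0) has_real_derivative flat (flat_deriv p) t) (at t)"
      using 2 by (auto simp: flat_def)
    moreover have "eventually (\<lambda>s. s < 0) (nhds t)" using 2 by (intro eventually_nhds_in_open[of "{..<0}", simplified]) auto
    then have "eventually (\<lambda>s. 0 = flat p s) (nhds t)"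
      by (rule eventually_mono) (simp add: flat_def)
    ultimately show ?thesis by (subst (asm) DERIV_cong_ev[OF refl _ refl])
  next
    case 3
    have "((\<lambda>s. flat p s / s) \<longlongrightarrow> 0) (at 0)"
    proof (rule filterlim_split_at)
      show "((\<lambda>s. flat p s / s) \<longlongrightarrow> 0) (at_left 0)"
        by (rule tendsto_eventually) (auto simp: eventually_at_left_field flat_def intro!: exI[of _ "-1"])
      have "((\<lambda>s. poly ([:0, 1:] * p) (inverse s) * exp (- (inverse s))) \<longlongrightarrow> 0) (at_right (0::real))"
        by (rule filterlim_compose[OF poly_times_exp_minus_tendsto_0 filterlim_inverse_at_top_right])
      moreover have "eventually (\<lambda>s. poly ([:0, 1:] * p) (inverse s) * exp (- (inverse s)) = flat p s / s) (at_right (0::real))"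
        by (rule eventually_at_rightI[of 0 1]) (auto simp: flat_def divide_inverse)
      ultimately show "((\<lambda>s. flat p s / s) \<longlongrightarrow> 0) (at_right 0)"
        by (rule Lim_transform_eventually)
    qed
    then show ?thesis unfolding 3 by (simp add: has_field_derivative_iff flat_def)
  qed
qed

text \<open>Normalised to take the value 1 at 0, so that it tends to 1 pointwise as \<open>R\<close> grows.\<close>

definition cutoff :: "real \<Rightarrow> real \<Rightarrow> real" where
  "cutoff R s = exp 1 * flat 1 (1 - s / R\<^sup>2)"

lemma cutoff_bounds:
  assumes "R > 0" "s \<ge> 0"
  shows "0 \<le> cutoff R s" "cutoff R s \<le> 1"
proof -
  show "0 \<le> cutoff R s" by (simp add: cutoff_def flat_def)
  show "cutoff R s \<le> 1"
  proof (cases "1 - s / R\<^sup>2 > 0")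
    case True
    then have "1 / (1 - s / R\<^sup>2) \<ge> 1" using assms by simp
    then have "exp (1 - 1 / (1 - s / R\<^sup>2)) \<le> exp (0::real)" by (subst exp_le_cancel_iff) simp
    then show ?thesis using True by (simp add: cutoff_def flat_def exp_diff exp_minus divide_inverse)
  qed (simp add: cutoff_def flat_def)
qed

lemma cutoff_vanishes:
  assumes "R > 0" "s > R\<^sup>2"
  shows "cutoff R s = 0"
  using assms by (simp add: cutoff_def flat_def)

lemma cutoff_tendsto: "(\<lambda>k. cutoff (real (Suc k)) s) \<longlonglongrightarrow> 1"
proof -
  have s: "(\<lambda>k. 1 - s / (real (Suc k))\<^sup>2) \<longlonglongrightarrow> 1"
  proof -
    have "(\<lambda>k. 1 - s * (1 / real (Suc k))\<^sup>2) \<longlonglongrightarrow> 1 - s * 0\<^sup>2"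
      by (intro tendsto_intros LIMSEQ_Suc[OF lim_1_over_n])
    then show ?thesis by (simp add: power_divide del: of_nat_Suc)
  qed
  have "flat 1 \<midarrow>1\<rightarrow> flat 1 1"
    using DERIV_isCont[OF has_field_derivative_flat] by (simp add: isCont_def)
  then have "isCont (flat 1) 1" by (simp add: isCont_def)
  from isCont_tendsto_compose[OF this s]
  have "(\<lambda>k. cutoff (real (Suc k)) s) \<longlonglongrightarrow> exp 1 * flat 1 1" unfolding cutoff_def by (intro tendsto_intros)
  then show ?thesis by (simp add: flat_def exp_minus)
qed

definition truncated_gaussian :: "complex \<Rightarrow> real \<Rightarrow> 'a::euclidean_space \<Rightarrow> complex" where
  "truncated_gaussian c R x = exp (- (c * of_real (x \<bullet> x))) * of_real (cutoff R (x \<bullet> x))"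

lemma truncated_gaussian_in_Cc_infinity:
  assumes R: "R > 0"
  shows "(truncated_gaussian c R :: 'a::euclidean_space \<Rightarrow> complex) \<in> Cc_infinity"
proof -
  define \<Phi> where "\<Phi> = (\<lambda>j s. (- c) ^ j * exp (- (c * complex_of_real s)))"
  define \<Psi> where "\<Psi> = (\<lambda>j s. complex_of_real (exp 1 * (- (1 / R\<^sup>2)) ^ j * flat ((flat_deriv ^^ j) 1) (1 - s / R\<^sup>2)))"
  have 1: "(\<Phi> j has_vector_derivative \<Phi> (Suc j) s) (at s)" for j s
  proof -
    have "((\<lambda>z. (- c) ^ j * exp (- (c * z))) has_field_derivative \<Phi> (Suc j) s) (at (complex_of_real s))"
      by (auto intro!: derivative_eq_intros simp: \<Phi>_def)
    from has_vector_derivative_real_field[OF this] show ?thesis by (simp add: \<Phi>_def)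
  qed
  have 2: "(\<Psi> j has_vector_derivative \<Psi> (Suc j) s) (at s)" for j s
  proof -
    have "((\<lambda>s. 1 - (1 / R\<^sup>2) * s) has_real_derivative 0 - (1 / R\<^sup>2) * 1) (at s)"
      by (intro DERIV_diff DERIV_const DERIV_cmult DERIV_ident)
    then have "((\<lambda>s. 1 - s / R\<^sup>2) has_real_derivative - (1 / R\<^sup>2)) (at s)" by simp
    from DERIV_chain2[OF has_field_derivative_flat this]
    have "((\<lambda>s. exp 1 * (- (1 / R\<^sup>2)) ^ j * flat ((flat_deriv ^^ j) 1) (1 - s / R\<^sup>2)) has_real_derivative
       exp 1 * (- (1 / R\<^sup>2)) ^ j * (flat (flat_deriv ((flat_deriv ^^ j) 1)) (1 - s / R\<^sup>2) * - (1 / R\<^sup>2))) (at s)"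
      by (rule DERIV_cmult)
    then show ?thesis unfolding \<Psi>_def
      by (intro has_vector_derivative_of_real) (simp add: has_real_derivative_iff_has_vector_derivative[symmetric] mult_ac)
  qed
  have "Ck k (\<lambda>x::'a. \<Phi> 0 (x \<bullet> x) * \<Psi> 0 (x \<bullet> x))" for k
    by (intro Ck_mult Ck_radial 1 2)
  moreover have "(\<lambda>x::'a. \<Phi> 0 (x \<bullet> x) * \<Psi> 0 (x \<bullet> x)) = truncated_gaussian c R"
    by (simp add: fun_eq_iff \<Phi>_def \<Psi>_def truncated_gaussian_def cutoff_def)
  ultimately have "smooth (truncated_gaussian c R :: 'a \<Rightarrow> complex)" by (simp add: smooth_def)
  moreover have "{x::'a. truncated_gaussian c R x \<noteq> 0} \<subseteq> cball 0 R"
  proof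
    fix x :: 'a assume "x \<in> {x. truncated_gaussian c R x \<noteq> 0}"
    then have "\<not> x \<bullet> x > R\<^sup>2" using cutoff_vanishes[OF R, of "x \<bullet> x"] by (auto simp: truncated_gaussian_def)
    then show "x \<in> cball 0 R" using R by (simp add: norm_le_square not_less)
  qed
  then have "bounded {x::'a. truncated_gaussian c R x \<noteq> 0}" using bounded_subset[OF bounded_cball] by blast
  then have "compact (closure {x::'a. truncated_gaussian c R x \<noteq> 0})" by (simp add: compact_closure)
  ultimately show ?thesis by (simp add: Cc_infinity_def)
qed

lemma norm_truncated_gaussian_le:
  assumes "R > 0"
  shows "cmod (truncated_gaussian c R x) \<le> exp (- (Re c * (norm x)\<^sup>2))"
  using cutoff_bounds[OF assms, of "x \<bullet> x"]
  by (simp add: truncated_gaussian_def norm_mult power2_norm_eq_inner mult_left_le)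

section \<open>Failure for sublinear weights\<close>

lemma FT_diff:
  assumes "integrable lborel f" "integrable lborel g"
  shows "FT l (\<lambda>x. f x - g x) \<xi> = FT l f \<xi> - FT l g \<xi>"
proof -
  have "FT l f \<xi> - FT l g \<xi> = (LINT y|lborel. cis (- (l * (\<xi> \<bullet> y))) * f y - cis (- (l * (\<xi> \<bullet> y))) * g y)"
    unfolding FT_def by (intro Bochner_Integration.integral_diff[symmetric] integrable_cis_mult assms) measurable
  then show ?thesis by (simp add: FT_def right_diff_distrib)
qed

lemma sublinear_bound:
  fixes \<alpha> :: "real \<Rightarrow> real"
  assumes mono: "mono_on {0<..} \<alpha>" and lim: "((\<lambda>s. \<alpha> s / s) \<longlongrightarrow> 0) at_top" and d: "d > 0"
  obtains q where "\<And>s. s > 0 \<Longrightarrow> \<alpha> s \<le> d * s + q"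
proof -
  have "eventually (\<lambda>s. \<alpha> s / s < d) at_top" using order_tendstoD(2)[OF lim d] .
  then obtain S where S: "\<And>s. s \<ge> S \<Longrightarrow> \<alpha> s / s < d" by (auto simp: eventually_at_top_linorder)
  define S' where "S' = max S 1"
  have "\<alpha> s \<le> d * s + max 0 (\<alpha> S')" if s: "s > 0" for s
  proof (cases "s \<ge> S'")
    case True
    then have "\<alpha> s / s < d" using S by (simp add: S'_def)
    then show ?thesis using s by (simp add: field_simps)
  next
    case False
    then have "\<alpha> s \<le> \<alpha> S'" using s by (intro mono_onD[OF mono]) (auto simp: S'_def)
    moreover have "d * s > 0" using d s by simp
    ultimately show ?thesis by (smt (verit))
  qed
  then show thesis by (rule that)
qed

lemma norm_square_add_le: "(cmod (a + b))\<^sup>2 \<le> 2 * (cmod a)\<^sup>2 + 2 * (cmod b)\<^sup>2"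
proof -
  have "(cmod (a + b))\<^sup>2 \<le> (cmod a + cmod b)\<^sup>2" by (intro power_mono norm_triangle_ineq) auto
  also have "\<dots> \<le> 2 * (cmod a)\<^sup>2 + 2 * (cmod b)\<^sup>2"
    using zero_le_power2[of "cmod a - cmod b"] by (simp add: power2_eq_square algebra_simps)
  finally show ?thesis .
qed

definition gaussian :: "real \<Rightarrow> 'a::euclidean_space \<Rightarrow> complex" where
  "gaussian \<kappa> x = exp (- (of_real \<kappa> * of_real ((norm x)\<^sup>2)))"

lemma norm_gaussian: "cmod (gaussian \<kappa> x) = exp (- (\<kappa> * (norm x)\<^sup>2))"
  by (simp add: gaussian_def del: of_real_power)

lemma gaussian_props:
  fixes \<kappa> :: real
  assumes "\<kappa> > 0"
  shows integrable_gaussian: "integrable lborel (gaussian \<kappa> :: 'a::euclidean_space \<Rightarrow> complex)"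
    and continuous_gaussian: "continuous_on UNIV (gaussian \<kappa> :: 'a \<Rightarrow> complex)"
    and norm_gaussian_le_1: "cmod (gaussian \<kappa> (x::'a)) \<le> 1"
proof -
  show "integrable lborel (gaussian \<kappa> :: 'a \<Rightarrow> complex)"
    using integrable_complex_gaussian[of "of_real \<kappa>" "0::'a"] assms by (simp add: gaussian_def[abs_def])
  show "continuous_on UNIV (gaussian \<kappa> :: 'a \<Rightarrow> complex)"
    unfolding gaussian_def[abs_def] by (intro continuous_intros)
  show "cmod (gaussian \<kappa> (x::'a)) \<le> 1" using assms by (simp add: norm_gaussian)
qed

text \<open>The transform of a Gaussian is a Gaussian. Half of its exponent is given up for the factor
  that records the distance to the origin; the integral of the other half is explicit.\<close>

lemma gaussian_outer_energy:
  fixes \<kappa> l r :: real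
  assumes k: "\<kappa> > 0" and l: "l > 0" and r: "r > 0"
  shows "(LINT x:(- cball (0::'a::euclidean_space) r)|lborel. (cmod (FT l (gaussian \<kappa>) x))\<^sup>2)
     \<le> (2 * pi / l) ^ DIM('a) * (sqrt (pi / \<kappa>) ^ DIM('a) * exp (- (l\<^sup>2 * r\<^sup>2 / 4 / \<kappa>)))"
proof -
  let ?p = "l\<^sup>2 * r\<^sup>2 / 4" and ?b = "l\<^sup>2 / (4 * \<kappa>)" and ?n = "DIM('a)"
  have F: "(cmod (FT l (gaussian \<kappa>) x))\<^sup>2 = (pi / \<kappa>) ^ ?n * exp (- (2 * ?b * (norm x)\<^sup>2))" for x :: 'a
  proof -
    have "FT l (gaussian \<kappa>) x = gauss_root (of_real \<kappa>) ^ ?n * exp (- (of_real ((norm (0 *\<^sub>R x - l *\<^sub>R x))\<^sup>2) / (4 * of_real \<kappa>)))"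
      using FT_gaussian[of "of_real \<kappa>" l x 0 x] k by (simp add: FT_def gaussian_def[abs_def])
    also have "\<dots> = of_real (sqrt (pi / \<kappa>) ^ ?n * exp (- (?b * (norm x)\<^sup>2)))"
      using k l by (simp add: gauss_root_of_real power_mult_distrib exp_of_real[symmetric])
    finally have "cmod (FT l (gaussian \<kappa>) x) = sqrt (pi / \<kappa>) ^ ?n * exp (- (?b * (norm x)\<^sup>2))"
      using k by (simp only: norm_of_real) simp
    then have "(cmod (FT l (gaussian \<kappa>) x))\<^sup>2 = (sqrt (pi / \<kappa>) ^ 2) ^ ?n * (exp (- (?b * (norm x)\<^sup>2)))\<^sup>2"
      by (simp only: power_mult_distrib power_mult[symmetric] mult.commute)
    also have "(exp (- (?b * (norm x)\<^sup>2)))\<^sup>2 = exp (- (2 * ?b * (norm x)\<^sup>2))"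
      by (simp add: exp_double[symmetric])
    finally show ?thesis using k by simp
  qed
  have b: "?b > 0" using k l by simp
  have "(LINT x:(- cball (0::'a) r)|lborel. (cmod (FT l (gaussian \<kappa>) x))\<^sup>2) \<le> (LINT x::'a|lborel. (pi / \<kappa>) ^ ?n * exp (- (?p / \<kappa>)) * exp (- (?b * (norm x)\<^sup>2)))"
    unfolding set_lebesgue_integral_def
  proof (rule integral_mono_AE')
    show "integrable lborel (\<lambda>x::'a. (pi / \<kappa>) ^ ?n * exp (- (?p / \<kappa>)) * exp (- (?b * (norm x)\<^sup>2)))"
      by (intro integrable_mult_right integrable_real_gaussian b)
    show "AE x in lborel. indicat_real (- cball (0::'a) r) x *\<^sub>R (cmod (FT l (gaussian \<kappa>) x))\<^sup>2 \<le> (pi / \<kappa>) ^ ?n * exp (- (?p / \<kappa>)) * exp (- (?b * (norm x)\<^sup>2))"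
    proof (rule AE_I2)
      fix x :: 'a
      show "indicat_real (- cball (0::'a) r) x *\<^sub>R (cmod (FT l (gaussian \<kappa>) x))\<^sup>2 \<le> (pi / \<kappa>) ^ ?n * exp (- (?p / \<kappa>)) * exp (- (?b * (norm x)\<^sup>2))"
      proof (cases "norm x \<le> r")
        case True
        then show ?thesis using k by simp
      next
        case False
        then have "r\<^sup>2 \<le> (norm x)\<^sup>2" using r by (intro power_mono) auto
        then have "?b * r\<^sup>2 \<le> ?b * (norm x)\<^sup>2" using b by (intro mult_left_mono) auto
        moreover have "?b * r\<^sup>2 = ?p / \<kappa>" by simp
        ultimately have "exp (- (2 * ?b * (norm x)\<^sup>2)) \<le> exp (- (?p / \<kappa>) + - (?b * (norm x)\<^sup>2))"
          by (subst exp_le_cancel_iff) linarith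
        then have "exp (- (2 * ?b * (norm x)\<^sup>2)) \<le> exp (- (?p / \<kappa>)) * exp (- (?b * (norm x)\<^sup>2))"
          by (simp only: exp_add)
        then have "(pi / \<kappa>) ^ ?n * exp (- (2 * ?b * (norm x)\<^sup>2)) \<le> (pi / \<kappa>) ^ ?n * (exp (- (?p / \<kappa>)) * exp (- (?b * (norm x)\<^sup>2)))"
          using k by (intro mult_left_mono) auto
        then show ?thesis unfolding F using False by (simp only: mult.assoc) simp
      qed
    qed
    show "AE x in lborel. 0 \<le> (pi / \<kappa>) ^ ?n * exp (- (?p / \<kappa>)) * exp (- (?b * (norm (x::'a))\<^sup>2))"
      by (intro AE_I2 mult_nonneg_nonneg zero_le_power) (use k in auto)
  qed
  also have "\<dots> = (pi / \<kappa>) ^ ?n * exp (- (?p / \<kappa>)) * sqrt (pi / ?b) ^ ?n"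
    by (simp only: integral_mult_right_zero integral_real_gaussian[OF b])
  also have "\<dots> = (pi / \<kappa> * sqrt (pi / ?b)) ^ ?n * exp (- (?p / \<kappa>))"
    by (simp only: power_mult_distrib mult_ac)
  also have "pi / \<kappa> * sqrt (pi / ?b) = 2 * pi / l * sqrt (pi / \<kappa>)"
  proof -
    have "sqrt (pi / ?b) = 2 / l * sqrt (pi * \<kappa>)"
      using k l by (simp add: real_sqrt_divide real_sqrt_mult)
    moreover have "sqrt (pi * \<kappa>) = sqrt (pi / \<kappa>) * \<kappa>"
      using k by (simp add: real_sqrt_divide real_sqrt_mult real_div_sqrt field_simps)
    ultimately show ?thesis using k by simp
  qed
  finally show ?thesis by (simp only: power_mult_distrib mult.assoc)
qed

text \<open>What an observability inequality would say about the initial datum whose product with the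
  chirp is the Gaussian $e^{-\kappa|x|^2}$. This datum is a limit of smooth functions of compact support,
  for which all terms of the inequality converge or are bounded uniformly.\<close>

lemma gaussian_test_inequality:
  fixes \<alpha> :: "real \<Rightarrow> real"
  assumes r: "r > 0" and a: "a > 0" and T: "T > 0" and \<gamma>: "0 < \<gamma>" "\<gamma> < 1" and C: "C > 0"
    and ineq: "\<And>u0 :: real ^ 'n \<Rightarrow> complex. u0 \<in> Cc_infinity \<Longrightarrow> (LINT x|lborel. (cmod (u0 x))\<^sup>2)
                  \<le> C * (LINT x:(- cball 0 r)|lborel. (cmod (schroedinger T u0 x))\<^sup>2) powr \<gamma>
                    * (LINT x|lborel. exp (a * \<alpha> (norm x)) * (cmod (u0 x))\<^sup>2) powr (1 - \<gamma>)"
    and \<alpha>: "\<And>s. s > 0 \<Longrightarrow> \<alpha> s \<le> d * s + q" and k: "\<kappa> > 0"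
  defines "S \<equiv> sqrt (pi / \<kappa>) ^ CARD('n)"
  shows "sqrt (pi / (2 * \<kappa>)) ^ CARD('n) \<le> C * (2 * (S * exp (- ((1 / (2 * T))\<^sup>2 * r\<^sup>2 / 4 / \<kappa>)))) powr \<gamma> *
      (exp (a * q + a\<^sup>2 * d\<^sup>2 / 4 / \<kappa>) * S) powr (1 - \<gamma>)"
proof -
  define l where "l = 1 / (2 * T)"
  define N where "N = (2 * pi / l) ^ CARD('n)"
  define G :: "real ^ 'n \<Rightarrow> complex" where "G = gaussian \<kappa>"
  have l: "l > 0" using T by (simp add: l_def)
  have N: "N > 0" using l by (simp add: N_def)
  have "2 * pi / l = 4 * pi * T" by (simp add: l_def)
  then have N': "N = (4 * pi * T) ^ CARD('n)" by (simp only: N_def)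
  \<comment> \<open>The imaginary part cancels the chirp.\<close>
  define c where "c = Complex \<kappa> (1 / (4 * T))"
  define u :: "nat \<Rightarrow> real ^ 'n \<Rightarrow> complex" where "u = (\<lambda>k. truncated_gaussian c (real (Suc k)))"
  define g :: "nat \<Rightarrow> real ^ 'n \<Rightarrow> complex" where "g = (\<lambda>k. chirp T (u k))"
  have u: "u k \<in> Cc_infinity" for k unfolding u_def by (intro truncated_gaussian_in_Cc_infinity) simp
  have gu: "cmod (g k x) = cmod (u k x)" for k x by (simp add: g_def)
  have g_eq: "g k x = G x * of_real (cutoff (real (Suc k)) (x \<bullet> x))" for k x
  proof -
    have "cis ((norm x)\<^sup>2 / (4 * T)) * exp (- (c * of_real (x \<bullet> x))) = G x"
      by (simp add: G_def gaussian_def cis_conv_exp exp_add[symmetric] c_def complex_eq_iff power2_norm_eq_inner Re_exp Im_exp del: of_real_power)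
    then show ?thesis by (simp add: g_def chirp_def u_def truncated_gaussian_def mult.assoc[symmetric])
  qed
  have ub: "cmod (u k x) \<le> exp (- (\<kappa> * (norm x)\<^sup>2))" for k x
    using norm_truncated_gaussian_le[of "real (Suc k)" c x] by (simp add: u_def c_def)
  have g_lim: "(\<lambda>k. g k x) \<longlonglongrightarrow> G x" for x
  proof -
    have "(\<lambda>k. g k x) \<longlonglongrightarrow> G x * of_real 1" unfolding g_eq by (intro tendsto_intros cutoff_tendsto)
    then show ?thesis by simp
  qed
  have gc: "continuous_on UNIV (g k)" and gi: "integrable lborel (g k)" for k
  proof -
    obtain R where "vanishing_far (g k) R" unfolding g_def using u T by (rule vanishing_far_chirp)
    then interpret vanishing_far "g k" R .
    show "continuous_on UNIV (g k)" by (rule cont)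
    show "integrable lborel (g k)" by (rule integrable_continuous_vanishing[OF cont van])
  qed
  have Gc: "continuous_on UNIV G" and Gi: "integrable lborel G" unfolding G_def by (rule gaussian_props[OF k])+
  have nG: "cmod (G x) = exp (- (\<kappa> * (norm x)\<^sup>2))" for x by (simp add: G_def norm_gaussian)
  have [measurable]: "g k \<in> borel_measurable borel" "G \<in> borel_measurable borel" for k using gi Gi by auto
  have k2: "2 * \<kappa> > 0" using k by simp
  have sq: "(exp (- (\<kappa> * (norm x)\<^sup>2)))\<^sup>2 = exp (- (2 * \<kappa> * (norm x)\<^sup>2))" for x :: "real ^ 'n"
    by (simp add: exp_double[symmetric])
  have E_lim: "(\<lambda>k. LINT x|lborel. (cmod (g k x))\<^sup>2) \<longlonglongrightarrow> sqrt (pi / (2 * \<kappa>)) ^ CARD('n)"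
  proof -
    have "(\<lambda>k. LINT x|lborel. (cmod (g k x))\<^sup>2) \<longlonglongrightarrow> (LINT x|lborel. (cmod (G x))\<^sup>2)"
    proof (rule integral_dominated_convergence[where w="\<lambda>x. exp (- (2 * \<kappa> * (norm x)\<^sup>2))"])
      show "integrable lborel (\<lambda>x::real^'n. exp (- (2 * \<kappa> * (norm x)\<^sup>2)))" by (rule integrable_real_gaussian[OF k2])
      show "AE x in lborel. (\<lambda>k. (cmod (g k x))\<^sup>2) \<longlonglongrightarrow> (cmod (G x))\<^sup>2"
        by (intro AE_I2 tendsto_intros g_lim)
      show "AE x in lborel. norm ((cmod (g k x))\<^sup>2) \<le> exp (- (2 * \<kappa> * (norm x)\<^sup>2))" for k
        using power_mono[OF ub norm_ge_zero, where n=2] by (simp add: gu sq)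
    qed measurable
    also have "(LINT x|lborel. (cmod (G x))\<^sup>2) = sqrt (pi / (2 * \<kappa>)) ^ CARD('n)"
      using integral_real_gaussian[OF k2, where 'a="real ^ 'n"] by (simp add: nG sq)
    finally show ?thesis .
  qed
  define D where "D = (\<lambda>k. LINT x|lborel. (cmod (g k x - G x))\<^sup>2)"
  have D_lim: "D \<longlonglongrightarrow> 0"
  proof -
    have "D \<longlonglongrightarrow> (LINT x::real^'n|lborel. 0)" unfolding D_def
    proof (rule integral_dominated_convergence[where w="\<lambda>x. 4 * exp (- (2 * \<kappa> * (norm x)\<^sup>2))"])
      show "integrable lborel (\<lambda>x::real^'n. 4 * exp (- (2 * \<kappa> * (norm x)\<^sup>2)))" by (intro integrable_mult_right integrable_real_gaussian k2)
      show "AE x in lborel. (\<lambda>k. (cmod (g k x - G x))\<^sup>2) \<longlonglongrightarrow> 0"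
      proof (rule AE_I2)
        fix x
        have "(\<lambda>k. (cmod (g k x - G x))\<^sup>2) \<longlonglongrightarrow> (cmod (G x - G x))\<^sup>2" by (intro tendsto_intros g_lim)
        then show "(\<lambda>k. (cmod (g k x - G x))\<^sup>2) \<longlonglongrightarrow> 0" by simp
      qed
      show "AE x in lborel. norm ((cmod (g k x - G x))\<^sup>2) \<le> 4 * exp (- (2 * \<kappa> * (norm x)\<^sup>2))" for k
      proof (rule AE_I2)
        fix x
        have "cmod (g k x - G x) \<le> 2 * exp (- (\<kappa> * (norm x)\<^sup>2))"
          using norm_triangle_ineq4[of "g k x" "G x"] ub[of k x] by (simp add: gu nG)
        from power_mono[OF this norm_ge_zero, where n=2]
        show "norm ((cmod (g k x - G x))\<^sup>2) \<le> 4 * exp (- (2 * \<kappa> * (norm x)\<^sup>2))" by (simp add: power_mult_distrib sq)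
      qed
    qed measurable
    then show ?thesis by simp
  qed
  define \<tau> where "\<tau> = (LINT x:(- cball 0 r)|lborel. (cmod (FT l G x))\<^sup>2)"
  have \<tau>0: "\<tau> \<ge> 0" unfolding \<tau>_def set_lebesgue_integral_def by (intro Bochner_Integration.integral_nonneg) auto
  have D0: "D k \<ge> 0" for k unfolding D_def by (intro Bochner_Integration.integral_nonneg) auto
  let ?U = "\<lambda>k. LINT x:(- cball 0 r)|lborel. (cmod (schroedinger T (u k) x))\<^sup>2"
  have U: "?U k \<le> 2 * \<tau> / N + 2 * D k" for k
  proof -
    let ?f = "\<lambda>x. g k x - G x"
    have fi: "integrable lborel ?f" using gi Gi by (rule Bochner_Integration.integrable_diff)
    have fc: "continuous_on UNIV ?f" by (intro continuous_intros gc Gc)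
    have fb: "cmod (?f x) \<le> 2" for x
    proof -
      have "exp (- (\<kappa> * (norm x)\<^sup>2)) \<le> 1" using k by simp
      then show ?thesis using norm_triangle_ineq4[of "g k x" "G x", unfolded gu nG] ub[of k x] by linarith
    qed
    have Gb: "cmod (G x) \<le> 1" for x unfolding G_def by (rule gaussian_props[OF k])
    note pf = fi fc fb l
    note i1 = integrable_FT_square[OF pf] and i2 = integrable_FT_square[OF Gi Gc Gb l]
    have s: "- cball (0::real^'n) r \<in> sets lborel" by auto
    have i3: "integrable lborel (\<lambda>x. indicat_real (- cball 0 r) x *\<^sub>R (cmod (FT l G x))\<^sup>2)"
      using integrable_mult_indicator[OF s i2] .
    have "N * ?U k = (LINT x:(- cball 0 r)|lborel. (cmod (FT l (g k) x))\<^sup>2)"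
      unfolding N' g_def l_def by (rule schroedinger_energy_outside[OF u T])
    also have "\<dots> \<le> (LINT x|lborel. 2 * (indicat_real (- cball 0 r) x *\<^sub>R (cmod (FT l G x))\<^sup>2) + 2 * (cmod (FT l ?f x))\<^sup>2)"
      unfolding set_lebesgue_integral_def
    proof (rule integral_mono_AE')
      show "integrable lborel (\<lambda>x. 2 * (indicat_real (- cball 0 r) x *\<^sub>R (cmod (FT l G x))\<^sup>2) + 2 * (cmod (FT l ?f x))\<^sup>2)"
        by (intro Bochner_Integration.integrable_add integrable_mult_right i1 i3)
      show "AE x in lborel. indicat_real (- cball 0 r) x *\<^sub>R (cmod (FT l (g k) x))\<^sup>2 \<le> 2 * (indicat_real (- cball 0 r) x *\<^sub>R (cmod (FT l G x))\<^sup>2) + 2 * (cmod (FT l ?f x))\<^sup>2"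
      proof (rule AE_I2)
        fix x
        have "FT l (g k) x = FT l G x + FT l ?f x" by (simp add: FT_diff[OF gi Gi])
        then show "indicat_real (- cball 0 r) x *\<^sub>R (cmod (FT l (g k) x))\<^sup>2 \<le> 2 * (indicat_real (- cball 0 r) x *\<^sub>R (cmod (FT l G x))\<^sup>2) + 2 * (cmod (FT l ?f x))\<^sup>2"
          using norm_square_add_le[of "FT l G x" "FT l ?f x"] by (cases "x \<in> cball 0 r") (auto simp: indicator_def)
      qed
    qed auto
    also have "\<dots> = 2 * \<tau> + 2 * (N * D k)"
    proof -
      have "N * D k = (LINT x|lborel. (cmod (FT l ?f x))\<^sup>2)"
        using plancherel[OF pf] by (simp add: N_def D_def)
      then show ?thesis
        unfolding \<tau>_def set_lebesgue_integral_def
        by (subst Bochner_Integration.integral_add[OF integrable_mult_right[OF i3] integrable_mult_right[OF i1]])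
          (simp only: integral_mult_right_zero)
    qed
    finally have "N * ?U k \<le> N * (2 * \<tau> / N + 2 * D k)" using N by (simp add: distrib_left)
    then show ?thesis using N by simp
  qed
  define Wb where "Wb = exp (a * q + a\<^sup>2 * d\<^sup>2 / 4 / \<kappa>) * S"
  let ?W = "\<lambda>k. LINT x|lborel. exp (a * \<alpha> (norm x)) * (cmod (u k x))\<^sup>2"
  have W: "?W k \<le> Wb" for k
  proof -
    have "?W k \<le> (LINT x::real^'n|lborel. exp (a * q + a\<^sup>2 * d\<^sup>2 / 4 / \<kappa>) * exp (- (\<kappa> * (norm x)\<^sup>2)))"
    proof (rule integral_mono_AE')
      show "integrable lborel (\<lambda>x::real^'n. exp (a * q + a\<^sup>2 * d\<^sup>2 / 4 / \<kappa>) * exp (- (\<kappa> * (norm x)\<^sup>2)))"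
        by (intro integrable_mult_right integrable_real_gaussian k)
      have "AE x in lborel. x \<noteq> (0::real^'n)" by (rule AE_lborel_singleton)
      then show "AE x in lborel. exp (a * \<alpha> (norm x)) * (cmod (u k x))\<^sup>2 \<le> exp (a * q + a\<^sup>2 * d\<^sup>2 / 4 / \<kappa>) * exp (- (\<kappa> * (norm x)\<^sup>2))"
      proof (rule AE_mp, intro AE_I2 impI)
        fix x :: "real ^ 'n" assume "x \<noteq> 0"
        then have "a * \<alpha> (norm x) \<le> a * (d * norm x + q)" using a by (intro mult_left_mono \<alpha>) auto
        moreover have "a * d * norm x \<le> \<kappa> * (norm x)\<^sup>2 + a\<^sup>2 * d\<^sup>2 / 4 / \<kappa>"
        proof -
          have "0 \<le> (\<kappa> * norm x - a * d / 2)\<^sup>2 / \<kappa>" using k by simp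
          also have "\<dots> = \<kappa> * (norm x)\<^sup>2 + a\<^sup>2 * d\<^sup>2 / 4 / \<kappa> - a * d * norm x"
            using k by (simp add: field_simps power2_eq_square)
          finally show ?thesis by simp
        qed
        ultimately have *: "a * \<alpha> (norm x) + - (2 * \<kappa> * (norm x)\<^sup>2) \<le> (a * q + a\<^sup>2 * d\<^sup>2 / 4 / \<kappa>) + - (\<kappa> * (norm x)\<^sup>2)"
          by (simp add: algebra_simps)
        have "exp (a * \<alpha> (norm x)) * (cmod (u k x))\<^sup>2 \<le> exp (a * \<alpha> (norm x)) * exp (- (2 * \<kappa> * (norm x)\<^sup>2))"
          using power_mono[OF ub norm_ge_zero, where n=2] by (intro mult_left_mono) (auto simp: sq)
        also have "\<dots> \<le> exp (a * q + a\<^sup>2 * d\<^sup>2 / 4 / \<kappa>) * exp (- (\<kappa> * (norm x)\<^sup>2))"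
          unfolding exp_add[symmetric] using * by (subst exp_le_cancel_iff)
        finally show "exp (a * \<alpha> (norm x)) * (cmod (u k x))\<^sup>2 \<le> exp (a * q + a\<^sup>2 * d\<^sup>2 / 4 / \<kappa>) * exp (- (\<kappa> * (norm x)\<^sup>2))" .
      qed
    qed auto
    also have "\<dots> = Wb" unfolding Wb_def S_def
      using integral_real_gaussian[OF k, where 'a="real ^ 'n"] by simp
    finally show ?thesis .
  qed
  have main: "(LINT x|lborel. (cmod (g k x))\<^sup>2) \<le> C * (2 * \<tau> / N + 2 * D k) powr \<gamma> * Wb powr (1 - \<gamma>)" for k
  proof -
    have "?U k \<ge> 0" "?W k \<ge> 0" unfolding set_lebesgue_integral_def by (intro Bochner_Integration.integral_nonneg; simp)+
    then have "C * ?U k powr \<gamma> * ?W k powr (1 - \<gamma>) \<le> C * (2 * \<tau> / N + 2 * D k) powr \<gamma> * Wb powr (1 - \<gamma>)"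
      using C \<gamma> U[of k] W[of k] by (intro mult_mono powr_mono2 mult_left_mono) auto
    then show ?thesis using ineq[OF u[of k]] by (simp add: gu)
  qed
  have "(\<lambda>k. C * (2 * \<tau> / N + 2 * D k) powr \<gamma> * Wb powr (1 - \<gamma>)) \<longlonglongrightarrow> C * (2 * \<tau> / N + 2 * 0) powr \<gamma> * Wb powr (1 - \<gamma>)"
    by (intro tendsto_intros tendsto_powr2 D_lim) (use \<gamma> \<tau>0 N D0 in \<open>auto intro!: always_eventually add_nonneg_nonneg\<close>)
  then have "sqrt (pi / (2 * \<kappa>)) ^ CARD('n) \<le> C * (2 * \<tau> / N + 2 * 0) powr \<gamma> * Wb powr (1 - \<gamma>)"
    using E_lim main by (intro LIMSEQ_le) auto
  also have "\<dots> \<le> C * (2 * (S * exp (- (l\<^sup>2 * r\<^sup>2 / 4 / \<kappa>)))) powr \<gamma> * Wb powr (1 - \<gamma>)"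
  proof -
    have "\<tau> \<le> N * (S * exp (- (l\<^sup>2 * r\<^sup>2 / 4 / \<kappa>)))"
      using gaussian_outer_energy[OF k l r, where 'a="real ^ 'n"] by (simp add: \<tau>_def G_def N_def S_def)
    then have "2 * \<tau> / N + 2 * 0 \<le> 2 * (S * exp (- (l\<^sup>2 * r\<^sup>2 / 4 / \<kappa>)))" using N by (simp add: field_simps)
    then show ?thesis using C \<gamma> \<tau>0 N by (intro mult_right_mono mult_left_mono powr_mono2) auto
  qed
  finally show ?thesis unfolding Wb_def l_def .
qed

text \<open>A weight $e^{a\alpha(|x|)}$ with sublinear \<open>\<alpha>\<close> is at most a constant times $e^{ad|x|}$ for
  every \<open>d > 0\<close>. On the Gaussian $e^{-\kappa|x|^2}$ it therefore costs at most $e^{a^2d^2/(4\kappa)}$,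
  while the energy outside the ball is smaller than the total by a factor of order $e^{-p/\kappa}$ with a
  fixed \<open>p > 0\<close>. If \<open>d\<close> is small enough, then the gain wins as \<open>\<kappa>\<close> tends to 0.\<close>

lemma no_sublinear_weight:
  fixes \<alpha> :: "real \<Rightarrow> real"
  assumes r: "r > 0" and a: "a > 0" and T: "T > 0" and mono: "mono_on {0<..} \<alpha>" and lim: "((\<lambda>s. \<alpha> s / s) \<longlongrightarrow> 0) at_top"
    and \<gamma>: "\<gamma> \<in> {0<..<1}"
  shows "\<not> (\<exists>C>0. \<forall>u0 \<in> (Cc_infinity :: (real ^ 'n \<Rightarrow> complex) set).
                (LINT x|lborel. (cmod (u0 x))\<^sup>2)
                  \<le> C * (LINT x:(- cball 0 r)|lborel. (cmod (schroedinger T u0 x))\<^sup>2) powr \<gamma>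
                    * (LINT x|lborel. exp (a * \<alpha> (norm x)) * (cmod (u0 x))\<^sup>2)
                        powr (1 - \<gamma>))"
proof
  assume "\<exists>C>0. \<forall>u0 \<in> (Cc_infinity :: (real ^ 'n \<Rightarrow> complex) set).
                (LINT x|lborel. (cmod (u0 x))\<^sup>2)
                  \<le> C * (LINT x:(- cball 0 r)|lborel. (cmod (schroedinger T u0 x))\<^sup>2) powr \<gamma>
                    * (LINT x|lborel. exp (a * \<alpha> (norm x)) * (cmod (u0 x))\<^sup>2)
                        powr (1 - \<gamma>)"
  then obtain C where C: "C > 0" and ineq: "\<And>u0 :: real ^ 'n \<Rightarrow> complex. u0 \<in> Cc_infinity \<Longrightarrow> (LINT x|lborel. (cmod (u0 x))\<^sup>2)
                  \<le> C * (LINT x:(- cball 0 r)|lborel. (cmod (schroedinger T u0 x))\<^sup>2) powr \<gamma>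
                    * (LINT x|lborel. exp (a * \<alpha> (norm x)) * (cmod (u0 x))\<^sup>2) powr (1 - \<gamma>)"
    by blast
  have \<gamma>': "0 < \<gamma>" "\<gamma> < 1" using \<gamma> by auto
  define p where "p = (1 / (2 * T))\<^sup>2 * r\<^sup>2 / 4"
  have p: "p > 0" using r T by (simp add: p_def)
  \<comment> \<open>With this \<open>d\<close> the weight eats up exactly half of the gain \<open>\<gamma> * p / \<kappa>\<close>.\<close>
  define d where "d = sqrt (2 * \<gamma> * p / (1 - \<gamma>)) / a"
  have d: "d > 0" using \<gamma>' p a by (simp add: d_def)
  have d2: "(1 - \<gamma>) * (a\<^sup>2 * d\<^sup>2 / 4) = \<gamma> * p / 2"
  proof -
    have "a\<^sup>2 * d\<^sup>2 = 2 * \<gamma> * p / (1 - \<gamma>)" using \<gamma>' p a by (simp add: d_def power_divide)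
    then have "(1 - \<gamma>) * (a\<^sup>2 * d\<^sup>2) = 2 * \<gamma> * p" using \<gamma>' by simp
    then show ?thesis by simp
  qed
  obtain q where q: "\<And>s. s > 0 \<Longrightarrow> \<alpha> s \<le> d * s + q" using sublinear_bound[OF mono lim d] by blast
  define K where "K = sqrt 2 ^ CARD('n) * C * 2 powr \<gamma> * exp ((1 - \<gamma>) * (a * q))"
  have K: "K > 0" using C by (simp add: K_def)
  have bound: "1 \<le> K * exp (- (\<gamma> * p / 2 / \<kappa>))" if k: "\<kappa> > 0" for \<kappa>
  proof -
    define S where "S = sqrt (pi / \<kappa>) ^ CARD('n)"
    have S: "S > 0" using k by (simp add: S_def)
    have "sqrt (pi / (2 * \<kappa>)) = sqrt (pi / \<kappa>) / sqrt 2" using k by (simp add: real_sqrt_divide real_sqrt_mult)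
    then have "sqrt (pi / (2 * \<kappa>)) ^ CARD('n) = S / sqrt 2 ^ CARD('n)" by (simp add: S_def power_divide)
    then have "S / sqrt 2 ^ CARD('n) \<le> C * (2 * (S * exp (- (p / \<kappa>)))) powr \<gamma> * (exp (a * q + a\<^sup>2 * d\<^sup>2 / 4 / \<kappa>) * S) powr (1 - \<gamma>)"
      using gaussian_test_inequality[OF r a T \<gamma>' C ineq q k] unfolding p_def S_def by simp
    also have "\<dots> = C * 2 powr \<gamma> * (S powr \<gamma> * S powr (1 - \<gamma>)) * (exp (- (p / \<kappa>)) powr \<gamma> * exp (a * q + a\<^sup>2 * d\<^sup>2 / 4 / \<kappa>) powr (1 - \<gamma>))"
      using S by (simp add: powr_mult mult_ac)
    also have "S powr \<gamma> * S powr (1 - \<gamma>) = S" using S by (simp flip: powr_add)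
    also have "exp (- (p / \<kappa>)) powr \<gamma> * exp (a * q + a\<^sup>2 * d\<^sup>2 / 4 / \<kappa>) powr (1 - \<gamma>) = exp ((1 - \<gamma>) * (a * q)) * exp (- (\<gamma> * p / 2 / \<kappa>))"
    proof -
      have "- (p / \<kappa>) * \<gamma> + (a * q + a\<^sup>2 * d\<^sup>2 / 4 / \<kappa>) * (1 - \<gamma>) = (1 - \<gamma>) * (a * q) + ((1 - \<gamma>) * (a\<^sup>2 * d\<^sup>2 / 4) - \<gamma> * p) / \<kappa>"
        using k by (simp add: field_simps)
      also have "\<dots> = (1 - \<gamma>) * (a * q) + - (\<gamma> * p / 2 / \<kappa>)" unfolding d2 using k by (simp add: field_simps)
      finally show ?thesis by (simp add: exp_powr_real exp_add[symmetric])
    qed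
    finally have "S \<le> S * (K * exp (- (\<gamma> * p / 2 / \<kappa>)))"
      by (simp add: K_def field_simps)
    then show ?thesis using S by simp
  qed
  \<comment> \<open>A value of \<open>\<gamma> * p / 2 / \<kappa>\<close> for which the bound fails.\<close>
  define X where "X = max 1 (ln K + 1)"
  have X: "X > 0" "X \<ge> ln K + 1" by (auto simp: X_def)
  have "1 \<le> K * exp (- (\<gamma> * p / 2 / (\<gamma> * p / 2 / X)))"
    using X \<gamma>' p by (intro bound) auto
  also have "\<gamma> * p / 2 / (\<gamma> * p / 2 / X) = X" using \<gamma>' p X by simp
  also have "K * exp (- X) \<le> K * exp (- (ln K + 1))" using X K by (intro mult_left_mono) auto
  also have "\<dots> = exp (- 1)" using K by (simp add: exp_diff exp_minus inverse_eq_divide)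
  finally show False by simp
qed

section \<open>Observability inequalities\<close>

theorem theorem1p2:
  shows
    "(\<exists>C>0. \<exists>\<theta>\<in>{0<..<1::real}. \<forall>r>0. \<forall>a>0. \<forall>T>0.
        \<forall>u0 \<in> (Cc_infinity :: (real ^ 'n \<Rightarrow> complex) set).
          (LINT x|lborel. (cmod (u0 x))\<^sup>2)
            \<le> C * (1 + r ^ CARD('n) / (a * T) ^ CARD('n))
              * (LINT x:(- cball 0 r)|lborel. (cmod (schroedinger T u0 x))\<^sup>2)
                  powr (\<theta> powr (1 + r / (a * T)))
              * (LINT x|lborel. exp (a * norm x) * (cmod (u0 x))\<^sup>2)
                  powr (1 - \<theta> powr (1 + r / (a * T))))
     \<and>
     (\<exists>C>0. \<forall>r>0. \<forall>a>0. \<forall>T>0. \<forall>\<beta>>1. \<forall>\<gamma>\<in>{0<..<1::real}.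
        \<forall>u0 \<in> (Cc_infinity :: (real ^ 'n \<Rightarrow> complex) set).
          (LINT x|lborel. (cmod (u0 x))\<^sup>2)
            \<le> C * exp ((C powr \<beta> * r powr \<beta> / (a * (1 - \<gamma>) * T powr \<beta>))
                        powr (1 / (\<beta> - 1)))
              * (LINT x:(- cball 0 r)|lborel. (cmod (schroedinger T u0 x))\<^sup>2) powr \<gamma>
              * (LINT x|lborel. exp (a * norm x powr \<beta>) * (cmod (u0 x))\<^sup>2)
                  powr (1 - \<gamma>))
     \<and>
     (\<forall>r>0. \<forall>a>0. \<forall>T>0. \<forall>\<alpha> :: real \<Rightarrow> real.
        mono_on {0<..} \<alpha> \<longrightarrow> ((\<lambda>s. \<alpha> s / s) \<longlongrightarrow> 0) at_top \<longrightarrow>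
        (\<forall>\<gamma>\<in>{0<..<1::real}.
          \<not> (\<exists>C>0. \<forall>u0 \<in> (Cc_infinity :: (real ^ 'n \<Rightarrow> complex) set).
                (LINT x|lborel. (cmod (u0 x))\<^sup>2)
                  \<le> C * (LINT x:(- cball 0 r)|lborel. (cmod (schroedinger T u0 x))\<^sup>2) powr \<gamma>
                    * (LINT x|lborel. exp (a * \<alpha> (norm x)) * (cmod (u0 x))\<^sup>2)
                        powr (1 - \<gamma>))))"
  using observability_exponential_weight[where 'n='n] observability_power_weight[where 'n='n]
  by (intro conjI allI impI ballI no_sublinear_weight) auto

end
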